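(* Let $R$ be a commutative Ding-Chen ring. Then the group ring $R[G]$ is a Ding-Chen ring for any finite group $G$.
   Context: All rings have an identity and all modules are unital. FP-injective dimension: for a (left or right) module $N$ over a ring $S$, $\text{FP-id}(N)$ is the least $n\ge 0$ such that $\operatorname{Ext}^{n+1}_S(F,N)=0$ for all finitely presented $S$-modules $F$ on the same side (and $\infty$ if there is no such $n$). Ding-Chen ring: a ring $S$ that is left and right coherent with $\text{FP-id}({}_SS)=\text{FP-id}(S_S)=n$ for some integer $n\ge 0$. (It is a known result of Ding and Chen that if $S$ is left and right coherent and both $\text{FP-id}({}_SS)$ and $\text{FP-id}(S_S)$ are finite, then they are equal.) *)

theory Defs
  imports "HOL-Algebra.Algebra" "HOL-Library.Extended_Nat"
begin

section \<open>Modules over arbitrary rings\<close>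

text \<open>The locale \<^locale>\<open>module\<close> of the library assumes a commutative ring of scalars.
  We use its record type of modules (the fields \<open>mult\<close> and \<open>one\<close> of which play no
  role for modules) and its notion \<^locale>\<open>submodule\<close>, which makes no assumption on the
  scalars. Right modules over \<open>S\<close> are the left modules over \<open>opp_ring S\<close>.\<close>

locale left_module = R?: ring R + M?: abelian_group M
  for R :: "('a, 'r) ring_scheme" (structure) and M :: "('a, 'b, 'm) module_scheme" (structure) +
  assumes smult_closed [simp, intro]:
      "\<lbrakk>a \<in> carrier R; x \<in> carrier M\<rbrakk> \<Longrightarrow> a \<odot>\<^bsub>M\<^esub> x \<in> carrier M"
    and smult_l_distr:
      "\<lbrakk>a \<in> carrier R; b \<in> carrier R; x \<in> carrier M\<rbrakk> \<Longrightarrow>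
      (a \<oplus> b) \<odot>\<^bsub>M\<^esub> x = a \<odot>\<^bsub>M\<^esub> x \<oplus>\<^bsub>M\<^esub> b \<odot>\<^bsub>M\<^esub> x"
    and smult_r_distr:
      "\<lbrakk>a \<in> carrier R; x \<in> carrier M; y \<in> carrier M\<rbrakk> \<Longrightarrow>
      a \<odot>\<^bsub>M\<^esub> (x \<oplus>\<^bsub>M\<^esub> y) = a \<odot>\<^bsub>M\<^esub> x \<oplus>\<^bsub>M\<^esub> a \<odot>\<^bsub>M\<^esub> y"
    and smult_assoc1:
      "\<lbrakk>a \<in> carrier R; b \<in> carrier R; x \<in> carrier M\<rbrakk> \<Longrightarrow>
      (a \<otimes> b) \<odot>\<^bsub>M\<^esub> x = a \<odot>\<^bsub>M\<^esub> (b \<odot>\<^bsub>M\<^esub> x)"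
    and smult_one [simp]:
      "x \<in> carrier M \<Longrightarrow> \<one> \<odot>\<^bsub>M\<^esub> x = x"

definition opp_ring :: "('a, 'b) ring_scheme \<Rightarrow> ('a, 'b) ring_scheme" where
  "opp_ring S = S\<lparr>monoid.mult := \<lambda>x y. y \<otimes>\<^bsub>S\<^esub> x\<rparr>"

definition regular_module :: "('a, 'b) ring_scheme \<Rightarrow> ('a, 'a) module" where
  "regular_module S =
     \<lparr>carrier = carrier S, monoid.mult = monoid.mult S, one = \<one>\<^bsub>S\<^esub>, ring.zero = \<zero>\<^bsub>S\<^esub>, add = add S,
      smult = monoid.mult S\<rparr>"

definition mod_hom ::
  "('a, 's) ring_scheme \<Rightarrow> ('a, 'b, 'm) module_scheme \<Rightarrow> ('a, 'c, 'n) module_scheme \<Rightarrow> ('b \<Rightarrow> 'c) set"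
  where
  "mod_hom S M N =
     {h \<in> hom (add_monoid M) (add_monoid N).
        \<forall>a\<in>carrier S. \<forall>x\<in>carrier M. h (a \<odot>\<^bsub>M\<^esub> x) = a \<odot>\<^bsub>N\<^esub> h x}"

text \<open>The free left module \<open>S\<^sup>(\<^sup>I\<^sup>)\<close>: finitely supported families, extended by zero outside \<open>I\<close>.\<close>

definition free_module :: "('a, 's) ring_scheme \<Rightarrow> 'i set \<Rightarrow> ('a, 'i \<Rightarrow> 'a) module" where
  "free_module S I =
     \<lparr>carrier = {f. range f \<subseteq> carrier S \<and> (\<forall>i. i \<notin> I \<longrightarrow> f i = \<zero>\<^bsub>S\<^esub>) \<and> finite {i. f i \<noteq> \<zero>\<^bsub>S\<^esub>}},
      monoid.mult = undefined, one = undefined,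
      ring.zero = (\<lambda>i. \<zero>\<^bsub>S\<^esub>), add = (\<lambda>f g i. f i \<oplus>\<^bsub>S\<^esub> g i),
      smult = (\<lambda>a f i. a \<otimes>\<^bsub>S\<^esub> f i)\<rparr>"

text \<open>\<open>M\<close> is finitely presented if there is an exact sequence
  \<open>S\<^sup>m \<rightarrow> S\<^sup>k \<rightarrow> M \<rightarrow> 0\<close>.\<close>

definition finitely_presented ::
  "('a, 's) ring_scheme \<Rightarrow> ('a, 'b, 'm) module_scheme \<Rightarrow> bool" where
  "finitely_presented S M \<longleftrightarrow> left_module S M \<and>
     (\<exists>(k::nat) (m::nat).
       \<exists>f \<in> mod_hom S (free_module S {..<m}) (free_module S {..<k}).
       \<exists>g \<in> mod_hom S (free_module S {..<k}) M.
         g ` carrier (free_module S {..<k}) = carrier M \<and>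
         f ` carrier (free_module S {..<m}) = a_kernel (free_module S {..<k}) M g)"

definition submodule_generated ::
  "('a, 's) ring_scheme \<Rightarrow> ('a, 'b, 'm) module_scheme \<Rightarrow> 'b set \<Rightarrow> 'b set" where
  "submodule_generated S M A = \<Inter> {H. submodule H S M \<and> A \<subseteq> H}"

definition left_coherent :: "('a, 's) ring_scheme \<Rightarrow> bool" where
  "left_coherent S \<longleftrightarrow> ring S \<and>
     (\<forall>A \<subseteq> carrier S. finite A \<longrightarrow>
        finitely_presented S
          ((regular_module S)\<lparr>carrier := submodule_generated S (regular_module S) A\<rparr>))"

definition right_coherent :: "('a, 's) ring_scheme \<Rightarrow> bool" where
  "right_coherent S \<longleftrightarrow> left_coherent (opp_ring S)"


section \<open>Ext and FP-injective dimension\<close>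

text \<open>The abelian group of homomorphisms, written multiplicatively in order to use the library's
  quotient groups. Its elements are normalised to be undefined outside the carrier of \<open>M\<close>.\<close>

definition Hom_group ::
  "('a, 's) ring_scheme \<Rightarrow> ('a, 'b, 'm) module_scheme \<Rightarrow> ('a, 'c, 'n) module_scheme \<Rightarrow> ('b \<Rightarrow> 'c) monoid"
  where
  "Hom_group S M N =
     \<lparr>carrier = mod_hom S M N \<inter> extensional (carrier M),
      monoid.mult = (\<lambda>f g. \<lambda>x\<in>carrier M. f x \<oplus>\<^bsub>N\<^esub> g x),
      one = (\<lambda>x\<in>carrier M. \<zero>\<^bsub>N\<^esub>)\<rparr>"

text \<open>An exact sequence
  \<open>\<dots> \<rightarrow> S\<^sup>(\<^sup>I\<^sup>2\<^sup>) \<rightarrow> S\<^sup>(\<^sup>I\<^sup>1\<^sup>) \<rightarrow> S\<^sup>(\<^sup>I\<^sup>0\<^sup>) \<rightarrow> M \<rightarrow> 0\<close> with the maps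
  \<open>d n\<close> from the \<open>n + 1\<close>-st to the \<open>n\<close>-th free module and the augmentation \<open>e\<close>.\<close>

definition free_resolution ::
  "('a, 's) ring_scheme \<Rightarrow> ('a, 'b, 'm) module_scheme \<Rightarrow> (nat \<Rightarrow> 'i set) \<Rightarrow>
     (nat \<Rightarrow> ('i \<Rightarrow> 'a) \<Rightarrow> ('i \<Rightarrow> 'a)) \<Rightarrow> (('i \<Rightarrow> 'a) \<Rightarrow> 'b) \<Rightarrow> bool" where
  "free_resolution S M I d e \<longleftrightarrow>
     e \<in> mod_hom S (free_module S (I 0)) M \<and>
     e ` carrier (free_module S (I 0)) = carrier M \<and>
     (\<forall>n. d n \<in> mod_hom S (free_module S (I (Suc n))) (free_module S (I n))) \<and>
     d 0 ` carrier (free_module S (I 1)) = a_kernel (free_module S (I 0)) M e \<and>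
     (\<forall>n. d (Suc n) ` carrier (free_module S (I (Suc (Suc n)))) =
           a_kernel (free_module S (I (Suc n))) (free_module S (I n)) (d n))"

text \<open>The \<open>n\<close>-th cohomology group of the complex obtained by applying \<open>Hom(-, N)\<close> to a
  free resolution (with the augmentation removed).\<close>

definition coboundary ::
  "('a, 's) ring_scheme \<Rightarrow> (nat \<Rightarrow> 'i set) \<Rightarrow> (nat \<Rightarrow> ('i \<Rightarrow> 'a) \<Rightarrow> ('i \<Rightarrow> 'a)) \<Rightarrow> nat \<Rightarrow>
     (('i \<Rightarrow> 'a) \<Rightarrow> 'c) \<Rightarrow> (('i \<Rightarrow> 'a) \<Rightarrow> 'c)" where
  "coboundary S I d n h = compose (carrier (free_module S (I (Suc n)))) h (d n)"

definition Hom_cohomology ::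
  "('a, 's) ring_scheme \<Rightarrow> (nat \<Rightarrow> 'i set) \<Rightarrow> (nat \<Rightarrow> ('i \<Rightarrow> 'a) \<Rightarrow> ('i \<Rightarrow> 'a)) \<Rightarrow> nat \<Rightarrow>
     ('a, 'c, 'n) module_scheme \<Rightarrow> (('i \<Rightarrow> 'a) \<Rightarrow> 'c) set monoid" where
  "Hom_cohomology S I d n N =
     (let C = (\<lambda>k. Hom_group S (free_module S (I k)) N);
          Z = kernel (C n) (C (Suc n)) (coboundary S I d n);
          B = (case n of 0 \<Rightarrow> {\<one>\<^bsub>C 0\<^esub>} | Suc k \<Rightarrow> coboundary S I d k ` carrier (C k))
      in (C n)\<lparr>carrier := Z\<rparr> Mod B)"

text \<open>A type of basis elements that is large enough for free resolutions of all modules over \<open>'a\<close>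
  with elements of type \<open>'b\<close>: it contains \<open>'b\<close>, and all formal linear combinations of
  its own elements. Hence a kernel inside a free module on a set of such
  elements can again be covered by a free module on a set of such elements.\<close>

datatype ('a, 'b) res_basis =
  Elem 'b
| Comb "('a \<times> ('a, 'b) res_basis) list"

text \<open>As usual, Ext is computed from an arbitrarily chosen free resolution; the lemma
  \<open>free_resolution_exists\<close> below shows that the choice is never empty.\<close>

definition Ext ::
  "('a, 's) ring_scheme \<Rightarrow> nat \<Rightarrow> ('a, 'b, 'm) module_scheme \<Rightarrow> ('a, 'c, 'n) module_scheme \<Rightarrow>
     ((('a, 'b) res_basis \<Rightarrow> 'a) \<Rightarrow> 'c) set monoid" where
  "Ext S n M N =
     (let (I, d, e) = (SOME (I, d, e). free_resolution S M I d e) in Hom_cohomology S I d n N)"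

text \<open>The test modules \<open>F\<close> range over the finitely presented modules whose elements are sets of
  finite families in \<open>S\<close>. Every finitely presented module is isomorphic to a quotient of some
  \<open>S\<^sup>k\<close> and therefore to one of these; see \<open>finitely_presented_representative\<close> below.\<close>

definition FP_id :: "('a, 's) ring_scheme \<Rightarrow> ('a, 'c, 'n) module_scheme \<Rightarrow> enat" where
  "FP_id S N =
     (let P = (\<lambda>n. \<forall>F :: ('a, (nat \<Rightarrow> 'a) set) module.
                  finitely_presented S F \<longrightarrow> trivial_group (Ext S (n + 1) F N))
      in if \<exists>n. P n then enat (LEAST n. P n) else \<infinity>)"

definition Ding_Chen_ring :: "('a, 's) ring_scheme \<Rightarrow> bool" where
  "Ding_Chen_ring S \<longleftrightarrow> ring S \<and> left_coherent S \<and> right_coherent S \<and>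
     (\<exists>n::nat. FP_id S (regular_module S) = enat n \<and>
               FP_id (opp_ring S) (regular_module (opp_ring S)) = enat n)"


section \<open>Group rings\<close>

text \<open>The elements are the finitely supported functions from the group to \<open>R\<close>, and the product is
  convolution; the sum runs over the support of the first factor.\<close>

definition group_ring ::
  "('a, 's) ring_scheme \<Rightarrow> ('g, 't) monoid_scheme \<Rightarrow> ('g \<Rightarrow> 'a) ring" where
  "group_ring R G =
     \<lparr>carrier = carrier (free_module R (carrier G)),
      monoid.mult = (\<lambda>f h x. if x \<in> carrier G
                then \<Oplus>\<^bsub>R\<^esub>y\<in>{y \<in> carrier G. f y \<noteq> \<zero>\<^bsub>R\<^esub>}. f y \<otimes>\<^bsub>R\<^esub> h (inv\<^bsub>G\<^esub> y \<otimes>\<^bsub>G\<^esub> x)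
                else \<zero>\<^bsub>R\<^esub>),
      one = (\<lambda>x. if x = \<one>\<^bsub>G\<^esub> then \<one>\<^bsub>R\<^esub> else \<zero>\<^bsub>R\<^esub>),
      ring.zero = ring.zero (free_module R (carrier G)),
      add = add (free_module R (carrier G))\<rparr>"


section \<open>The choices made in the definitions\<close>

text \<open>Free resolutions over \<^typ>\<open>('a, 'b) res_basis\<close> always exist, and up to isomorphism the test
  modules in \<open>FP_id\<close> are all finitely presented modules.\<close>

lemma left_module_free_module:
  assumes "ring S"
  shows "left_module S (free_module S I)"
proof -
  interpret S: ring S by fact
  let ?F = "free_module S I"
  have add: "(\<lambda>i. f i \<oplus>\<^bsub>S\<^esub> g i) \<in> carrier ?F" if "f \<in> carrier ?F" "g \<in> carrier ?F" for f g
  proof -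
    have "finite {i. f i \<oplus>\<^bsub>S\<^esub> g i \<noteq> \<zero>\<^bsub>S\<^esub>}"
      by (rule finite_subset[of _ "{i. f i \<noteq> \<zero>\<^bsub>S\<^esub>} \<union> {i. g i \<noteq> \<zero>\<^bsub>S\<^esub>}"])
         (use that in \<open>auto simp: free_module_def\<close>)
    with that show ?thesis by (auto simp: free_module_def image_subset_iff)
  qed
  have smult: "(\<lambda>i. a \<otimes>\<^bsub>S\<^esub> f i) \<in> carrier ?F" if "a \<in> carrier S" "f \<in> carrier ?F" for a f
  proof -
    have "finite {i. a \<otimes>\<^bsub>S\<^esub> f i \<noteq> \<zero>\<^bsub>S\<^esub>}"
      by (rule finite_subset[of _ "{i. f i \<noteq> \<zero>\<^bsub>S\<^esub>}"])
         (use that in \<open>auto simp: free_module_def\<close>)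
    with that show ?thesis by (auto simp: free_module_def image_subset_iff)
  qed
  have neg: "(\<lambda>i. \<ominus>\<^bsub>S\<^esub> f i) \<in> carrier ?F" if "f \<in> carrier ?F" for f
  proof -
    have "finite {i. \<ominus>\<^bsub>S\<^esub> f i \<noteq> \<zero>\<^bsub>S\<^esub>}"
      by (rule finite_subset[of _ "{i. f i \<noteq> \<zero>\<^bsub>S\<^esub>}"])
         (use that in \<open>auto simp: free_module_def\<close>)
    with that show ?thesis by (auto simp: free_module_def image_subset_iff)
  qed
  have C: "f i \<in> carrier S" if "f \<in> carrier ?F" for f i
    using that by (auto simp: free_module_def image_subset_iff)
  have ab: "abelian_group ?F"
  proof (rule abelian_groupI)
    show "\<zero>\<^bsub>?F\<^esub> \<in> carrier ?F" by (auto simp: free_module_def)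
    fix f assume f: "f \<in> carrier ?F"
    show "\<exists>g\<in>carrier ?F. g \<oplus>\<^bsub>?F\<^esub> f = \<zero>\<^bsub>?F\<^esub>"
      by (rule bexI[OF _ neg[OF f]]) (simp add: free_module_def C[OF f] S.l_neg)
  qed (use add C in \<open>simp_all add: free_module_def S.a_ac fun_eq_iff\<close>)
  show ?thesis
    by (intro left_module.intro left_module_axioms.intro assms ab)
       (use smult C in \<open>simp_all add: free_module_def S.l_distr S.r_distr S.m_assoc fun_eq_iff\<close>)
qed

definition linear_extension :: "('a, 's) ring_scheme \<Rightarrow> ('a, 'b, 'm) module_scheme \<Rightarrow> ('i \<Rightarrow> 'b) \<Rightarrow> ('i \<Rightarrow> 'a) \<Rightarrow> 'b"
  where "linear_extension S M \<phi> f = (\<Oplus>\<^bsub>M\<^esub>i\<in>{i. f i \<noteq> \<zero>\<^bsub>S\<^esub>}. f i \<odot>\<^bsub>M\<^esub> \<phi> i)"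

lemma (in left_module) smult_zero [simp]:
  "x \<in> carrier M \<Longrightarrow> \<zero>\<^bsub>R\<^esub> \<odot>\<^bsub>M\<^esub> x = \<zero>\<^bsub>M\<^esub>"
  "a \<in> carrier R \<Longrightarrow> a \<odot>\<^bsub>M\<^esub> \<zero>\<^bsub>M\<^esub> = \<zero>\<^bsub>M\<^esub>"
proof -
  assume x: "x \<in> carrier M"
  have "\<zero>\<^bsub>R\<^esub> \<odot>\<^bsub>M\<^esub> x \<oplus>\<^bsub>M\<^esub> \<zero>\<^bsub>R\<^esub> \<odot>\<^bsub>M\<^esub> x = \<zero>\<^bsub>R\<^esub> \<odot>\<^bsub>M\<^esub> x"
    using x smult_l_distr[of "\<zero>\<^bsub>R\<^esub>" "\<zero>\<^bsub>R\<^esub>" x] by simp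
  then show "\<zero>\<^bsub>R\<^esub> \<odot>\<^bsub>M\<^esub> x = \<zero>\<^bsub>M\<^esub>"
    using x by (metis M.add.r_cancel_one' smult_closed R.zero_closed)
next
  assume a: "a \<in> carrier R"
  have "a \<odot>\<^bsub>M\<^esub> \<zero>\<^bsub>M\<^esub> \<oplus>\<^bsub>M\<^esub> a \<odot>\<^bsub>M\<^esub> \<zero>\<^bsub>M\<^esub> = a \<odot>\<^bsub>M\<^esub> \<zero>\<^bsub>M\<^esub>"
    using a smult_r_distr[of a "\<zero>\<^bsub>M\<^esub>" "\<zero>\<^bsub>M\<^esub>"] by simp
  then show "a \<odot>\<^bsub>M\<^esub> \<zero>\<^bsub>M\<^esub> = \<zero>\<^bsub>M\<^esub>"
    using a by (metis M.add.r_cancel_one' smult_closed M.zero_closed)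
qed

lemma (in left_module) finsum_smult:
  "finite A \<Longrightarrow> a \<in> carrier R \<Longrightarrow> f \<in> A \<rightarrow> carrier M \<Longrightarrow>
     a \<odot>\<^bsub>M\<^esub> (\<Oplus>\<^bsub>M\<^esub>i\<in>A. f i) = (\<Oplus>\<^bsub>M\<^esub>i\<in>A. a \<odot>\<^bsub>M\<^esub> f i)"
  by (induct A rule: finite_induct) (simp_all add: Pi_def smult_r_distr)

text \<open>A submodule is the image of the free module on any family that enumerates it.\<close>

lemma linear_extension_onto:
  assumes "left_module S M" "submodule H S M" "\<phi> ` I = H"
  shows "linear_extension S M \<phi> \<in> mod_hom S (free_module S I) M"
    and "linear_extension S M \<phi> ` carrier (free_module S I) = H"
proof -
  interpret left_module S M by fact
  interpret H: submodule H S M by fact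
  let ?F = "free_module S I" and ?L = "linear_extension S M \<phi>"
  have HM: "H \<subseteq> carrier M" using H.subset by simp
  have \<phi>: "\<phi> i \<in> carrier M" if "i \<in> I" for i using that assms(3) HM by auto
  have C: "f i \<in> carrier S" if "f \<in> carrier ?F" for f i
    using that by (auto simp: free_module_def image_subset_iff)
  have supp: "finite {i. f i \<noteq> \<zero>\<^bsub>S\<^esub>}" "{i. f i \<noteq> \<zero>\<^bsub>S\<^esub>} \<subseteq> I" if "f \<in> carrier ?F" for f
    using that by (auto simp: free_module_def)
  have L: "?L f = (\<Oplus>\<^bsub>M\<^esub>i\<in>T. f i \<odot>\<^bsub>M\<^esub> \<phi> i)"
    if "f \<in> carrier ?F" "finite T" "{i. f i \<noteq> \<zero>\<^bsub>S\<^esub>} \<subseteq> T" "T \<subseteq> I" for f T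
    unfolding linear_extension_def using that C \<phi>
    by (intro M.add.finprod_mono_neutral_cong_left) (auto simp: subset_iff)
  have Lc: "?L f \<in> carrier M" if "f \<in> carrier ?F" for f
    unfolding linear_extension_def using supp[OF that] C[OF that] \<phi>
    by (intro M.finsum_closed) auto
  interpret F: left_module S ?F by (rule left_module_free_module) (rule ring_axioms)
  show "?L \<in> mod_hom S ?F M"
    unfolding mod_hom_def
  proof (intro CollectI conjI ballI homI)
    fix f assume "f \<in> carrier (add_monoid ?F)" then show "?L f \<in> carrier (add_monoid M)"
      using Lc by simp
  next
    fix f g assume "f \<in> carrier (add_monoid ?F)" "g \<in> carrier (add_monoid ?F)"
    then have fg: "f \<in> carrier ?F" "g \<in> carrier ?F" by simp_all
    let ?T = "{i. f i \<noteq> \<zero>\<^bsub>S\<^esub>} \<union> {i. g i \<noteq> \<zero>\<^bsub>S\<^esub>}"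
    have T: "finite ?T" "?T \<subseteq> I" using supp fg by auto
    have fgF: "f \<oplus>\<^bsub>?F\<^esub> g \<in> carrier ?F" using fg by simp
    have sub: "{i. (f \<oplus>\<^bsub>?F\<^esub> g) i \<noteq> \<zero>\<^bsub>S\<^esub>} \<subseteq> ?T" by (auto simp: free_module_def)
    have "?L (f \<oplus>\<^bsub>?F\<^esub> g) = (\<Oplus>\<^bsub>M\<^esub>i\<in>?T. (f \<oplus>\<^bsub>?F\<^esub> g) i \<odot>\<^bsub>M\<^esub> \<phi> i)"
      by (rule L[OF fgF T(1) sub T(2)])
    also have "\<dots> = (\<Oplus>\<^bsub>M\<^esub>i\<in>?T. f i \<odot>\<^bsub>M\<^esub> \<phi> i \<oplus>\<^bsub>M\<^esub> g i \<odot>\<^bsub>M\<^esub> \<phi> i)"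
    proof (rule M.finsum_cong'[OF refl])
      show "(\<lambda>i. f i \<odot>\<^bsub>M\<^esub> \<phi> i \<oplus>\<^bsub>M\<^esub> g i \<odot>\<^bsub>M\<^esub> \<phi> i) \<in> ?T \<rightarrow> carrier M"
        using C[OF fg(1)] C[OF fg(2)] \<phi> T(2) by blast
      fix i assume "i \<in> ?T"
      then have "\<phi> i \<in> carrier M" using \<phi> T(2) by blast
      then show "(f \<oplus>\<^bsub>?F\<^esub> g) i \<odot>\<^bsub>M\<^esub> \<phi> i = f i \<odot>\<^bsub>M\<^esub> \<phi> i \<oplus>\<^bsub>M\<^esub> g i \<odot>\<^bsub>M\<^esub> \<phi> i"
        using smult_l_distr[OF C[OF fg(1)] C[OF fg(2)]] by (simp add: free_module_def)
    qed
    also have "\<dots> = (\<Oplus>\<^bsub>M\<^esub>i\<in>?T. f i \<odot>\<^bsub>M\<^esub> \<phi> i) \<oplus>\<^bsub>M\<^esub> (\<Oplus>\<^bsub>M\<^esub>i\<in>?T. g i \<odot>\<^bsub>M\<^esub> \<phi> i)"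
      by (rule M.finsum_addf) (use C[OF fg(1)] C[OF fg(2)] \<phi> T(2) in blast)+
    also have "\<dots> = ?L f \<oplus>\<^bsub>M\<^esub> ?L g"
      using L[OF fg(1) T(1) _ T(2)] L[OF fg(2) T(1) _ T(2)] by simp
    finally show "?L (f \<otimes>\<^bsub>add_monoid ?F\<^esub> g) = ?L f \<otimes>\<^bsub>add_monoid M\<^esub> ?L g" by simp
  next
    fix a f assume a: "a \<in> carrier S" and f: "f \<in> carrier ?F"
    let ?T = "{i. f i \<noteq> \<zero>\<^bsub>S\<^esub>}"
    have sub: "{i. (a \<odot>\<^bsub>?F\<^esub> f) i \<noteq> \<zero>\<^bsub>S\<^esub>} \<subseteq> ?T" using a by (auto simp: free_module_def)
    have T: "finite ?T" "?T \<subseteq> I" using supp[OF f] by simp_all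
    have "?L (a \<odot>\<^bsub>?F\<^esub> f) = (\<Oplus>\<^bsub>M\<^esub>i\<in>?T. (a \<odot>\<^bsub>?F\<^esub> f) i \<odot>\<^bsub>M\<^esub> \<phi> i)"
      by (rule L[OF F.smult_closed[OF a f] T(1) sub T(2)])
    also have "\<dots> = (\<Oplus>\<^bsub>M\<^esub>i\<in>?T. a \<odot>\<^bsub>M\<^esub> (f i \<odot>\<^bsub>M\<^esub> \<phi> i))"
    proof (rule M.finsum_cong'[OF refl])
      show "(\<lambda>i. a \<odot>\<^bsub>M\<^esub> (f i \<odot>\<^bsub>M\<^esub> \<phi> i)) \<in> ?T \<rightarrow> carrier M"
        using a C[OF f] \<phi> T(2) by blast
      fix i assume "i \<in> ?T"
      then have "\<phi> i \<in> carrier M" using \<phi> T(2) by blast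
      then show "(a \<odot>\<^bsub>?F\<^esub> f) i \<odot>\<^bsub>M\<^esub> \<phi> i = a \<odot>\<^bsub>M\<^esub> (f i \<odot>\<^bsub>M\<^esub> \<phi> i)"
        using smult_assoc1[OF a C[OF f]] by (simp add: free_module_def)
    qed
    also have "\<dots> = a \<odot>\<^bsub>M\<^esub> ?L f"
      unfolding linear_extension_def
      by (rule finsum_smult[OF T(1) a, symmetric]) (use C[OF f] \<phi> T(2) in blast)
    finally show "?L (a \<odot>\<^bsub>?F\<^esub> f) = a \<odot>\<^bsub>M\<^esub> ?L f" .
  qed
  show "?L ` carrier ?F = H"
  proof (intro equalityI subsetI)
    fix x assume "x \<in> ?L ` carrier ?F"
    then obtain f where f: "f \<in> carrier ?F" "x = ?L f" by auto
    have "(\<Oplus>\<^bsub>M\<^esub>i\<in>A. f i \<odot>\<^bsub>M\<^esub> \<phi> i) \<in> H" if "finite A" "A \<subseteq> I" for A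
      using that
    proof (induct A rule: finite_induct)
      case empty then show ?case using H.one_closed by simp
    next
      case (insert i A)
      have "f i \<odot>\<^bsub>M\<^esub> \<phi> i \<in> H"
        using H.smult_closed[OF C[OF f(1)]] insert assms(3) by blast
      then show ?case using insert C[OF f(1)] \<phi> H.m_closed by (simp add: Pi_def subset_iff)
    qed
    from this[of "{i. f i \<noteq> \<zero>\<^bsub>S\<^esub>}"] show "x \<in> H"
      using f(2) supp[OF f(1)] by (simp add: linear_extension_def)
  next
    fix x assume "x \<in> H"
    then obtain i where i: "i \<in> I" "x = \<phi> i" using assms(3) by auto
    let ?e = "\<lambda>j. if j = i then \<one>\<^bsub>S\<^esub> else \<zero>\<^bsub>S\<^esub>"
    have sub: "{j. ?e j \<noteq> \<zero>\<^bsub>S\<^esub>} \<subseteq> {i}" by auto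
    have e: "?e \<in> carrier ?F"
      using i(1) finite_subset[OF sub] by (auto simp: free_module_def)
    have "?L ?e = (\<Oplus>\<^bsub>M\<^esub>j\<in>{i}. ?e j \<odot>\<^bsub>M\<^esub> \<phi> j)"
      by (rule L[OF e _ sub]) (use i in auto)
    also have "\<dots> = \<phi> i" using \<phi>[OF i(1)] by simp
    finally have "?L ?e = x" using i by simp
    with e show "x \<in> ?L ` carrier ?F" by (metis imageI)
  qed
qed

lemma submodule_a_kernel:
  assumes "left_module S M" "left_module S N" "h \<in> mod_hom S M N"
  shows "submodule (a_kernel M N h) S M"
proof -
  interpret M: left_module S M by fact
  interpret N: left_module S N by fact
  have h: "h \<in> hom (add_monoid M) (add_monoid N)"
    and hs: "\<And>a x. a \<in> carrier S \<Longrightarrow> x \<in> carrier M \<Longrightarrow> h (a \<odot>\<^bsub>M\<^esub> x) = a \<odot>\<^bsub>N\<^esub> h x"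
    using assms(3) by (auto simp: mod_hom_def)
  interpret h: group_hom "add_monoid M" "add_monoid N" h
    by (intro group_hom.intro group_hom_axioms.intro h M.a_group N.a_group)
  show ?thesis
    by (intro submodule.intro submodule_axioms.intro)
       (use h.subgroup_kernel in \<open>auto simp: a_kernel_def kernel_def hs\<close>)
qed

lemma free_cover_exists:
  fixes M :: "('a, 'b, 'm) module_scheme" and \<phi> :: "'i \<Rightarrow> 'b"
  assumes "left_module S M" "submodule H S M" "H \<subseteq> range \<phi>"
  shows "\<exists>(I :: 'i set) h. h \<in> mod_hom S (free_module S I) M \<and> h ` carrier (free_module S I) = H"
  using linear_extension_onto[OF assms(1,2), of \<phi> "\<phi> -` H"] assms(3)
  by (metis image_vimage_eq inf.absorb_iff1)

lemma kernel_cover_exists: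
  fixes S :: "('a, 's) ring_scheme" and N :: "('a, 'c, 'n) module_scheme"
    and I :: "('a, 'b) res_basis set"
  assumes "left_module S N" "h \<in> mod_hom S (free_module S I) N"
  shows "\<exists>(J :: ('a, 'b) res_basis set) d.
           d \<in> mod_hom S (free_module S J) (free_module S I) \<and>
           d ` carrier (free_module S J) = a_kernel (free_module S I) N h"
proof (rule free_cover_exists)
  interpret N: left_module S N by fact
  show F: "left_module S (free_module S I)"
    by (rule left_module_free_module) (rule N.ring_axioms)
  show "submodule (a_kernel (free_module S I) N h) S (free_module S I)"
    by (rule submodule_a_kernel[OF F assms])
  define \<phi> :: "('a, 'b) res_basis \<Rightarrow> (('a, 'b) res_basis \<Rightarrow> 'a)" where
    "\<phi> t = (case t of Elem b \<Rightarrow> undefined | Comb l \<Rightarrow>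
        (\<lambda>i. case find (\<lambda>p. snd p = i) l of None \<Rightarrow> \<zero>\<^bsub>S\<^esub> | Some p \<Rightarrow> fst p))" for t
  show "a_kernel (free_module S I) N h \<subseteq> range \<phi>"
  proof
    fix f assume "f \<in> a_kernel (free_module S I) N h"
    then have fin: "finite {i. f i \<noteq> \<zero>\<^bsub>S\<^esub>}"
      by (auto simp: a_kernel_def kernel_def free_module_def)
    then obtain l where l: "set l = {i. f i \<noteq> \<zero>\<^bsub>S\<^esub>}" using finite_list by blast
    have find: "find (\<lambda>p. snd p = i) (map (\<lambda>j. (f j, j)) xs) =
        (if i \<in> set xs then Some (f i, i) else None)" for i xs
      by (induct xs) auto
    have "f = \<phi> (Comb (map (\<lambda>j. (f j, j)) l))"
      unfolding \<phi>_def by (rule ext) (simp add: find l)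
    then show "f \<in> range \<phi>" by blast
  qed
qed

theorem free_resolution_exists:
  fixes S :: "('a, 's) ring_scheme" and M :: "('a, 'b, 'm) module_scheme"
  assumes "left_module S M"
  shows "\<exists>(I :: nat \<Rightarrow> ('a, 'b) res_basis set) d e. free_resolution S M I d e"
proof -
  interpret M: left_module S M by fact
  have free: "left_module S (free_module S I)" for I :: "('a, 'b) res_basis set"
    by (rule left_module_free_module) (rule M.ring_axioms)
  have carrier: "submodule (carrier M) S M"
    by (intro submodule.intro submodule_axioms.intro)
       (use M.add.subgroup_self in auto)
  have range: "carrier M \<subseteq> range (case_res_basis id undefined :: ('a, 'b) res_basis \<Rightarrow> 'b)"
  proof
    fix x show "x \<in> range (case_res_basis id undefined :: ('a, 'b) res_basis \<Rightarrow> 'b)"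
      by (rule range_eqI[of _ _ "Elem x"]) simp
  qed
  obtain I0 :: "('a, 'b) res_basis set" and e where
    e: "e \<in> mod_hom S (free_module S I0) M" "e ` carrier (free_module S I0) = carrier M"
    using free_cover_exists[OF assms carrier range] by blast
  obtain I1 :: "('a, 'b) res_basis set" and d0 where
    d0: "d0 \<in> mod_hom S (free_module S I1) (free_module S I0)"
        "d0 ` carrier (free_module S I1) = a_kernel (free_module S I0) M e"
    using kernel_cover_exists[OF assms e(1)] by blast
  define P where "P = (\<lambda>(n::nat) (I :: ('a, 'b) res_basis set, J :: ('a, 'b) res_basis set, d).
    d \<in> mod_hom S (free_module S J) (free_module S I) \<and> (n = 0 \<longrightarrow> I = I0 \<and> J = I1 \<and> d = d0))"
  define Q where "Q = (\<lambda>(n::nat) (I :: ('a, 'b) res_basis set, J :: ('a, 'b) res_basis set, d)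
      (I' :: ('a, 'b) res_basis set, J' :: ('a, 'b) res_basis set, d').
    I' = J \<and> d' ` carrier (free_module S J') = a_kernel (free_module S J) (free_module S I) d)"
  obtain T where T: "\<And>n. P n (T n)" "\<And>n. Q n (T n) (T (Suc n))"
  proof -
    have "\<exists>T. \<forall>n. P n (T n) \<and> Q n (T n) (T (Suc n))"
    proof (rule dependent_nat_choice)
      show "\<exists>x. P 0 x" using d0 by (auto simp: P_def)
      fix x n assume "P n x"
      moreover obtain I J d where x: "x = (I, J, d)" by (cases x)
      ultimately have "d \<in> mod_hom S (free_module S J) (free_module S I)" by (simp add: P_def)
      from kernel_cover_exists[OF free this] obtain J' :: "('a, 'b) res_basis set" and d' where
        "d' \<in> mod_hom S (free_module S J') (free_module S J)"
        "d' ` carrier (free_module S J') = a_kernel (free_module S J) (free_module S I) d" by blast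
      then have "P (Suc n) (J, J', d') \<and> Q n x (J, J', d')" by (simp add: P_def Q_def x)
      then show "\<exists>y. P (Suc n) y \<and> Q n x y" by blast
    qed
    then show thesis using that by blast
  qed
  define I where "I n = fst (T n)" for n
  define d where "d n = snd (snd (T n))" for n
  have J: "fst (snd (T n)) = I (Suc n)" for n
    using T(2)[of n] by (simp add: Q_def I_def case_prod_beta)
  have T0: "I 0 = I0" "I 1 = I1" "d 0 = d0"
    using T(1)[of 0] J[of 0] by (simp_all add: P_def I_def d_def case_prod_beta)
  have "d n \<in> mod_hom S (free_module S (I (Suc n))) (free_module S (I n))" for n
    using T(1)[of n] J[of n] by (simp add: P_def I_def d_def case_prod_beta)
  moreover have "d (Suc n) ` carrier (free_module S (I (Suc (Suc n)))) =
      a_kernel (free_module S (I (Suc n))) (free_module S (I n)) (d n)" for n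
    using T(2)[of n] J[of n] J[of "Suc n"] by (simp add: Q_def I_def d_def case_prod_beta)
  ultimately have "free_resolution S M I d e"
    unfolding free_resolution_def using e d0 T0 by simp
  then show ?thesis by blast
qed

theorem finitely_presented_representative:
  fixes S :: "('a, 's) ring_scheme" and M :: "('a, 'b, 'm) module_scheme"
  assumes "finitely_presented S M"
  shows "\<exists>(F :: ('a, (nat \<Rightarrow> 'a) set) module) h.
           finitely_presented S F \<and> h \<in> mod_hom S M F \<and> bij_betw h (carrier M) (carrier F)"
proof -
  from assms obtain k m :: nat and f g where lm: "left_module S M"
    and f: "f \<in> mod_hom S (free_module S {..<m}) (free_module S {..<k})"
    and g: "g \<in> mod_hom S (free_module S {..<k}) M"
    and surj: "g ` carrier (free_module S {..<k}) = carrier M"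
    and ex: "f ` carrier (free_module S {..<m}) = a_kernel (free_module S {..<k}) M g"
    unfolding finitely_presented_def by blast
  interpret M: left_module S M by fact
  let ?P = "free_module S {..<k}"
  define h where "h x = {p \<in> carrier ?P. g p = x}" for x
  define u where "u A = (THE x. x \<in> carrier M \<and> h x = A)" for A
  have inj: "x = y" if "x \<in> carrier M" "h x = h y" for x y
  proof -
    from that(1) have "x \<in> g ` carrier ?P" by (simp only: surj)
    then obtain p where "p \<in> carrier ?P" "g p = x" by (elim imageE) simp
    then have "p \<in> h x" by (simp add: h_def)
    then have "p \<in> h y" by (simp only: that(2))
    with \<open>g p = x\<close> show ?thesis by (simp add: h_def)
  qed
  have uh [simp]: "u (h x) = x" if "x \<in> carrier M" for x
    unfolding u_def using that inj by (intro the_equality) auto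
  define F :: "('a, (nat \<Rightarrow> 'a) set) module" where
    "F = \<lparr>carrier = h ` carrier M, monoid.mult = undefined, one = undefined,
          ring.zero = h \<zero>\<^bsub>M\<^esub>, add = \<lambda>A B. h (u A \<oplus>\<^bsub>M\<^esub> u B), smult = \<lambda>a A. h (a \<odot>\<^bsub>M\<^esub> u A)\<rparr>"
  have ab: "abelian_group F"
  proof (rule abelian_groupI)
    fix A assume "A \<in> carrier F"
    then obtain x where "x \<in> carrier M" "A = h x" by (auto simp: F_def)
    then show "\<exists>B\<in>carrier F. B \<oplus>\<^bsub>F\<^esub> A = \<zero>\<^bsub>F\<^esub>"
      by (intro bexI[of _ "h (\<ominus>\<^bsub>M\<^esub> x)"]) (auto simp: F_def M.l_neg)
  next
    fix A B assume "A \<in> carrier F" "B \<in> carrier F"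
    then obtain x y where xy: "x \<in> carrier M" "y \<in> carrier M" "A = h x" "B = h y"
      by (auto simp: F_def)
    then show "A \<oplus>\<^bsub>F\<^esub> B \<in> carrier F" "A \<oplus>\<^bsub>F\<^esub> B = B \<oplus>\<^bsub>F\<^esub> A"
      by (simp_all add: F_def M.a_comm[of x y])
    fix D assume "D \<in> carrier F"
    then obtain z where "z \<in> carrier M" "D = h z" by (auto simp: F_def)
    with xy show "A \<oplus>\<^bsub>F\<^esub> B \<oplus>\<^bsub>F\<^esub> D = A \<oplus>\<^bsub>F\<^esub> (B \<oplus>\<^bsub>F\<^esub> D)"
      by (simp add: F_def M.a_assoc)
  qed (auto simp: F_def)
  have lF: "left_module S F"
    by (intro left_module.intro left_module_axioms.intro ab M.ring_axioms)
       (auto simp: F_def M.smult_l_distr M.smult_r_distr M.smult_assoc1)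
  have hom: "h \<in> mod_hom S M F"
    by (auto simp: mod_hom_def hom_def F_def)
  have bij: "bij_betw h (carrier M) (carrier F)"
    by (auto simp: bij_betw_def F_def intro!: inj_onI inj)
  interpret P: left_module S ?P by (rule left_module_free_module) (rule M.ring_axioms)
  have gc: "g p \<in> carrier M" if "p \<in> carrier ?P" for p
    using imageI[OF that, of g] by (simp only: surj)
  have hg: "(\<lambda>p. h (g p)) \<in> mod_hom S ?P F"
    using g gc by (auto simp: mod_hom_def hom_def F_def)
  have ker: "a_kernel ?P F (\<lambda>p. h (g p)) = a_kernel ?P M g"
  proof -
    have "h (g p) = h \<zero>\<^bsub>M\<^esub> \<longleftrightarrow> g p = \<zero>\<^bsub>M\<^esub>" if "p \<in> carrier ?P" for p
      using inj[OF gc[OF that]] by auto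
    then show ?thesis by (auto simp: a_kernel_def kernel_def F_def)
  qed
  have im: "(\<lambda>p. h (g p)) ` carrier ?P = carrier F"
    by (simp add: F_def image_image flip: surj)
  have "finitely_presented S F"
    unfolding finitely_presented_def
  proof (intro conjI lF exI bexI)
    show "f ` carrier (free_module S {..<m}) = a_kernel ?P F (\<lambda>p. h (g p))"
      using ex ker by simp
  qed (fact im f hg)+
  with hom bij show ?thesis by blast
qed

end

theory Submission
  imports Defs
begin

text \<open>For a finite group \<open>G\<close> the extension \<open>R \<subseteq> R[G]\<close> is a Frobenius extension: \<open>R[G]\<close> is free of
  finite rank as a left \<open>R\<close>-module, and reading off the coefficient at the identity identifies
  \<open>R[G]\<close> with the left \<open>R[G]\<close>-module \<open>Hom\<^sub>R(R[G], R)\<close>. Hence kernels of maps between finite free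
  \<open>R[G]\<close>-modules are finitely generated already over \<open>R\<close>, so that coherence ascends, and
  \<open>Ext\<^sup>k(F, R[G])\<close> over \<open>R[G]\<close> is \<open>Ext\<^sup>k(F, R)\<close> over \<open>R\<close> for every finitely presented
  \<open>R[G]\<close>-module \<open>F\<close>, which is again finitely presented over \<open>R\<close>; so the left FP-injective dimension
  stays finite. As \<open>R\<close> is commutative, \<open>g \<mapsto> g\<^sup>-\<^sup>1\<close> induces an isomorphism of \<open>R[G]\<close> with its
  opposite ring, which gives the right-hand conditions and the equality of both dimensions. A ring
  isomorphism is itself a Frobenius extension of rank one, so a single ascent result serves both
  steps.\<close>


section \<open>Homomorphisms and free modules\<close>

text \<open>\<open>Ext\<close> is the cohomology of one arbitrarily chosen resolution on a fixed
  type of basis elements, and the test modules of \<open>FP_id\<close> live in a type tied to that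
  of the scalars. A resolution over R[G], restricted to R, is neither the chosen one nor on the
  right basis type, and the restricted module is not literally a test module. So independence of the
  resolution, for arbitrary index types and up to isomorphism of the resolved module, must be
  available before two rings can be compared; chain maps and homotopies serve this end. The
  dimension depends on vanishing alone, so no isomorphism of Ext groups is constructed: a cocycle
  with values in R[G] is composed with the coefficient form, bounded over R, and the bounding
  functional is lifted back to an R[G]-linear map. This yields only the direction from the base ring
  to the extension, which is why the isomorphism with the opposite ring is used both ways. The two
  dimensions are then least solutions of the same condition.\<close>

lemma mod_homI:
  assumes "\<And>x. x \<in> carrier M \<Longrightarrow> h x \<in> carrier N"
    and "\<And>x y. x \<in> carrier M \<Longrightarrow> y \<in> carrier M \<Longrightarrow> h (x \<oplus>\<^bsub>M\<^esub> y) = h x \<oplus>\<^bsub>N\<^esub> h y"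
    and "\<And>a x. a \<in> carrier S \<Longrightarrow> x \<in> carrier M \<Longrightarrow> h (a \<odot>\<^bsub>M\<^esub> x) = a \<odot>\<^bsub>N\<^esub> h x"
  shows "h \<in> mod_hom S M N"
  using assms by (auto simp: mod_hom_def hom_def)

lemma mod_homD:
  assumes "h \<in> mod_hom S M N"
  shows "x \<in> carrier M \<Longrightarrow> h x \<in> carrier N"
    and "x \<in> carrier M \<Longrightarrow> y \<in> carrier M \<Longrightarrow> h (x \<oplus>\<^bsub>M\<^esub> y) = h x \<oplus>\<^bsub>N\<^esub> h y"
    and "a \<in> carrier S \<Longrightarrow> x \<in> carrier M \<Longrightarrow> h (a \<odot>\<^bsub>M\<^esub> x) = a \<odot>\<^bsub>N\<^esub> h x"
  using assms by (auto simp: mod_hom_def hom_def)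

lemma mod_hom_zero:
  assumes "left_module S M" "left_module S N" "h \<in> mod_hom S M N"
  shows "h \<zero>\<^bsub>M\<^esub> = \<zero>\<^bsub>N\<^esub>"
proof -
  interpret M: left_module S M by fact
  interpret N: left_module S N by fact
  have "h \<zero>\<^bsub>M\<^esub> \<oplus>\<^bsub>N\<^esub> h \<zero>\<^bsub>M\<^esub> = h \<zero>\<^bsub>M\<^esub>"
    using mod_homD(2)[OF assms(3), of "\<zero>\<^bsub>M\<^esub>" "\<zero>\<^bsub>M\<^esub>"] by simp
  then show ?thesis using mod_homD(1)[OF assms(3)] by (metis M.M.zero_closed N.add.r_cancel_one')
qed

text \<open>A homomorphism is constrained only on the carrier, so it may be changed outside it. This
  lets \<open>restrict\<close> turn homomorphisms into elements of \<open>Hom_group\<close>, which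
  are normalised there.\<close>

lemma mod_hom_cong:
  assumes "left_module S M" "h \<in> mod_hom S M N" "\<And>x. x \<in> carrier M \<Longrightarrow> g x = h x"
  shows "g \<in> mod_hom S M N"
proof -
  interpret M: left_module S M by fact
  show ?thesis by (rule mod_homI) (simp_all add: assms(3) mod_homD[OF assms(2)])
qed

lemma mod_hom_id: "(\<lambda>x. x) \<in> mod_hom S M M"
  by (rule mod_homI) simp_all

lemma mod_hom_comp:
  assumes "f \<in> mod_hom S M N" "g \<in> mod_hom S N P"
  shows "(\<lambda>x. g (f x)) \<in> mod_hom S M P"
  by (rule mod_homI) (simp_all add: mod_homD[OF assms(1)] mod_homD[OF assms(2)])

lemma mod_hom_const_zero:
  assumes "left_module S N"
  shows "(\<lambda>x. \<zero>\<^bsub>N\<^esub>) \<in> mod_hom S M N"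
proof -
  interpret N: left_module S N by fact
  show ?thesis by (rule mod_homI) simp_all
qed

lemma mod_hom_plus:
  assumes "left_module S N" "f \<in> mod_hom S M N" "g \<in> mod_hom S M N"
  shows "(\<lambda>x. f x \<oplus>\<^bsub>N\<^esub> g x) \<in> mod_hom S M N"
proof -
  interpret N: left_module S N by fact
  show ?thesis
    by (rule mod_homI)
      (simp_all add: mod_homD[OF assms(2)] mod_homD[OF assms(3)] N.smult_r_distr N.M.a_ac)
qed

lemma (in abelian_group) eq_if_minus_eq_zero:
  assumes "x \<ominus> y = \<zero>" "x \<in> carrier G" "y \<in> carrier G"
  shows "x = y"
  using assms by (metis a_minus_def minus_equality minus_minus a_inv_closed)

lemma (in left_module) smult_a_inv:
  assumes "a \<in> carrier R" "x \<in> carrier M"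
  shows "a \<odot>\<^bsub>M\<^esub> (\<ominus>\<^bsub>M\<^esub> x) = \<ominus>\<^bsub>M\<^esub> (a \<odot>\<^bsub>M\<^esub> x)"
  using assms smult_r_distr[of a "\<ominus>\<^bsub>M\<^esub> x" x]
  by (intro M.minus_equality[symmetric]) (simp_all add: M.l_neg)

lemma mod_hom_a_inv:
  assumes "left_module S N" "f \<in> mod_hom S M N"
  shows "(\<lambda>x. \<ominus>\<^bsub>N\<^esub> f x) \<in> mod_hom S M N"
proof -
  interpret N: left_module S N by fact
  show ?thesis
    by (rule mod_homI) (simp_all add: mod_homD[OF assms(2)] N.smult_a_inv N.M.minus_add)
qed

lemma mod_hom_minus:
  assumes "left_module S N" "f \<in> mod_hom S M N" "g \<in> mod_hom S M N"
  shows "(\<lambda>x. f x \<ominus>\<^bsub>N\<^esub> g x) \<in> mod_hom S M N"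
  unfolding a_minus_def by (intro mod_hom_plus mod_hom_a_inv assms)

lemma mod_hom_a_inv_apply:
  assumes "left_module S M" "left_module S N" "h \<in> mod_hom S M N" "x \<in> carrier M"
  shows "h (\<ominus>\<^bsub>M\<^esub> x) = \<ominus>\<^bsub>N\<^esub> h x"
proof -
  interpret M: left_module S M by fact
  interpret N: left_module S N by fact
  have "h (\<ominus>\<^bsub>M\<^esub> x) \<oplus>\<^bsub>N\<^esub> h x = \<zero>\<^bsub>N\<^esub>"
    using mod_homD(2)[OF assms(3), of "\<ominus>\<^bsub>M\<^esub> x" x] assms(4) mod_hom_zero[OF assms(1-3)]
    by (simp add: M.M.l_neg)
  then show ?thesis using mod_homD(1)[OF assms(3)] assms(4) by (metis N.M.minus_equality M.M.a_inv_closed)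
qed

lemma mod_hom_minus_apply:
  assumes "left_module S M" "left_module S N" "h \<in> mod_hom S M N" "x \<in> carrier M" "y \<in> carrier M"
  shows "h (x \<ominus>\<^bsub>M\<^esub> y) = h x \<ominus>\<^bsub>N\<^esub> h y"
proof -
  interpret M: left_module S M by fact
  show ?thesis
    using assms(4,5) by (simp add: a_minus_def mod_homD(2)[OF assms(3)] mod_hom_a_inv_apply[OF assms(1-3)])
qed

lemma mod_hom_inverse:
  assumes "left_module S M" "h \<in> mod_hom S M N" "bij_betw h (carrier M) (carrier N)"
  shows "the_inv_into (carrier M) h \<in> mod_hom S N M"
    and "x \<in> carrier M \<Longrightarrow> the_inv_into (carrier M) h (h x) = x"
    and "y \<in> carrier N \<Longrightarrow> h (the_inv_into (carrier M) h y) = y"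
    and "y \<in> carrier N \<Longrightarrow> the_inv_into (carrier M) h y \<in> carrier M"
    and "the_inv_into (carrier M) h ` carrier N = carrier M"
proof -
  interpret M: left_module S M by fact
  let ?g = "the_inv_into (carrier M) h"
  have inj: "inj_on h (carrier M)" and im: "h ` carrier M = carrier N"
    using assms(3) by (auto simp: bij_betw_def)
  show hg: "h (?g y) = y" if "y \<in> carrier N" for y
    using f_the_inv_into_f[OF inj] that im by auto
  show gh: "?g (h x) = x" if "x \<in> carrier M" for x
    using the_inv_into_f_f[OF inj that] .
  show gc: "?g y \<in> carrier M" if "y \<in> carrier N" for y
    using the_inv_into_into[OF inj] that im by auto
  show "?g \<in> mod_hom S N M"
  proof (rule mod_homI)
    fix x y assume xy: "x \<in> carrier N" "y \<in> carrier N"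
    have "?g (h (?g x \<oplus>\<^bsub>M\<^esub> ?g y)) = ?g x \<oplus>\<^bsub>M\<^esub> ?g y" using gc xy by (intro gh) simp
    then show "?g (x \<oplus>\<^bsub>N\<^esub> y) = ?g x \<oplus>\<^bsub>M\<^esub> ?g y"
      using xy by (simp add: mod_homD(2)[OF assms(2)] gc hg)
  next
    fix a x assume ax: "a \<in> carrier S" "x \<in> carrier N"
    have "?g (h (a \<odot>\<^bsub>M\<^esub> ?g x)) = a \<odot>\<^bsub>M\<^esub> ?g x" using gc ax by (intro gh) simp
    then show "?g (a \<odot>\<^bsub>N\<^esub> x) = a \<odot>\<^bsub>M\<^esub> ?g x"
      using ax by (simp add: mod_homD(3)[OF assms(2)] gc hg)
  qed (rule gc)
  show "?g ` carrier N = carrier M"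
    using the_inv_into_onto[OF inj] im by simp
qed

lemma submoduleI:
  assumes "left_module S M" "H \<subseteq> carrier M" "\<zero>\<^bsub>M\<^esub> \<in> H"
    and "\<And>x y. x \<in> H \<Longrightarrow> y \<in> H \<Longrightarrow> x \<oplus>\<^bsub>M\<^esub> y \<in> H"
    and "\<And>a x. a \<in> carrier S \<Longrightarrow> x \<in> H \<Longrightarrow> a \<odot>\<^bsub>M\<^esub> x \<in> H"
    and "\<And>x. x \<in> H \<Longrightarrow> \<ominus>\<^bsub>M\<^esub> x \<in> H"
  shows "submodule H S M"
proof -
  interpret M: left_module S M by fact
  show ?thesis
    by (intro submodule.intro submodule_axioms.intro M.add.subgroupI)
      (use assms in \<open>auto simp: a_inv_def\<close>)
qed

lemma submodule_image:
  assumes "left_module S M" "left_module S N" "h \<in> mod_hom S M N"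
  shows "submodule (h ` carrier M) S N"
proof -
  interpret M: left_module S M by fact
  show ?thesis
  proof (rule submoduleI[OF assms(2)])
    show "\<zero>\<^bsub>N\<^esub> \<in> h ` carrier M"
      using mod_hom_zero[OF assms] by (metis M.M.zero_closed imageI)
  next
    fix x y assume "x \<in> h ` carrier M" "y \<in> h ` carrier M"
    then obtain u v where "u \<in> carrier M" "v \<in> carrier M" "x = h u" "y = h v" by auto
    then show "x \<oplus>\<^bsub>N\<^esub> y \<in> h ` carrier M"
      by (intro image_eqI[of _ _ "u \<oplus>\<^bsub>M\<^esub> v"]) (simp_all add: mod_homD[OF assms(3)])
  next
    fix a x assume "a \<in> carrier S" "x \<in> h ` carrier M"
    then obtain u where "u \<in> carrier M" "x = h u" by auto
    with \<open>a \<in> carrier S\<close> show "a \<odot>\<^bsub>N\<^esub> x \<in> h ` carrier M"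
      by (intro image_eqI[of _ _ "a \<odot>\<^bsub>M\<^esub> u"]) (simp_all add: mod_homD[OF assms(3)])
  next
    fix x assume "x \<in> h ` carrier M"
    then obtain u where "u \<in> carrier M" "x = h u" by auto
    then show "\<ominus>\<^bsub>N\<^esub> x \<in> h ` carrier M"
      by (intro image_eqI[of _ _ "\<ominus>\<^bsub>M\<^esub> u"]) (simp_all add: mod_hom_a_inv_apply[OF assms])
  qed (use mod_homD(1)[OF assms(3)] in auto)
qed

section \<open>Free modules, their unit vectors and lifting along homomorphisms\<close>

lemma mem_free_module:
  "f \<in> carrier (free_module S I) \<longleftrightarrow>
     (\<forall>i. f i \<in> carrier S) \<and> (\<forall>i. i \<notin> I \<longrightarrow> f i = \<zero>\<^bsub>S\<^esub>) \<and> finite {i. f i \<noteq> \<zero>\<^bsub>S\<^esub>}"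
  by (auto simp: free_module_def image_subset_iff)

lemma free_module_sel:
  "f \<oplus>\<^bsub>free_module S I\<^esub> g = (\<lambda>i. f i \<oplus>\<^bsub>S\<^esub> g i)"
  "\<zero>\<^bsub>free_module S I\<^esub> = (\<lambda>i. \<zero>\<^bsub>S\<^esub>)"
  "a \<odot>\<^bsub>free_module S I\<^esub> f = (\<lambda>i. a \<otimes>\<^bsub>S\<^esub> f i)"
  by (simp_all add: free_module_def)

lemma mem_free_module_finite:
  assumes "finite I"
  shows "f \<in> carrier (free_module S I) \<longleftrightarrow> (\<forall>i. f i \<in> carrier S) \<and> (\<forall>i. i \<notin> I \<longrightarrow> f i = \<zero>\<^bsub>S\<^esub>)"
proof -
  have "finite {i. f i \<noteq> \<zero>\<^bsub>S\<^esub>}" if "\<forall>i. i \<notin> I \<longrightarrow> f i = \<zero>\<^bsub>S\<^esub>"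
    by (rule finite_subset[OF _ assms]) (use that in auto)
  then show ?thesis by (auto simp: mem_free_module)
qed

definition unit_vector :: "('a, 's) ring_scheme \<Rightarrow> 'i \<Rightarrow> 'i \<Rightarrow> 'a" where
  "unit_vector S i = (\<lambda>j. if j = i then \<one>\<^bsub>S\<^esub> else \<zero>\<^bsub>S\<^esub>)"

lemma unit_vector_closed:
  assumes "ring S" "i \<in> I"
  shows "unit_vector S i \<in> carrier (free_module S I)"
proof -
  interpret ring S by fact
  have "finite {j. unit_vector S i j \<noteq> \<zero>\<^bsub>S\<^esub>}"
    by (rule finite_subset[of _ "{i}"]) (auto simp: unit_vector_def)
  then show ?thesis using assms(2) by (auto simp: mem_free_module unit_vector_def)
qed

text \<open>Every element is a finite combination of unit vectors. This serves as an induction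
  principle on free modules: it is applied to the kernel of a difference and to the preimage of a
  submodule.\<close>

lemma submodule_free_eq:
  assumes "ring S" "submodule H S (free_module S I)" "\<And>i. i \<in> I \<Longrightarrow> unit_vector S i \<in> H"
  shows "H = carrier (free_module S I)"
proof
  interpret S: ring S by fact
  interpret F: left_module S "free_module S I" by (rule left_module_free_module) fact
  interpret H: submodule H S "free_module S I" by fact
  show "H \<subseteq> carrier (free_module S I)" using H.subset by simp
  \<comment> \<open>The induction runs over any finite set containing the support, so that deleting
    coordinate \<open>j\<close> leaves the induction hypothesis applicable whether or not
    \<open>f j\<close> vanishes.\<close>
  have *: "f \<in> H" if "finite T" "f \<in> carrier (free_module S I)" "{i. f i \<noteq> \<zero>\<^bsub>S\<^esub>} \<subseteq> T" for f T
    using that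
  proof (induct T arbitrary: f rule: finite_induct)
    case empty
    then have "f = \<zero>\<^bsub>free_module S I\<^esub>" by (auto simp: free_module_sel)
    then show ?case using H.one_closed by simp
  next
    case (insert j T)
    let ?g = "\<lambda>i. if i = j then \<zero>\<^bsub>S\<^esub> else f i"
    have "finite {i. ?g i \<noteq> \<zero>\<^bsub>S\<^esub>}"
      by (rule finite_subset[OF _ insert(1)]) (use insert(5) in auto)
    then have "?g \<in> carrier (free_module S I)" using insert(4) by (auto simp: mem_free_module)
    then have g: "?g \<in> H" by (rule insert(3)) (use insert(5) in auto)
    show ?case
    proof (cases "j \<in> I")
      case True
      have fc: "f i \<in> carrier S" for i using insert(4) by (simp add: mem_free_module)
      have "f = ?g \<oplus>\<^bsub>free_module S I\<^esub> f j \<odot>\<^bsub>free_module S I\<^esub> unit_vector S j"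
        using fc by (auto simp: free_module_sel unit_vector_def fun_eq_iff)
      also have "\<dots> \<in> H"
        using H.m_closed[OF g H.smult_closed[OF fc assms(3)[OF True]], of j] by simp
      finally show ?thesis .
    next
      case False
      then have "f = ?g" using insert(4) by (auto simp: mem_free_module)
      then show ?thesis using g by simp
    qed
  qed
  show "carrier (free_module S I) \<subseteq> H"
  proof
    fix f assume f: "f \<in> carrier (free_module S I)"
    then show "f \<in> H" by (intro *[OF _ f order_refl]) (simp add: mem_free_module)
  qed
qed

text \<open>Two homomorphisms agree on the kernel of their difference, which is a submodule and
  contains all unit vectors.\<close>

lemma free_hom_eqI:
  assumes "left_module S M" "g \<in> mod_hom S (free_module S I) M" "h \<in> mod_hom S (free_module S I) M"
    and "\<And>i. i \<in> I \<Longrightarrow> g (unit_vector S i) = h (unit_vector S i)"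
    and "x \<in> carrier (free_module S I)"
  shows "g x = h x"
proof -
  interpret M: left_module S M by fact
  have F: "left_module S (free_module S I)" by (rule left_module_free_module) (rule M.ring_axioms)
  let ?H = "a_kernel (free_module S I) M (\<lambda>x. g x \<ominus>\<^bsub>M\<^esub> h x)"
  have "?H = carrier (free_module S I)"
  proof (rule submodule_free_eq[OF M.ring_axioms])
    show "submodule ?H S (free_module S I)"
      by (intro submodule_a_kernel F assms(1) mod_hom_minus assms(2,3))
    show "unit_vector S i \<in> ?H" if "i \<in> I" for i
      using unit_vector_closed[OF M.ring_axioms that] assms(4)[OF that] mod_homD(1)[OF assms(3)]
      by (simp add: a_kernel_def kernel_def M.M.r_neg a_minus_def)
  qed
  then have "g x \<ominus>\<^bsub>M\<^esub> h x = \<zero>\<^bsub>M\<^esub>" using assms(5) by (auto simp: a_kernel_def kernel_def)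
  then show ?thesis
    using mod_homD(1)[OF assms(2)] mod_homD(1)[OF assms(3)] assms(5) by (simp add: M.M.eq_if_minus_eq_zero)
qed

text \<open>Enlarging the index set by all of \<open>M\<close> makes the family onto, as
  \<open>linear_extension_onto\<close> requires.\<close>

lemma free_hom_exists:
  fixes \<phi> :: "'i \<Rightarrow> 'b"
  assumes "left_module S M" "\<And>i. i \<in> I \<Longrightarrow> \<phi> i \<in> carrier M"
  shows "\<exists>h \<in> mod_hom S (free_module S I) M. \<forall>i\<in>I. h (unit_vector S i) = \<phi> i"
proof -
  interpret M: left_module S M by fact
  have F: "left_module S (free_module S I)" for I :: "'j set"
    by (rule left_module_free_module) (rule M.ring_axioms)
  define \<psi> where "\<psi> = case_sum \<phi> (\<lambda>x::'b. x)"
  let ?J = "I <+> carrier M"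
  let ?L = "linear_extension S M \<psi>"
  define emb where "emb f = case_sum f (\<lambda>x::'b. \<zero>\<^bsub>S\<^esub>)" for f :: "'i \<Rightarrow> 'a"
  have sub: "submodule (carrier M) S M" by (rule submoduleI[OF assms(1)]) auto
  have im: "\<psi> ` ?J = carrier M" using assms(2) by (force simp: \<psi>_def)
  have L: "?L \<in> mod_hom S (free_module S ?J) M"
    by (rule linear_extension_onto(1)[OF assms(1) sub im])
  have emb_c: "emb f \<in> carrier (free_module S ?J)" if "f \<in> carrier (free_module S I)" for f
  proof -
    have "{i. emb f i \<noteq> \<zero>\<^bsub>S\<^esub>} = Inl ` {i. f i \<noteq> \<zero>\<^bsub>S\<^esub>}"
    proof (intro equalityI subsetI)
      fix j assume "j \<in> {i. emb f i \<noteq> \<zero>\<^bsub>S\<^esub>}"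
      then show "j \<in> Inl ` {i. f i \<noteq> \<zero>\<^bsub>S\<^esub>}" by (cases j) (auto simp: emb_def)
    qed (auto simp: emb_def)
    then show ?thesis using that by (auto simp: mem_free_module emb_def split: sum.splits)
  qed
  have emb: "emb \<in> mod_hom S (free_module S I) (free_module S ?J)"
    by (rule mod_homI[OF emb_c])
      (auto simp: free_module_sel emb_def fun_eq_iff mem_free_module split: sum.splits)
  have Le: "?L (unit_vector S j) = \<psi> j" if j: "j \<in> ?J" for j
  proof -
    have c: "\<psi> j \<in> carrier M" using im j by blast
    \<comment> \<open>Over the zero ring a unit vector has empty support and its linear extension is
      zero; \<open>M\<close> is zero as well, so the sum over \<open>{j}\<close> still has the right
      value.\<close>
    have c0: "\<psi> j = \<zero>\<^bsub>M\<^esub>" if "\<one>\<^bsub>S\<^esub> = \<zero>\<^bsub>S\<^esub>"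
      using M.smult_one[OF c] M.smult_zero(1)[OF c] that by simp
    have "?L (unit_vector S j) = (\<Oplus>\<^bsub>M\<^esub>i\<in>{j}. unit_vector S j i \<odot>\<^bsub>M\<^esub> \<psi> i)"
      unfolding linear_extension_def using c
      by (intro M.add.finprod_mono_neutral_cong_left) (auto simp: unit_vector_def c0)
    also have "\<dots> = \<psi> j" using c by (simp add: unit_vector_def)
    finally show ?thesis .
  qed
  have "emb (unit_vector S i) = unit_vector S (Inl i)" for i
    by (auto simp: emb_def unit_vector_def fun_eq_iff split: sum.splits)
  moreover have "?L (unit_vector S (Inl i)) = \<phi> i" if "i \<in> I" for i
    using Le[OF InlI[OF that]] by (simp add: \<psi>_def)
  ultimately show ?thesis
    by (intro bexI[OF _ mod_hom_comp[OF emb L]]) simp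
qed

text \<open>Projectivity of free modules: preimages are chosen for the images of the unit vectors.
  Asking only that the image of \<open>f\<close> lie in that of \<open>h\<close>, instead of
  \<open>h\<close> being onto, makes it applicable to the differentials of a resolution.\<close>

lemma free_hom_lift:
  assumes "left_module S M" "left_module S N" "h \<in> mod_hom S M N" "f \<in> mod_hom S (free_module S I) N"
    and "f ` carrier (free_module S I) \<subseteq> h ` carrier M"
  shows "\<exists>g \<in> mod_hom S (free_module S I) M. \<forall>x \<in> carrier (free_module S I). h (g x) = f x"
proof -
  interpret M: left_module S M by fact
  have "\<exists>m. m \<in> carrier M \<and> h m = f (unit_vector S i)" if "i \<in> I" for i
    using assms(5) unit_vector_closed[OF M.ring_axioms that] by (metis image_iff subsetD)
  then obtain m where m: "\<And>i. i \<in> I \<Longrightarrow> m i \<in> carrier M \<and> h (m i) = f (unit_vector S i)" by metis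
  obtain g where g: "g \<in> mod_hom S (free_module S I) M" "\<forall>i\<in>I. g (unit_vector S i) = m i"
    using free_hom_exists[OF assms(1), of I m] m by blast
  have "h (g x) = f x" if "x \<in> carrier (free_module S I)" for x
    by (rule free_hom_eqI[OF assms(2) mod_hom_comp[OF g(1) assms(3)] assms(4) _ that])
      (use g(2) m in auto)
  with g(1) show ?thesis by blast
qed


section \<open>Finite generation and coherence\<close>

lemma mem_a_kernel: "x \<in> a_kernel M N h \<longleftrightarrow> x \<in> carrier M \<and> h x = \<zero>\<^bsub>N\<^esub>"
  by (simp add: a_kernel_def kernel_def)

lemma left_module_regular:
  assumes "ring S"
  shows "left_module S (regular_module S)"
proof -
  interpret ring S by fact
  have "abelian_group (regular_module S)"
  proof (rule abelian_groupI)
    fix x assume "x \<in> carrier (regular_module S)"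
    then show "\<exists>y\<in>carrier (regular_module S). y \<oplus>\<^bsub>regular_module S\<^esub> x = \<zero>\<^bsub>regular_module S\<^esub>"
      by (intro bexI[of _ "\<ominus>\<^bsub>S\<^esub> x"]) (simp_all add: regular_module_def l_neg)
  qed (simp_all add: regular_module_def a_ac)
  then show ?thesis
    by (intro left_module.intro left_module_axioms.intro assms)
      (simp_all add: regular_module_def l_distr r_distr m_assoc)
qed

lemma left_module_submodule:
  assumes "left_module S M" "submodule H S M"
  shows "left_module S (M\<lparr>carrier := H\<rparr>)"
proof -
  interpret M: left_module S M by fact
  interpret H: submodule H S M by fact
  have sub [simp]: "x \<in> carrier M" if "x \<in> H" for x using that H.subset by auto
  have neg: "\<ominus>\<^bsub>M\<^esub> x \<in> H" if "x \<in> H" for x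
    using H.m_inv_closed[OF that] by (simp add: a_inv_def)
  have "abelian_group (M\<lparr>carrier := H\<rparr>)"
  proof (intro abelian_groupI)
    fix x assume "x \<in> carrier (M\<lparr>carrier := H\<rparr>)"
    then show "\<exists>y\<in>carrier (M\<lparr>carrier := H\<rparr>). y \<oplus>\<^bsub>M\<lparr>carrier := H\<rparr>\<^esub> x = \<zero>\<^bsub>M\<lparr>carrier := H\<rparr>\<^esub>"
      using neg by (intro bexI[of _ "\<ominus>\<^bsub>M\<^esub> x"]) (simp_all add: M.M.l_neg)
  qed (use H.m_closed H.one_closed in \<open>simp_all add: M.M.a_ac\<close>)
  then show ?thesis
    by (intro left_module.intro left_module_axioms.intro M.ring_axioms)
      (simp_all add: H.smult_closed M.smult_l_distr M.smult_r_distr M.smult_assoc1)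
qed

lemma free_module_reindex:
  assumes "ring S" "finite I" "bij_betw \<beta> I J"
  shows "\<exists>h \<in> mod_hom S (free_module S I) (free_module S J).
           bij_betw h (carrier (free_module S I)) (carrier (free_module S J))"
proof -
  interpret ring S by fact
  have J: "finite J" using assms(2,3) bij_betw_finite by blast
  define \<gamma> where "\<gamma> = the_inv_into I \<beta>"
  have \<gamma>: "\<And>j. j \<in> J \<Longrightarrow> \<gamma> j \<in> I" "\<And>j. j \<in> J \<Longrightarrow> \<beta> (\<gamma> j) = j" "\<And>i. i \<in> I \<Longrightarrow> \<gamma> (\<beta> i) = i"
    and \<beta>: "\<And>i. i \<in> I \<Longrightarrow> \<beta> i \<in> J"
    using assms(3) unfolding \<gamma>_def bij_betw_def
    by (auto intro: the_inv_into_into f_the_inv_into_f the_inv_into_f_f)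
  define h where "h = (\<lambda>f j. if j \<in> J then f (\<gamma> j) else \<zero>\<^bsub>S\<^esub>)"
  define h' where "h' = (\<lambda>f i. if i \<in> I then f (\<beta> i) else \<zero>\<^bsub>S\<^esub>)"
  have "h \<in> mod_hom S (free_module S I) (free_module S J)"
    by (rule mod_homI) (auto simp: h_def mem_free_module_finite assms(2) J free_module_sel fun_eq_iff)
  moreover have "bij_betw h (carrier (free_module S I)) (carrier (free_module S J))"
    by (rule bij_betw_byWitness[of _ h'])
      (auto simp: h_def h'_def mem_free_module_finite assms(2) J fun_eq_iff \<gamma> \<beta>)
  ultimately show ?thesis by blast
qed

lemma free_module_reindex_nat:
  assumes "ring S" "finite I"
  obtains h where "h \<in> mod_hom S (free_module S {..<card I}) (free_module S I)"
    "bij_betw h (carrier (free_module S {..<card I})) (carrier (free_module S I))"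
proof -
  obtain \<beta> where "bij_betw \<beta> {..<card I} I"
    using ex_bij_betw_nat_finite[OF assms(2)] by (auto simp: atLeast0LessThan)
  then show thesis using free_module_reindex[OF assms(1) _ \<open>bij_betw \<beta> _ _\<close>] that by blast
qed

text \<open>The index sets \<open>{..<k}\<close> match those in \<open>finitely_presented\<close>;
  \<open>fin_gen_image_free\<close> gives access to any other finite basis, such as the products
  \<open>{..<k} \<times> B\<close> that arise over the base ring.\<close>

definition fin_gen :: "('a, 's) ring_scheme \<Rightarrow> ('a, 'b, 'm) module_scheme \<Rightarrow> 'b set \<Rightarrow> bool" where
  "fin_gen S M H \<longleftrightarrow>
     (\<exists>k::nat. \<exists>f \<in> mod_hom S (free_module S {..<k}) M. f ` carrier (free_module S {..<k}) = H)"

lemma fin_gen_image_free: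
  assumes "ring S" "finite I" "f \<in> mod_hom S (free_module S I) M"
  shows "fin_gen S M (f ` carrier (free_module S I))"
proof -
  obtain h where h: "h \<in> mod_hom S (free_module S {..<card I}) (free_module S I)"
    "bij_betw h (carrier (free_module S {..<card I})) (carrier (free_module S I))"
    using free_module_reindex_nat[OF assms(1,2)] .
  have "(\<lambda>x. f (h x)) ` carrier (free_module S {..<card I}) = f ` carrier (free_module S I)"
    by (simp add: image_image[of f h, symmetric] bij_betw_imp_surj_on[OF h(2)])
  then show ?thesis
    unfolding fin_gen_def using mod_hom_comp[OF h(1) assms(3)] by blast
qed

lemma fin_gen_image:
  assumes "fin_gen S M H" "h \<in> mod_hom S M N"
  shows "fin_gen S N (h ` H)"
proof -
  obtain k :: nat and f where f: "f \<in> mod_hom S (free_module S {..<k}) M"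
    "f ` carrier (free_module S {..<k}) = H"
    using assms(1) unfolding fin_gen_def by blast
  have "(\<lambda>x. h (f x)) ` carrier (free_module S {..<k}) = h ` H"
    by (simp add: image_image flip: f(2))
  with mod_hom_comp[OF f(1) assms(2)] show ?thesis unfolding fin_gen_def by blast
qed

lemma fin_gen_add:
  assumes "left_module S M" "fin_gen S M H" "fin_gen S M K"
  shows "fin_gen S M {x \<oplus>\<^bsub>M\<^esub> y | x y. x \<in> H \<and> y \<in> K}"
proof -
  interpret M: left_module S M by fact
  obtain k l :: nat and f g where f: "f \<in> mod_hom S (free_module S {..<k}) M"
    and fH: "f ` carrier (free_module S {..<k}) = H"
    and g: "g \<in> mod_hom S (free_module S {..<l}) M"
    and gK: "g ` carrier (free_module S {..<l}) = K"
    using assms(2,3) unfolding fin_gen_def by blast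
  \<comment> \<open>The free module on the disjoint union is the direct sum, with projections given
    by composition with \<open>Inl\<close> and \<open>Inr\<close>.\<close>
  let ?F = "free_module S ({..<k} <+> {..<l})"
  have l: "(\<lambda>p. p \<circ> Inl) \<in> mod_hom S ?F (free_module S {..<k})"
    by (rule mod_homI) (auto simp: mem_free_module_finite free_module_sel fun_eq_iff)
  have r: "(\<lambda>p. p \<circ> Inr) \<in> mod_hom S ?F (free_module S {..<l})"
    by (rule mod_homI) (auto simp: mem_free_module_finite free_module_sel fun_eq_iff)
  let ?h = "\<lambda>p. f (p \<circ> Inl) \<oplus>\<^bsub>M\<^esub> g (p \<circ> Inr)"
  have h: "?h \<in> mod_hom S ?F M"
    by (rule mod_hom_plus[OF assms(1) mod_hom_comp[OF l f] mod_hom_comp[OF r g]])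
  have "?h ` carrier ?F = {x \<oplus>\<^bsub>M\<^esub> y | x y. x \<in> H \<and> y \<in> K}"
  proof (intro equalityI subsetI)
    fix z assume "z \<in> ?h ` carrier ?F"
    then show "z \<in> {x \<oplus>\<^bsub>M\<^esub> y | x y. x \<in> H \<and> y \<in> K}"
      using mod_homD(1)[OF l] mod_homD(1)[OF r] fH gK by blast
  next
    fix z assume "z \<in> {x \<oplus>\<^bsub>M\<^esub> y | x y. x \<in> H \<and> y \<in> K}"
    then obtain p q where p: "p \<in> carrier (free_module S {..<k})"
      and q: "q \<in> carrier (free_module S {..<l})" and z: "z = f p \<oplus>\<^bsub>M\<^esub> g q"
      using fH gK by blast
    have "case_sum p q \<in> carrier ?F"
      using p q by (auto simp: mem_free_module_finite split: sum.splits)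
    moreover have "?h (case_sum p q) = z" by (simp add: z case_sum_o_inj)
    ultimately show "z \<in> ?h ` carrier ?F" by blast
  qed
  with fin_gen_image_free[OF M.ring_axioms _ h] show ?thesis by simp
qed

text \<open>Both the cover and the generators of its kernel can be transported along an enumeration
  of \<open>I\<close>, so any finite basis will do for a presentation.\<close>

lemma finitely_presentedI:
  assumes "left_module S M" "finite I" "g \<in> mod_hom S (free_module S I) M"
    and "g ` carrier (free_module S I) = carrier M"
    and "fin_gen S (free_module S I) (a_kernel (free_module S I) M g)"
  shows "finitely_presented S M"
proof -
  interpret M: left_module S M by fact
  have F: "left_module S (free_module S I)" for I :: "'j set"
    by (rule left_module_free_module) (rule M.ring_axioms)
  let ?P = "free_module S {..<card I}" and ?Q = "free_module S I"
  obtain h where h: "h \<in> mod_hom S ?P ?Q" "bij_betw h (carrier ?P) (carrier ?Q)"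
    using free_module_reindex_nat[OF M.ring_axioms assms(2)] .
  note inv = mod_hom_inverse[OF F h]
  let ?h' = "the_inv_into (carrier ?P) h"
  have gen: "fin_gen S ?P (?h' ` a_kernel ?Q M g)"
    by (rule fin_gen_image[OF assms(5) inv(1)])
  have ker: "?h' ` a_kernel ?Q M g = a_kernel ?P M (\<lambda>x. g (h x))"
  proof (intro equalityI subsetI)
    fix x assume "x \<in> a_kernel ?P M (\<lambda>x. g (h x))"
    then show "x \<in> ?h' ` a_kernel ?Q M g"
      by (intro image_eqI[of _ _ "h x"]) (auto simp: mem_a_kernel inv mod_homD[OF h(1)])
  qed (auto simp: mem_a_kernel inv)
  have im: "(\<lambda>x. g (h x)) ` carrier ?P = carrier M"
    by (simp add: image_image[of g h, symmetric] bij_betw_imp_surj_on[OF h(2)] assms(4))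
  obtain m :: nat and f where "f \<in> mod_hom S (free_module S {..<m}) ?P"
    "f ` carrier (free_module S {..<m}) = a_kernel ?P M (\<lambda>x. g (h x))"
    using gen unfolding ker fin_gen_def by blast
  with im mod_hom_comp[OF h(1) assms(3)] show ?thesis
    unfolding finitely_presented_def by (intro conjI assms(1) exI bexI)
qed

text \<open>Schanuel's trick: if \<open>\<phi> u = g\<close> and \<open>g v = \<phi>\<close>, then
  \<open>ker \<phi> = u (ker g) + im (1 - u v)\<close>.\<close>

lemma finitely_presented_kernel:
  assumes "finitely_presented S M" "finite I" "\<phi> \<in> mod_hom S (free_module S I) M"
    and "\<phi> ` carrier (free_module S I) = carrier M"
  shows "fin_gen S (free_module S I) (a_kernel (free_module S I) M \<phi>)"
proof -
  from assms(1) obtain k m :: nat and f g where M: "left_module S M"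
    and f: "f \<in> mod_hom S (free_module S {..<m}) (free_module S {..<k})"
    and g: "g \<in> mod_hom S (free_module S {..<k}) M"
    and surj: "g ` carrier (free_module S {..<k}) = carrier M"
    and ex: "f ` carrier (free_module S {..<m}) = a_kernel (free_module S {..<k}) M g"
    unfolding finitely_presented_def by blast
  interpret M: left_module S M by fact
  have F: "left_module S (free_module S I)" for I :: "'j set"
    by (rule left_module_free_module) (rule M.ring_axioms)
  let ?P = "free_module S {..<k}" and ?Q = "free_module S I"
  interpret Q: left_module S ?Q by (rule F)
  obtain u where u: "u \<in> mod_hom S ?P ?Q" "\<And>x. x \<in> carrier ?P \<Longrightarrow> \<phi> (u x) = g x"
    using free_hom_lift[OF F M assms(3) g] surj assms(4) by auto
  obtain v where v: "v \<in> mod_hom S ?Q ?P" "\<And>x. x \<in> carrier ?Q \<Longrightarrow> g (v x) = \<phi> x"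
    using free_hom_lift[OF F M g assms(3)] surj assms(4) by auto
  let ?w = "\<lambda>x. x \<ominus>\<^bsub>?Q\<^esub> u (v x)"
  have w: "?w \<in> mod_hom S ?Q ?Q"
    by (rule mod_hom_minus[OF F mod_hom_id mod_hom_comp[OF v(1) u(1)]])
  have "fin_gen S ?P (a_kernel ?P M g)" using f ex unfolding fin_gen_def by blast
  then have gen: "fin_gen S ?Q {x \<oplus>\<^bsub>?Q\<^esub> y | x y. x \<in> u ` a_kernel ?P M g \<and> y \<in> ?w ` carrier ?Q}"
    by (intro fin_gen_add F fin_gen_image_free w M.ring_axioms assms(2)) (rule fin_gen_image[OF _ u(1)])
  have \<phi>w: "\<phi> (?w x) = \<zero>\<^bsub>M\<^esub>" if x: "x \<in> carrier ?Q" for x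
  proof -
    have vx: "v x \<in> carrier ?P" and uvx: "u (v x) \<in> carrier ?Q"
      using mod_homD(1)[OF v(1)] mod_homD(1)[OF u(1)] x by blast+
    have "\<phi> (?w x) = \<phi> x \<ominus>\<^bsub>M\<^esub> \<phi> (u (v x))"
      by (rule mod_hom_minus_apply[OF F M assms(3) x uvx])
    also have "\<phi> (u (v x)) = \<phi> x" using u(2)[OF vx] v(2)[OF x] by simp
    finally show ?thesis using mod_homD(1)[OF assms(3) x] by (simp add: a_minus_def M.M.r_neg)
  qed
  have "{x \<oplus>\<^bsub>?Q\<^esub> y | x y. x \<in> u ` a_kernel ?P M g \<and> y \<in> ?w ` carrier ?Q} = a_kernel ?Q M \<phi>"
  proof (intro equalityI subsetI)
    fix z assume "z \<in> {x \<oplus>\<^bsub>?Q\<^esub> y | x y. x \<in> u ` a_kernel ?P M g \<and> y \<in> ?w ` carrier ?Q}"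
    then obtain x y where "x \<in> carrier ?P" "g x = \<zero>\<^bsub>M\<^esub>" "y \<in> carrier ?Q" "z = u x \<oplus>\<^bsub>?Q\<^esub> ?w y"
      by (auto simp: mem_a_kernel)
    then show "z \<in> a_kernel ?Q M \<phi>"
      using mod_homD(1)[OF w] mod_homD(1)[OF u(1)]
      by (simp add: mem_a_kernel mod_homD(2)[OF assms(3)] u \<phi>w)
  next
    fix z assume z: "z \<in> a_kernel ?Q M \<phi>"
    then have "v z \<in> a_kernel ?P M g" by (simp add: mem_a_kernel v mod_homD(1)[OF v(1)])
    moreover have zc: "z \<in> carrier ?Q" using z by (simp add: mem_a_kernel)
    have "u (v z) \<in> carrier ?Q" using mod_homD(1)[OF u(1)] mod_homD(1)[OF v(1)] zc by blast
    then have "z = u (v z) \<oplus>\<^bsub>?Q\<^esub> ?w z"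
      using zc by (simp add: a_minus_def Q.M.a_lcomm Q.M.r_neg)
    ultimately show "z \<in> {x \<oplus>\<^bsub>?Q\<^esub> y | x y. x \<in> u ` a_kernel ?P M g \<and> y \<in> ?w ` carrier ?Q}"
      using zc by blast
  qed
  with gen show ?thesis by simp
qed

lemma submodule_vimage:
  assumes "left_module S M" "left_module S N" "h \<in> mod_hom S M N" "submodule H S N"
  shows "submodule {x \<in> carrier M. h x \<in> H} S M"
proof -
  interpret M: left_module S M by fact
  interpret H: submodule H S N by fact
  have "\<ominus>\<^bsub>N\<^esub> x \<in> H" if "x \<in> H" for x
    using H.m_inv_closed[OF that] by (simp add: a_inv_def)
  then show ?thesis
    by (intro submoduleI[OF assms(1)])
      (use H.m_closed H.one_closed H.smult_closed in
        \<open>auto simp: mod_homD[OF assms(3)] mod_hom_zero[OF assms(1-3)] mod_hom_a_inv_apply[OF assms(1-3)]\<close>)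
qed

text \<open>The preimage of any submodule containing the generators contains all unit vectors, hence
  is everything. This connects ideals given by generators, as in \<open>left_coherent\<close>, with
  images of free modules.\<close>

lemma free_image_eq_submodule_generated:
  assumes "left_module S M" "f \<in> mod_hom S (free_module S I) M"
  shows "f ` carrier (free_module S I) = submodule_generated S M ((\<lambda>i. f (unit_vector S i)) ` I)"
    (is "?L = ?R")
proof
  interpret M: left_module S M by fact
  have F: "left_module S (free_module S I)"
    by (rule left_module_free_module) (rule M.ring_axioms)
  show "?R \<subseteq> ?L"
    unfolding submodule_generated_def
  proof (rule Inter_lower, intro CollectI conjI image_subsetI)
    show "submodule ?L S M" by (rule submodule_image[OF F assms])
    show "f (unit_vector S i) \<in> ?L" if "i \<in> I" for i
      by (rule imageI[OF unit_vector_closed[OF M.ring_axioms that]])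
  qed
  show "?L \<subseteq> ?R"
    unfolding submodule_generated_def
  proof (rule Inter_greatest)
    fix H assume "H \<in> {H. submodule H S M \<and> (\<lambda>i. f (unit_vector S i)) ` I \<subseteq> H}"
    then have H: "submodule H S M" "\<And>i. i \<in> I \<Longrightarrow> f (unit_vector S i) \<in> H" by auto
    have "{x \<in> carrier (free_module S I). f x \<in> H} = carrier (free_module S I)"
      by (rule submodule_free_eq[OF M.ring_axioms submodule_vimage[OF F assms H(1)]])
        (simp add: H unit_vector_closed[OF M.ring_axioms])
    then show "?L \<subseteq> H" by blast
  qed
qed

text \<open>Coherence supplies some finite presentation of the image ideal; by Schanuel's trick the
  kernel of the particular cover \<open>f\<close> is then finitely generated too. Together with
  \<open>left_coherentI\<close> this turns coherence into a condition on kernels of maps from finite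
  free modules to the ring, the form in which it ascends.\<close>

lemma left_coherent_kernel:
  assumes "left_coherent S" "finite I" "f \<in> mod_hom S (free_module S I) (regular_module S)"
  shows "fin_gen S (free_module S I) (a_kernel (free_module S I) (regular_module S) f)"
proof -
  interpret ring S using assms(1) by (simp add: left_coherent_def)
  let ?J = "f ` carrier (free_module S I)" and ?A = "(\<lambda>i. f (unit_vector S i)) ` I"
  let ?M = "(regular_module S)\<lparr>carrier := ?J\<rparr>"
  have "f (unit_vector S i) \<in> carrier S" if "i \<in> I" for i
    using mod_homD(1)[OF assms(3) unit_vector_closed[OF ring_axioms that]] by (simp add: regular_module_def)
  then have A: "?A \<subseteq> carrier S" "finite ?A" using assms(2) by auto
  have "?J = submodule_generated S (regular_module S) ?A"
    by (rule free_image_eq_submodule_generated[OF left_module_regular[OF ring_axioms] assms(3)])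
  then have fp: "finitely_presented S ?M" using assms(1) A by (auto simp: left_coherent_def)
  \<comment> \<open>Shrinking the target to the image makes \<open>f\<close> onto without changing
    its kernel.\<close>
  have "f \<in> mod_hom S (free_module S I) ?M"
    by (rule mod_homI) (auto simp: mod_homD[OF assms(3)])
  from finitely_presented_kernel[OF fp assms(2) this]
  show ?thesis by (simp add: a_kernel_def kernel_def)
qed

lemma left_coherentI:
  assumes "ring S"
    and "\<And>(k::nat) f. f \<in> mod_hom S (free_module S {..<k}) (regular_module S) \<Longrightarrow>
      fin_gen S (free_module S {..<k}) (a_kernel (free_module S {..<k}) (regular_module S) f)"
  shows "left_coherent S"
  unfolding left_coherent_def
proof (intro conjI allI impI)
  fix A assume A: "A \<subseteq> carrier S" "finite A"
  let ?k = "card A" and ?M = "regular_module S"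
  have reg: "left_module S ?M" by (rule left_module_regular) fact
  obtain \<beta> where \<beta>: "bij_betw \<beta> {..<?k} A"
    using ex_bij_betw_nat_finite[OF A(2)] by (auto simp: atLeast0LessThan)
  let ?F = "free_module S {..<?k}"
  have "\<beta> i \<in> carrier ?M" if "i \<in> {..<?k}" for i
    using that A(1) bij_betwE[OF \<beta>] by (auto simp: regular_module_def)
  then obtain f where f: "f \<in> mod_hom S ?F ?M" "\<forall>i\<in>{..<?k}. f (unit_vector S i) = \<beta> i"
    using free_hom_exists[OF reg, of "{..<?k}" \<beta>] by blast
  have "(\<lambda>i. f (unit_vector S i)) ` {..<?k} = A"
    using f(2) bij_betw_imp_surj_on[OF \<beta>] by auto
  then have im: "f ` carrier ?F = submodule_generated S ?M A"
    using free_image_eq_submodule_generated[OF reg f(1)] by simp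
  let ?N = "?M\<lparr>carrier := submodule_generated S ?M A\<rparr>"
  have F: "left_module S ?F" by (rule left_module_free_module) fact
  show "finitely_presented S ?N"
  proof (rule finitely_presentedI)
    show "left_module S ?N"
      using left_module_submodule[OF reg submodule_image[OF F reg f(1)]] im by simp
    show "f \<in> mod_hom S ?F ?N"
      by (rule mod_homI) (use im in \<open>auto simp: mod_homD[OF f(1)]\<close>)
    show "fin_gen S ?F (a_kernel ?F ?N f)"
      using assms(2)[OF f(1)] by (simp add: a_kernel_def kernel_def)
  qed (use im in auto)
qed fact

text \<open>This is the kernel of a map into the free module on \<open>K\<close>, treated one
  coordinate at a time. The common kernel of the earlier functionals is the image of a finite free
  module under some \<open>f\<close>; the kernel of the next functional composed with
  \<open>f\<close> is finitely generated, and \<open>f\<close> maps it onto the smaller common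
  kernel.\<close>

lemma left_coherent_common_kernel:
  assumes "left_coherent S" "finite I" "finite K"
    and "\<And>k. k \<in> K \<Longrightarrow> \<phi> k \<in> mod_hom S (free_module S I) (regular_module S)"
  shows "fin_gen S (free_module S I) {x \<in> carrier (free_module S I). \<forall>k\<in>K. \<phi> k x = \<zero>\<^bsub>S\<^esub>}"
  using assms(3,4)
proof (induct K rule: finite_induct)
  case empty
  interpret ring S using assms(1) by (simp add: left_coherent_def)
  show ?case using fin_gen_image_free[OF ring_axioms assms(2) mod_hom_id] by simp
next
  case (insert k K)
  have "fin_gen S (free_module S I) {x \<in> carrier (free_module S I). \<forall>k\<in>K. \<phi> k x = \<zero>\<^bsub>S\<^esub>}"
    by (rule insert(3)) (simp add: insert(4))
  then obtain l :: nat and f where f: "f \<in> mod_hom S (free_module S {..<l}) (free_module S I)"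
    and im: "f ` carrier (free_module S {..<l}) =
      {x \<in> carrier (free_module S I). \<forall>k\<in>K. \<phi> k x = \<zero>\<^bsub>S\<^esub>}"
    unfolding fin_gen_def by blast
  let ?P = "free_module S {..<l}" and ?N = "regular_module S"
  have "fin_gen S ?P (a_kernel ?P ?N (\<lambda>x. \<phi> k (f x)))"
    by (rule left_coherent_kernel[OF assms(1) _ mod_hom_comp[OF f]]) (use insert in auto)
  from fin_gen_image[OF this f]
  have "fin_gen S (free_module S I) (f ` a_kernel ?P ?N (\<lambda>x. \<phi> k (f x)))" .
  also have "f ` a_kernel ?P ?N (\<lambda>x. \<phi> k (f x)) = {x \<in> f ` carrier ?P. \<phi> k x = \<zero>\<^bsub>S\<^esub>}"
    by (auto simp: mem_a_kernel regular_module_def)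
  also have "\<dots> = {x \<in> carrier (free_module S I). \<forall>k\<in>insert k K. \<phi> k x = \<zero>\<^bsub>S\<^esub>}"
    by (auto simp: im)
  finally show ?case .
qed


section \<open>Comparison of resolutions\<close>

lemma (in normal) trivial_factorgroup_iff: "trivial_group (G Mod H) \<longleftrightarrow> H = carrier G"
proof
  assume "trivial_group (G Mod H)"
  then have c: "rcosets H = {H}" by (simp add: trivial_group_def FactGroup_def)
  have "x \<in> H" if "x \<in> carrier G" for x
  proof -
    have "H #> x = H" using rcosetsI[OF subset that] c by simp
    then show ?thesis using rcos_self[OF that subgroup_axioms] by simp
  qed
  then show "H = carrier G" using subset by blast
next
  assume H: "H = carrier G"
  have "carrier G #> x = carrier G" if "x \<in> carrier G" for x
    using coset_join2[OF that subgroup_self that] .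
  then have "rcosets H = {H}" unfolding H RCOSETS_def by auto
  then show "trivial_group (G Mod H)"
    using factorgroup_is_group by (simp add: trivial_group_def FactGroup_def)
qed

lemma (in abelian_group) minus_self: "x \<in> carrier G \<Longrightarrow> x \<ominus> x = \<zero>"
  by (simp add: a_minus_def r_neg)

text \<open>Commutativity is what makes the coboundaries normal in the cocycles, so that the
  quotient in \<open>Hom_cohomology\<close> is a group.\<close>

lemma comm_group_Hom_group:
  assumes "left_module S M" "left_module S N"
  shows "comm_group (Hom_group S M N)"
proof -
  interpret M: left_module S M by fact
  interpret N: left_module S N by fact
  have r: "restrict f (carrier M) \<in> carrier (Hom_group S M N)" if "f \<in> mod_hom S M N" for f
    using mod_hom_cong[OF assms(1) that, of "restrict f (carrier M)"] by (simp add: Hom_group_def)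
  show ?thesis
  proof (rule comm_groupI)
    fix f g h assume "f \<in> carrier (Hom_group S M N)" "g \<in> carrier (Hom_group S M N)"
    then have fg: "f \<in> mod_hom S M N" "g \<in> mod_hom S M N" by (auto simp: Hom_group_def)
    show "f \<otimes>\<^bsub>Hom_group S M N\<^esub> g \<in> carrier (Hom_group S M N)"
      using r[OF mod_hom_plus[OF assms(2) fg]] by (simp add: Hom_group_def)
    show "f \<otimes>\<^bsub>Hom_group S M N\<^esub> g = g \<otimes>\<^bsub>Hom_group S M N\<^esub> f"
      by (auto simp: Hom_group_def fun_eq_iff mod_homD(1)[OF fg(1)] mod_homD(1)[OF fg(2)] N.M.a_comm)
    assume "h \<in> carrier (Hom_group S M N)"
    then have h: "h \<in> mod_hom S M N" by (auto simp: Hom_group_def)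
    show "f \<otimes>\<^bsub>Hom_group S M N\<^esub> g \<otimes>\<^bsub>Hom_group S M N\<^esub> h = f \<otimes>\<^bsub>Hom_group S M N\<^esub> (g \<otimes>\<^bsub>Hom_group S M N\<^esub> h)"
      by (auto simp: Hom_group_def fun_eq_iff mod_homD(1)[OF fg(1)] mod_homD(1)[OF fg(2)]
          mod_homD(1)[OF h] N.M.a_assoc)
  next
    show "\<one>\<^bsub>Hom_group S M N\<^esub> \<in> carrier (Hom_group S M N)"
      using r[OF mod_hom_const_zero[OF assms(2)]] by (simp add: Hom_group_def)
  next
    fix f assume "f \<in> carrier (Hom_group S M N)"
    then have f: "f \<in> mod_hom S M N" "f \<in> extensional (carrier M)" by (auto simp: Hom_group_def)
    show "\<one>\<^bsub>Hom_group S M N\<^esub> \<otimes>\<^bsub>Hom_group S M N\<^esub> f = f"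
      using f(2) by (auto simp: Hom_group_def fun_eq_iff mod_homD(1)[OF f(1)] extensional_def)
    show "\<exists>g\<in>carrier (Hom_group S M N). g \<otimes>\<^bsub>Hom_group S M N\<^esub> f = \<one>\<^bsub>Hom_group S M N\<^esub>"
      by (rule bexI[OF _ r[OF mod_hom_a_inv[OF assms(2) f(1)]]])
        (auto simp: Hom_group_def fun_eq_iff mod_homD(1)[OF f(1)] N.M.l_neg)
  qed
qed

text \<open>Vanishing of the cohomology in degree \<open>Suc n\<close>, in terms of elements. Maps
  are compared on carriers only, so the normalisation outside them no longer has to be carried
  along. The shift by one fits \<open>FP_id\<close>, where \<open>n\<close> stands for vanishing in
  degree \<open>n + 1\<close>.\<close>

definition Hom_acyclic ::
  "('a, 's) ring_scheme \<Rightarrow> (nat \<Rightarrow> 'i set) \<Rightarrow> (nat \<Rightarrow> ('i \<Rightarrow> 'a) \<Rightarrow> ('i \<Rightarrow> 'a)) \<Rightarrow> nat \<Rightarrow>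
     ('a, 'c, 'n) module_scheme \<Rightarrow> bool" where
  "Hom_acyclic S I d n N \<longleftrightarrow>
     (\<forall>z \<in> mod_hom S (free_module S (I (Suc n))) N.
        (\<forall>x \<in> carrier (free_module S (I (Suc (Suc n)))). z (d (Suc n) x) = \<zero>\<^bsub>N\<^esub>) \<longrightarrow>
        (\<exists>w \<in> mod_hom S (free_module S (I n)) N.
           \<forall>x \<in> carrier (free_module S (I (Suc n))). z x = w (d n x)))"

lemma free_resolutionD:
  assumes "ring S" "left_module S M" "free_resolution S M I d e"
  shows "e \<in> mod_hom S (free_module S (I 0)) M"
    and "e ` carrier (free_module S (I 0)) = carrier M"
    and "d n \<in> mod_hom S (free_module S (I (Suc n))) (free_module S (I n))"
    and "x \<in> carrier (free_module S (I (Suc 0))) \<Longrightarrow> e (d 0 x) = \<zero>\<^bsub>M\<^esub>"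
    and "x \<in> carrier (free_module S (I (Suc (Suc n)))) \<Longrightarrow> d n (d (Suc n) x) = \<zero>\<^bsub>free_module S (I n)\<^esub>"
    and "y \<in> carrier (free_module S (I 0)) \<Longrightarrow> e y = \<zero>\<^bsub>M\<^esub> \<Longrightarrow>
      y \<in> d 0 ` carrier (free_module S (I (Suc 0)))"
    and "y \<in> carrier (free_module S (I (Suc n))) \<Longrightarrow> d n y = \<zero>\<^bsub>free_module S (I n)\<^esub> \<Longrightarrow>
      y \<in> d (Suc n) ` carrier (free_module S (I (Suc (Suc n))))"
proof -
  show "e \<in> mod_hom S (free_module S (I 0)) M" "e ` carrier (free_module S (I 0)) = carrier M"
    "d n \<in> mod_hom S (free_module S (I (Suc n))) (free_module S (I n))"
    using assms(3) by (simp_all add: free_resolution_def)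
  have k: "d 0 ` carrier (free_module S (I (Suc 0))) = a_kernel (free_module S (I 0)) M e"
    "d (Suc n) ` carrier (free_module S (I (Suc (Suc n)))) =
      a_kernel (free_module S (I (Suc n))) (free_module S (I n)) (d n)"
    using assms(3) by (simp_all add: free_resolution_def)
  show "x \<in> carrier (free_module S (I (Suc 0))) \<Longrightarrow> e (d 0 x) = \<zero>\<^bsub>M\<^esub>"
    "y \<in> carrier (free_module S (I 0)) \<Longrightarrow> e y = \<zero>\<^bsub>M\<^esub> \<Longrightarrow>
      y \<in> d 0 ` carrier (free_module S (I (Suc 0)))"
    using k(1) by (auto simp: mem_a_kernel set_eq_iff image_iff)
  show "x \<in> carrier (free_module S (I (Suc (Suc n)))) \<Longrightarrow> d n (d (Suc n) x) = \<zero>\<^bsub>free_module S (I n)\<^esub>"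
    "y \<in> carrier (free_module S (I (Suc n))) \<Longrightarrow> d n y = \<zero>\<^bsub>free_module S (I n)\<^esub> \<Longrightarrow>
      y \<in> d (Suc n) ` carrier (free_module S (I (Suc (Suc n))))"
    using k(2) by (auto simp: mem_a_kernel set_eq_iff image_iff)
qed

text \<open>The quotient of cocycles by coboundaries is trivial exactly if both subgroups coincide.
  In positive degree the coboundaries are an image, so the exceptional clause for degree zero does
  not arise.\<close>

lemma trivial_Hom_cohomology_iff:
  assumes "left_module S M" "left_module S N" "free_resolution S M I d e"
  shows "trivial_group (Hom_cohomology S I d (Suc n) N) \<longleftrightarrow> Hom_acyclic S I d n N"
proof -
  interpret M: left_module S M by fact
  interpret N: left_module S N by fact
  note R = free_resolutionD[OF M.ring_axioms assms(1,3)]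
  let ?F = "\<lambda>k. free_module S (I k)"
  define C where "C = (\<lambda>k. Hom_group S (?F k) N)"
  have F: "left_module S (?F k)" for k by (rule left_module_free_module) (rule M.ring_axioms)
  have G: "comm_group (C k)" for k unfolding C_def by (rule comm_group_Hom_group[OF F assms(2)])
  have cC: "f \<in> carrier (C k) \<longleftrightarrow> f \<in> mod_hom S (?F k) N \<and> f \<in> extensional (carrier (?F k))" for f k
    by (auto simp: C_def Hom_group_def)
  have r: "restrict f (carrier (?F k)) \<in> carrier (C k)" if "f \<in> mod_hom S (?F k) N" for f k
    using mod_hom_cong[OF F that, of "restrict f (carrier (?F k))"] by (simp add: cC)
  let ?\<delta> = "coboundary S I d"
  have \<delta>: "?\<delta> k f = (\<lambda>x\<in>carrier (?F (Suc k)). f (d k x))" for k f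
    by (simp add: coboundary_def compose_def)
  have hom: "?\<delta> k \<in> hom (C k) (C (Suc k))" for k
  proof (rule homI)
    fix f g assume f: "f \<in> carrier (C k)" and g: "g \<in> carrier (C k)"
    show "?\<delta> k f \<in> carrier (C (Suc k))"
      unfolding \<delta> by (rule r) (use f cC mod_hom_comp[OF R(3)] in blast)
    show "?\<delta> k (f \<otimes>\<^bsub>C k\<^esub> g) = ?\<delta> k f \<otimes>\<^bsub>C (Suc k)\<^esub> ?\<delta> k g"
      unfolding \<delta> by (auto simp: C_def Hom_group_def fun_eq_iff mod_homD(1)[OF R(3)])
  qed
  have gh: "group_hom (C k) (C (Suc k)) (?\<delta> k)" for k
    using G hom by (intro group_hom.intro group_hom_axioms.intro) (auto simp: comm_group_def)
  let ?Z = "kernel (C (Suc n)) (C (Suc (Suc n))) (?\<delta> (Suc n))" and ?B = "?\<delta> n ` carrier (C n)"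
  have Z: "subgroup ?Z (C (Suc n))" by (rule group_hom.subgroup_kernel[OF gh])
  have B: "subgroup ?B (C (Suc n))" by (rule group_hom.img_is_subgroup[OF gh])
  have mem_Z: "f \<in> ?Z \<longleftrightarrow> f \<in> carrier (C (Suc n)) \<and>
      (\<forall>x \<in> carrier (?F (Suc (Suc n))). f (d (Suc n) x) = \<zero>\<^bsub>N\<^esub>)" for f
    by (auto simp: kernel_def \<delta> C_def Hom_group_def fun_eq_iff)
  have BZ: "?B \<subseteq> ?Z"
  proof
    fix f assume "f \<in> ?B"
    then obtain w where w: "w \<in> carrier (C n)" "f = ?\<delta> n w" by blast
    have "f (d (Suc n) x) = \<zero>\<^bsub>N\<^esub>" if "x \<in> carrier (?F (Suc (Suc n)))" for x
      using w that mod_hom_zero[OF F assms(2), of w]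
      by (simp add: \<delta> mod_homD(1)[OF R(3)] R(5) cC)
    then show "f \<in> ?Z" using w hom unfolding mem_Z by (auto simp: hom_def)
  qed
  interpret Cn: comm_group "C (Suc n)" by (rule G)
  interpret Z: group "(C (Suc n))\<lparr>carrier := ?Z\<rparr>"
    by (rule Cn.subgroup_imp_group[OF Z])
  interpret Z: comm_group "(C (Suc n))\<lparr>carrier := ?Z\<rparr>"
    by (rule Z.group_comm_groupI) (use subgroup.subset[OF Z] Cn.m_comm in \<open>auto simp: subset_iff\<close>)
  have "subgroup ?B ((C (Suc n))\<lparr>carrier := ?Z\<rparr>)"
    by (rule Cn.subgroup_incl[OF B Z BZ])
  then interpret B: normal ?B "(C (Suc n))\<lparr>carrier := ?Z\<rparr>"
    by (rule Z.subgroup_imp_normal)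
  have "Hom_cohomology S I d (Suc n) N = (C (Suc n))\<lparr>carrier := ?Z\<rparr> Mod ?B"
    by (simp add: Hom_cohomology_def C_def)
  then have "trivial_group (Hom_cohomology S I d (Suc n) N) \<longleftrightarrow> ?B = ?Z"
    using B.trivial_factorgroup_iff by simp
  also have "\<dots> \<longleftrightarrow> Hom_acyclic S I d n N"
  proof
    assume BZ: "?B = ?Z"
    show "Hom_acyclic S I d n N"
      unfolding Hom_acyclic_def
    proof (intro ballI impI)
      fix z assume z: "z \<in> mod_hom S (?F (Suc n)) N"
        and "\<forall>x\<in>carrier (?F (Suc (Suc n))). z (d (Suc n) x) = \<zero>\<^bsub>N\<^esub>"
      then have "restrict z (carrier (?F (Suc n))) \<in> ?Z"
        by (simp add: mem_Z r mod_homD(1)[OF R(3)])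
      then obtain w where w: "w \<in> carrier (C n)" "restrict z (carrier (?F (Suc n))) = ?\<delta> n w"
        unfolding BZ[symmetric] by blast
      have "z x = w (d n x)" if "x \<in> carrier (?F (Suc n))" for x
        using fun_cong[OF w(2), of x] that by (simp add: \<delta>)
      then show "\<exists>w\<in>mod_hom S (?F n) N. \<forall>x\<in>carrier (?F (Suc n)). z x = w (d n x)"
        using w(1) cC by blast
    qed
  next
    assume ac: "Hom_acyclic S I d n N"
    have "?Z \<subseteq> ?B"
    proof
      fix z assume z: "z \<in> ?Z"
      then obtain w where w: "w \<in> mod_hom S (?F n) N" "\<forall>x\<in>carrier (?F (Suc n)). z x = w (d n x)"
        using ac unfolding mem_Z cC Hom_acyclic_def by blast
      have "z \<in> extensional (carrier (?F (Suc n)))" using z by (simp add: mem_Z cC)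
      then have "z = ?\<delta> n (restrict w (carrier (?F n)))"
        using w(2) by (auto simp: \<delta> fun_eq_iff mod_homD(1)[OF R(3)] extensional_def)
      then show "z \<in> ?B" using r[OF w(1)] by blast
    qed
    with BZ show "?B = ?Z" by blast
  qed
  finally show ?thesis .
qed

text \<open>The identity of \<open>M\<close> is lifted degree by degree, by projectivity of the
  source and exactness of the target. The two index types may differ, which allows a restricted
  resolution to be compared with a chosen one.\<close>

lemma chain_map_exists:
  assumes "left_module S M" "free_resolution S M I d e" "free_resolution S M J d' e'"
  obtains f where "\<And>n. f n \<in> mod_hom S (free_module S (I n)) (free_module S (J n))"
    "\<And>x. x \<in> carrier (free_module S (I 0)) \<Longrightarrow> e' (f 0 x) = e x"
    "\<And>n x. x \<in> carrier (free_module S (I (Suc n))) \<Longrightarrow> d' n (f (Suc n) x) = f n (d n x)"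
proof -
  interpret M: left_module S M by fact
  note P = free_resolutionD[OF M.ring_axioms assms(1,2)]
  note Q = free_resolutionD[OF M.ring_axioms assms(1,3)]
  let ?P = "\<lambda>n. free_module S (I n)" and ?Q = "\<lambda>n. free_module S (J n)"
  have FP: "left_module S (?P n)" and FQ: "left_module S (?Q n)" for n
    by (rule left_module_free_module, rule M.ring_axioms)+
  \<comment> \<open>\<open>A\<close> carries the condition that lets the recursion continue: the
    composite of \<open>d n\<close> and \<open>f\<close> must land in the image of
    \<open>d' n\<close>. The chain relation links two stages and is therefore kept apart in
    \<open>B\<close>.\<close>
  define A where "A n f \<longleftrightarrow> f \<in> mod_hom S (?P n) (?Q n) \<and>
    (n = 0 \<longrightarrow> (\<forall>x \<in> carrier (?P 0). e' (f x) = e x)) \<and>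
    (\<forall>x \<in> carrier (?P (Suc n)). f (d n x) \<in> d' n ` carrier (?Q (Suc n)))" for n f
  define B where "B n f f' \<longleftrightarrow> (\<forall>x \<in> carrier (?P (Suc n)). d' n (f' x) = f (d n x))" for n f f'
  have "\<exists>F. \<forall>n. A n (F n) \<and> B n (F n) (F (Suc n))"
  proof (rule dependent_nat_choice)
    have "\<exists>f\<in>mod_hom S (?P 0) (?Q 0). \<forall>x\<in>carrier (?P 0). e' (f x) = e x"
      by (rule free_hom_lift[OF FQ assms(1) Q(1) P(1)]) (simp add: P(2) Q(2))
    then obtain f where f: "f \<in> mod_hom S (?P 0) (?Q 0)" "\<And>x. x \<in> carrier (?P 0) \<Longrightarrow> e' (f x) = e x"
      by blast
    have "f (d 0 x) \<in> d' 0 ` carrier (?Q (Suc 0))" if "x \<in> carrier (?P (Suc 0))" for x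
      by (rule Q(6)) (simp_all add: mod_homD(1)[OF f(1)] mod_homD(1)[OF P(3)] f(2) P(4) that)
    with f show "\<exists>f. A 0 f" by (auto simp: A_def)
  next
    fix f n assume A: "A n f"
    then have f: "f \<in> mod_hom S (?P n) (?Q n)"
      and im: "\<And>x. x \<in> carrier (?P (Suc n)) \<Longrightarrow> f (d n x) \<in> d' n ` carrier (?Q (Suc n))"
      by (auto simp: A_def)
    have "\<exists>g\<in>mod_hom S (?P (Suc n)) (?Q (Suc n)). \<forall>x\<in>carrier (?P (Suc n)). d' n (g x) = f (d n x)"
      by (rule free_hom_lift[OF FQ FQ Q(3) mod_hom_comp[OF P(3) f]]) (use im in blast)
    then obtain g where g: "g \<in> mod_hom S (?P (Suc n)) (?Q (Suc n))"
      "\<And>x. x \<in> carrier (?P (Suc n)) \<Longrightarrow> d' n (g x) = f (d n x)" by blast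
    have "g (d (Suc n) x) \<in> d' (Suc n) ` carrier (?Q (Suc (Suc n)))" if "x \<in> carrier (?P (Suc (Suc n)))" for x
      by (rule Q(7)) (simp_all add: mod_homD(1)[OF g(1)] mod_homD(1)[OF P(3)] g(2) P(5) that
          mod_hom_zero[OF FP FQ f])
    with g show "\<exists>f'. A (Suc n) f' \<and> B n f f'" by (auto simp: A_def B_def)
  qed
  then obtain F where "\<And>n. A n (F n)" "\<And>n. B n (F n) (F (Suc n))" by blast
  then show thesis using that[of F] by (simp add: A_def B_def)
qed

text \<open>The defect left at each stage is a cycle, and exactness of the target lifts it. The
  formula starts in degree one because only cohomology in positive degrees is compared.\<close>

lemma null_homotopy_exists:
  assumes "left_module S M" "free_resolution S M I d e" "free_resolution S M J d' e'"
    and f: "\<And>n. f n \<in> mod_hom S (free_module S (I n)) (free_module S (J n))"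
    and f0: "\<And>x. x \<in> carrier (free_module S (I 0)) \<Longrightarrow> e' (f 0 x) = \<zero>\<^bsub>M\<^esub>"
    and fd: "\<And>n x. x \<in> carrier (free_module S (I (Suc n))) \<Longrightarrow> d' n (f (Suc n) x) = f n (d n x)"
  shows "\<exists>s. (\<forall>n. s n \<in> mod_hom S (free_module S (I n)) (free_module S (J (Suc n)))) \<and>
    (\<forall>n. \<forall>x \<in> carrier (free_module S (I (Suc n))).
      f (Suc n) x = d' (Suc n) (s (Suc n) x) \<oplus>\<^bsub>free_module S (J (Suc n))\<^esub> s n (d n x))"
proof -
  interpret M: left_module S M by fact
  note P = free_resolutionD[OF M.ring_axioms assms(1,2)]
  note Q = free_resolutionD[OF M.ring_axioms assms(1,3)]
  let ?P = "\<lambda>n. free_module S (I n)" and ?Q = "\<lambda>n. free_module S (J n)"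
  have FP: "left_module S (?P n)" and FQ: "left_module S (?Q n)" for n
    by (rule left_module_free_module, rule M.ring_axioms)+
  interpret Q: left_module S "?Q k" for k by (rule FQ)
  \<comment> \<open>\<open>t n s\<close> is the part of \<open>f (Suc n)\<close> not yet accounted
    for by \<open>s\<close>; the next component of the homotopy has to lift it through
    \<open>d' (Suc n)\<close>. Condition \<open>A\<close> says that it is a cycle.\<close>
  define t where "t n s x = f (Suc n) x \<ominus>\<^bsub>?Q (Suc n)\<^esub> s (d n x)" for n s x
  define A where "A n s \<longleftrightarrow> s \<in> mod_hom S (?P n) (?Q (Suc n)) \<and>
    (\<forall>x \<in> carrier (?P (Suc n)). d' n (t n s x) = \<zero>\<^bsub>?Q n\<^esub>)" for n s
  define B where "B n s s' \<longleftrightarrow> (\<forall>x \<in> carrier (?P (Suc n)). d' (Suc n) (s' x) = t n s x)" for n s s'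
  have dt: "d' n (t n s x) = f n (d n x) \<ominus>\<^bsub>?Q n\<^esub> d' n (s (d n x))"
    if "s \<in> mod_hom S (?P n) (?Q (Suc n))" "x \<in> carrier (?P (Suc n))" for n s x
  proof -
    have "f (Suc n) x \<in> carrier (?Q (Suc n))" "s (d n x) \<in> carrier (?Q (Suc n))"
      using mod_homD(1)[OF f] mod_homD(1)[OF that(1)] mod_homD(1)[OF P(3)] that(2) by blast+
    from mod_hom_minus_apply[OF FQ FQ Q(3) this] show ?thesis by (simp add: t_def fd that(2))
  qed
  have "\<exists>s. \<forall>n. A n (s n) \<and> B n (s n) (s (Suc n))"
  proof (rule dependent_nat_choice)
    have "\<exists>s\<in>mod_hom S (?P 0) (?Q (Suc 0)). \<forall>x\<in>carrier (?P 0). d' 0 (s x) = f 0 x"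
      by (rule free_hom_lift[OF FQ FQ Q(3) f]) (use Q(6) mod_homD(1)[OF f] f0 in blast)
    then obtain s where s: "s \<in> mod_hom S (?P 0) (?Q (Suc 0))"
      "\<And>x. x \<in> carrier (?P 0) \<Longrightarrow> d' 0 (s x) = f 0 x" by blast
    have "d' 0 (t 0 s x) = \<zero>\<^bsub>?Q 0\<^esub>" if "x \<in> carrier (?P (Suc 0))" for x
    proof -
      have dx: "d 0 x \<in> carrier (?P 0)" using mod_homD(1)[OF P(3) that] .
      show ?thesis
        using mod_homD(1)[OF f dx] by (simp add: dt[OF s(1) that] s(2)[OF dx] a_minus_def Q.M.r_neg)
    qed
    with s show "\<exists>s. A 0 s" by (auto simp: A_def)
  next
    fix s n assume A: "A n s"
    then have s: "s \<in> mod_hom S (?P n) (?Q (Suc n))"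
      and z: "\<And>x. x \<in> carrier (?P (Suc n)) \<Longrightarrow> d' n (t n s x) = \<zero>\<^bsub>?Q n\<^esub>"
      by (auto simp: A_def)
    have t: "t n s \<in> mod_hom S (?P (Suc n)) (?Q (Suc n))"
      unfolding t_def by (rule mod_hom_minus[OF FQ f mod_hom_comp[OF P(3) s]])
    have "\<exists>s'\<in>mod_hom S (?P (Suc n)) (?Q (Suc (Suc n))). \<forall>x\<in>carrier (?P (Suc n)). d' (Suc n) (s' x) = t n s x"
      by (rule free_hom_lift[OF FQ FQ Q(3) t]) (use Q(7) mod_homD(1)[OF t] z in blast)
    then obtain s' where s': "s' \<in> mod_hom S (?P (Suc n)) (?Q (Suc (Suc n)))"
      "\<And>x. x \<in> carrier (?P (Suc n)) \<Longrightarrow> d' (Suc n) (s' x) = t n s x" by blast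
    have "d' (Suc n) (t (Suc n) s' x) = \<zero>\<^bsub>?Q (Suc n)\<^esub>" if x: "x \<in> carrier (?P (Suc (Suc n)))" for x
    proof -
      have dx: "d (Suc n) x \<in> carrier (?P (Suc n))" using mod_homD(1)[OF P(3) x] .
      have "t n s (d (Suc n) x) = f (Suc n) (d (Suc n) x)"
        using mod_homD(1)[OF f dx] by (simp add: t_def P(5)[OF x] mod_hom_zero[OF FP FQ s] a_minus_def)
      then show ?thesis
        using mod_homD(1)[OF f dx] by (simp add: dt[OF s'(1) x] s'(2)[OF dx] a_minus_def Q.M.r_neg)
    qed
    with s' show "\<exists>s'. A (Suc n) s' \<and> B n s s'" by (auto simp: A_def B_def)
  qed
  then obtain s where s: "\<And>n. s n \<in> mod_hom S (?P n) (?Q (Suc n))"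
    and ds: "\<And>n x. x \<in> carrier (?P (Suc n)) \<Longrightarrow> d' (Suc n) (s (Suc n) x) = t n (s n) x"
    by (auto simp: A_def B_def)
  have "f (Suc n) x = d' (Suc n) (s (Suc n) x) \<oplus>\<^bsub>?Q (Suc n)\<^esub> s n (d n x)" if x: "x \<in> carrier (?P (Suc n))" for n x
  proof -
    have "f (Suc n) x \<in> carrier (?Q (Suc n))" "s n (d n x) \<in> carrier (?Q (Suc n))"
      using mod_homD(1)[OF f] mod_homD(1)[OF s] mod_homD(1)[OF P(3)] x by blast+
    then show ?thesis by (simp add: ds[OF x] t_def a_minus_def Q.M.a_assoc Q.M.l_neg)
  qed
  with s show ?thesis by (intro exI[of _ s]) simp
qed

text \<open>The composite of the comparison maps differs from the identity by a null-homotopic map.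
  So a cocycle on \<open>J\<close> may be pulled back to \<open>I\<close>, bounded there, and the
  bound corrected by the homotopy.\<close>

lemma Hom_acyclic_resolution:
  assumes "left_module S M" "left_module S N"
    and "free_resolution S M I d e" "free_resolution S M J d' e'"
    and "Hom_acyclic S I d n N"
  shows "Hom_acyclic S J d' n N"
proof -
  interpret M: left_module S M by fact
  interpret N: left_module S N by fact
  note P = free_resolutionD[OF M.ring_axioms assms(1,3)]
  note Q = free_resolutionD[OF M.ring_axioms assms(1,4)]
  let ?P = "\<lambda>n. free_module S (I n)" and ?Q = "\<lambda>n. free_module S (J n)"
  have FP: "left_module S (?P n)" and FQ: "left_module S (?Q n)" for n
    by (rule left_module_free_module, rule M.ring_axioms)+
  interpret Q: left_module S "?Q k" for k by (rule FQ)
  obtain f where f: "\<And>n. f n \<in> mod_hom S (?Q n) (?P n)"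
    and f0: "\<And>x. x \<in> carrier (?Q 0) \<Longrightarrow> e (f 0 x) = e' x"
    and fd: "\<And>n x. x \<in> carrier (?Q (Suc n)) \<Longrightarrow> d n (f (Suc n) x) = f n (d' n x)"
    using chain_map_exists[OF assms(1,4,3)] by blast
  obtain g where g: "\<And>n. g n \<in> mod_hom S (?P n) (?Q n)"
    and g0: "\<And>x. x \<in> carrier (?P 0) \<Longrightarrow> e' (g 0 x) = e x"
    and gd: "\<And>n x. x \<in> carrier (?P (Suc n)) \<Longrightarrow> d' n (g (Suc n) x) = g n (d n x)"
    using chain_map_exists[OF assms(1,3,4)] by blast
  note fc = mod_homD(1)[OF f] and gc = mod_homD(1)[OF g] and dc = mod_homD(1)[OF Q(3)]
  define \<delta> where "\<delta> n x = g n (f n x) \<ominus>\<^bsub>?Q n\<^esub> x" for n x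
  have \<delta>: "\<delta> n \<in> mod_hom S (?Q n) (?Q n)" for n
    unfolding \<delta>_def by (rule mod_hom_minus[OF FQ mod_hom_comp[OF f g] mod_hom_id])
  have \<delta>0: "e' (\<delta> 0 x) = \<zero>\<^bsub>M\<^esub>" if x: "x \<in> carrier (?Q 0)" for x
    using mod_homD(1)[OF Q(1) x]
    by (simp add: \<delta>_def mod_hom_minus_apply[OF FQ assms(1) Q(1) gc[OF fc[OF x]] x] g0 f0 fc x
        M.M.minus_self)
  have \<delta>d: "d' n (\<delta> (Suc n) x) = \<delta> n (d' n x)" if x: "x \<in> carrier (?Q (Suc n))" for n x
    by (simp add: \<delta>_def mod_hom_minus_apply[OF FQ FQ Q(3) gc[OF fc[OF x]] x] gd fd fc x)
  obtain s where hs: "\<forall>n. s n \<in> mod_hom S (?Q n) (?Q (Suc n))"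
    "\<forall>n. \<forall>x \<in> carrier (?Q (Suc n)).
      \<delta> (Suc n) x = d' (Suc n) (s (Suc n) x) \<oplus>\<^bsub>?Q (Suc n)\<^esub> s n (d' n x)"
    using null_homotopy_exists[where f = \<delta>, OF assms(1,4,4) \<delta> \<delta>0 \<delta>d] by blast
  note s = hs(1)[rule_format] and \<delta>s = hs(2)[rule_format]
  note sc = mod_homD(1)[OF s]
  show ?thesis
    unfolding Hom_acyclic_def
  proof (intro ballI impI)
    fix z assume z: "z \<in> mod_hom S (?Q (Suc n)) N"
      and zd: "\<forall>x\<in>carrier (?Q (Suc (Suc n))). z (d' (Suc n) x) = \<zero>\<^bsub>N\<^esub>"
    note zc = mod_homD(1)[OF z]
    have zgd: "z (g (Suc n) (d (Suc n) x)) = \<zero>\<^bsub>N\<^esub>" if x: "x \<in> carrier (?P (Suc (Suc n)))" for x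
      using zd gc[OF x] by (simp flip: gd[OF x])
    have "\<exists>w\<in>mod_hom S (?P n) N. \<forall>x\<in>carrier (?P (Suc n)). z (g (Suc n) x) = w (d n x)"
      by (rule assms(5)[unfolded Hom_acyclic_def, rule_format, OF mod_hom_comp[OF g z]]) (rule zgd)
    then obtain w where w: "w \<in> mod_hom S (?P n) N"
      and zw: "\<And>x. x \<in> carrier (?P (Suc n)) \<Longrightarrow> z (g (Suc n) x) = w (d n x)"
      by blast
    \<comment> \<open>As \<open>z\<close> kills boundaries, applying it to the homotopy formula for
      \<open>\<delta>\<close> gives \<open>z (s n (d' n x)) = w (f n (d' n x)) - z x\<close>.
      Solving for \<open>z x\<close> dictates this witness.\<close>
    let ?w = "\<lambda>y. w (f n y) \<ominus>\<^bsub>N\<^esub> z (s n y)"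
    have wc: "?w \<in> mod_hom S (?Q n) N"
      by (rule mod_hom_minus[OF assms(2) mod_hom_comp[OF f w] mod_hom_comp[OF s z]])
    have "z x = ?w (d' n x)" if x: "x \<in> carrier (?Q (Suc n))" for x
    proof -
      have gfx: "g (Suc n) (f (Suc n) x) \<in> carrier (?Q (Suc n))" by (rule gc[OF fc[OF x]])
      have sd: "s n (d' n x) \<in> carrier (?Q (Suc n))" by (rule sc[OF dc[OF x]])
      have ds: "d' (Suc n) (s (Suc n) x) \<in> carrier (?Q (Suc n))" by (rule dc[OF sc[OF x]])
      have "z (s n (d' n x)) = z (\<delta> (Suc n) x)"
        using zd sc[OF x] zc[OF sd] by (simp add: \<delta>s[OF x] mod_homD(2)[OF z ds sd])
      also have "\<dots> = w (f n (d' n x)) \<ominus>\<^bsub>N\<^esub> z x"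
        by (simp add: \<delta>_def mod_hom_minus_apply[OF FQ assms(2) z gfx x] zw[OF fc[OF x]] fd[OF x])
      finally have "z (s n (d' n x)) = w (f n (d' n x)) \<ominus>\<^bsub>N\<^esub> z x" .
      moreover have "w (f n (d' n x)) \<in> carrier N" using mod_homD(1)[OF w fc[OF dc[OF x]]] .
      ultimately show ?thesis
        using zc[OF x] by (simp add: a_minus_def N.M.minus_add N.M.r_neg2)
    qed
    then show "\<exists>w\<in>mod_hom S (?Q n) N. \<forall>x\<in>carrier (?Q (Suc n)). z x = w (d' n x)"
      by (intro bexI[OF _ wc] ballI)
  qed
qed

text \<open>The arbitrary choice inside \<open>Ext\<close> is eliminated here: by the comparison of
  resolutions, any one of them, on any index type, decides vanishing.\<close>

lemma trivial_Ext_iff: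
  fixes S :: "('a, 's) ring_scheme" and M :: "('a, 'b, 'm) module_scheme"
  assumes "left_module S M" "left_module S N" "free_resolution S M J d e"
  shows "trivial_group (Ext S (Suc n) M N) \<longleftrightarrow> Hom_acyclic S J d n N"
proof -
  define T where "T = (SOME (I :: nat \<Rightarrow> ('a, 'b) res_basis set, d, e). free_resolution S M I d e)"
  obtain I d' e' where T: "T = (I, d', e')" by (cases T)
  have "case T of (I, d, e) \<Rightarrow> free_resolution S M I d e"
    unfolding T_def by (rule someI_ex) (use free_resolution_exists[OF assms(1)] in auto)
  then have res: "free_resolution S M I d' e'" by (simp add: T)
  have "Ext S (Suc n) M N = Hom_cohomology S I d' (Suc n) N"
    unfolding Ext_def T_def[symmetric] by (simp add: T)
  moreover have "Hom_acyclic S I d' n N \<longleftrightarrow> Hom_acyclic S J d n N"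
    by (rule iffI) (rule Hom_acyclic_resolution[OF assms(1,2) res assms(3)],
        assumption, rule Hom_acyclic_resolution[OF assms(1,2,3) res], assumption)
  ultimately show ?thesis
    using trivial_Hom_cohomology_iff[OF assms(1,2) res] by simp
qed

text \<open>Only the augmentation changes, and composing it with an isomorphism preserves its
  kernel.\<close>

lemma free_resolution_iso:
  assumes "left_module S M" "left_module S N" "free_resolution S M I d e"
    and "h \<in> mod_hom S M N" "bij_betw h (carrier M) (carrier N)"
  shows "free_resolution S N I d (\<lambda>x. h (e x))"
proof -
  interpret M: left_module S M by fact
  note R = free_resolutionD[OF M.ring_axioms assms(1,3)]
  have "h y = \<zero>\<^bsub>N\<^esub> \<longleftrightarrow> y = \<zero>\<^bsub>M\<^esub>" if "y \<in> carrier M" for y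
    using mod_hom_zero[OF assms(1,2,4)] inj_onD[OF bij_betw_imp_inj_on[OF assms(5)], of y "\<zero>\<^bsub>M\<^esub>"] that
    by auto
  then have "a_kernel (free_module S (I 0)) N (\<lambda>x. h (e x)) = a_kernel (free_module S (I 0)) M e"
    using mod_homD(1)[OF R(1)] by (auto simp: mem_a_kernel)
  moreover have "(\<lambda>x. h (e x)) ` carrier (free_module S (I 0)) = carrier N"
    by (simp add: image_image[of h e, symmetric] R(2) bij_betw_imp_surj_on[OF assms(5)])
  ultimately show ?thesis
    using assms(3) mod_hom_comp[OF R(1) assms(4)] by (simp add: free_resolution_def)
qed


section \<open>Frobenius extensions\<close>

definition restrict_scalars ::
  "('r \<Rightarrow> 's) \<Rightarrow> ('s, 'b, 'm) module_scheme \<Rightarrow> ('r, 'b) module" where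
  "restrict_scalars \<theta> M =
     \<lparr>carrier = carrier M, monoid.mult = undefined, one = undefined,
      ring.zero = \<zero>\<^bsub>M\<^esub>, add = add M, smult = (\<lambda>r x. \<theta> r \<odot>\<^bsub>M\<^esub> x)\<rparr>"

lemma restrict_scalars_sel [simp]:
  "carrier (restrict_scalars \<theta> M) = carrier M"
  "\<zero>\<^bsub>restrict_scalars \<theta> M\<^esub> = \<zero>\<^bsub>M\<^esub>"
  "x \<oplus>\<^bsub>restrict_scalars \<theta> M\<^esub> y = x \<oplus>\<^bsub>M\<^esub> y"
  "r \<odot>\<^bsub>restrict_scalars \<theta> M\<^esub> x = \<theta> r \<odot>\<^bsub>M\<^esub> x"
  by (simp_all add: restrict_scalars_def)

lemma regular_module_sel [simp]:
  "carrier (regular_module S) = carrier S"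
  "\<zero>\<^bsub>regular_module S\<^esub> = \<zero>\<^bsub>S\<^esub>"
  "x \<oplus>\<^bsub>regular_module S\<^esub> y = x \<oplus>\<^bsub>S\<^esub> y"
  "a \<odot>\<^bsub>regular_module S\<^esub> x = a \<otimes>\<^bsub>S\<^esub> x"
  by (simp_all add: regular_module_def)

lemma left_module_restrict_scalars:
  assumes "ring R" "\<theta> \<in> ring_hom R S" "left_module S M"
  shows "left_module R (restrict_scalars \<theta> M)"
proof -
  interpret M: left_module S M by fact
  have "abelian_group (restrict_scalars \<theta> M)"
  proof (rule abelian_groupI)
    fix x assume "x \<in> carrier (restrict_scalars \<theta> M)"
    then show "\<exists>y\<in>carrier (restrict_scalars \<theta> M). y \<oplus>\<^bsub>restrict_scalars \<theta> M\<^esub> x = \<zero>\<^bsub>restrict_scalars \<theta> M\<^esub>"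
      by (intro bexI[of _ "\<ominus>\<^bsub>M\<^esub> x"]) (simp_all add: M.M.l_neg)
  qed (simp_all add: M.M.a_ac)
  then show ?thesis
    by (intro left_module.intro left_module_axioms.intro assms(1))
      (simp_all add: ring_hom_memE[OF assms(2)] M.smult_l_distr M.smult_r_distr M.smult_assoc1)
qed

lemma mod_hom_restrict_scalars:
  assumes "\<theta> \<in> ring_hom R S" "f \<in> mod_hom S M N"
  shows "f \<in> mod_hom R (restrict_scalars \<theta> M) (restrict_scalars \<theta> N)"
  by (rule mod_homI) (simp_all add: mod_homD[OF assms(2)] ring_hom_memE(1)[OF assms(1)])

lemma submodule_restrict_scalars:
  assumes "\<theta> \<in> ring_hom R S" "submodule H S M" "ring R" "left_module S M"
  shows "submodule H R (restrict_scalars \<theta> M)"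
proof -
  interpret H: submodule H S M by fact
  show ?thesis
    using H.subset H.m_closed H.one_closed H.smult_closed ring_hom_memE(1)[OF assms(1)]
      H.m_inv_closed left_module_restrict_scalars[OF assms(3,1,4)]
    by (intro submoduleI) (auto simp: a_inv_def m_inv_def)
qed

lemma submodule_generated_least:
  "submodule H S M \<Longrightarrow> A \<subseteq> H \<Longrightarrow> submodule_generated S M A \<subseteq> H"
  unfolding submodule_generated_def by (rule Inter_lower) simp

text \<open>Generators over \<open>R\<close> also generate over \<open>S\<close>: their
  \<open>S\<close>-span stays inside \<open>H\<close> because \<open>H\<close> is an
  \<open>S\<close>-submodule, and it exhausts \<open>H\<close> because it is in particular an
  \<open>R\<close>-submodule containing the generators.\<close>

lemma fin_gen_restrict_scalars:
  assumes "ring R" "\<theta> \<in> ring_hom R S" "left_module S M" "submodule H S M"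
    and "fin_gen R (restrict_scalars \<theta> M) H"
  shows "fin_gen S M H"
proof -
  interpret R: ring R by fact
  interpret M: left_module S M by fact
  interpret H: submodule H S M by fact
  note RM = left_module_restrict_scalars[OF assms(1,2,3)]
  obtain l :: nat and f where f: "f \<in> mod_hom R (free_module R {..<l}) (restrict_scalars \<theta> M)"
    and im: "f ` carrier (free_module R {..<l}) = H"
    using assms(5) unfolding fin_gen_def by blast
  let ?x = "\<lambda>i. f (unit_vector R i)"
  have x: "?x i \<in> H" if "i \<in> {..<l}" for i
    using imageI[OF unit_vector_closed[OF assms(1) that], of f] im by simp
  then have "?x i \<in> carrier M" if "i \<in> {..<l}" for i using that H.subset by auto
  from free_hom_exists[where \<phi> = ?x, OF assms(3) this]
  obtain g where g: "g \<in> mod_hom S (free_module S {..<l}) M"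
    "\<forall>i\<in>{..<l}. g (unit_vector S i) = ?x i" by blast
  have F: "left_module S (free_module S {..<l})" by (rule left_module_free_module) (rule M.ring_axioms)
  have gen: "g ` carrier (free_module S {..<l}) = submodule_generated S M (?x ` {..<l})"
    using free_image_eq_submodule_generated[OF assms(3) g(1)] g(2) by simp
  have "g ` carrier (free_module S {..<l}) = H"
  proof
    show "g ` carrier (free_module S {..<l}) \<subseteq> H"
      unfolding gen by (rule submodule_generated_least[OF assms(4)]) (use x in blast)
    have sub: "submodule (g ` carrier (free_module S {..<l})) R (restrict_scalars \<theta> M)"
      by (rule submodule_restrict_scalars[OF assms(2) submodule_image[OF F assms(3) g(1)] assms(1,3)])
    have "?x ` {..<l} \<subseteq> g ` carrier (free_module S {..<l})"
    proof (rule image_subsetI)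
      fix i assume i: "i \<in> {..<l}"
      show "?x i \<in> g ` carrier (free_module S {..<l})"
        using imageI[OF unit_vector_closed[OF M.ring_axioms i], of g] g(2) i by simp
    qed
    from submodule_generated_least[OF sub this]
    show "H \<subseteq> g ` carrier (free_module S {..<l})"
      using free_image_eq_submodule_generated[OF RM f] im by simp
  qed
  with g(1) show ?thesis unfolding fin_gen_def by blast
qed

text \<open>The isomorphism \<open>\<gamma>\<close> exhibits \<open>S\<close> as a free left \<open>R\<close>-module of finite rank, and
  \<open>\<tau>\<close> identifies \<open>S\<close> with the left \<open>S\<close>-module \<open>Hom\<^sub>R(S, R)\<close>.\<close>

locale frobenius_extension =
  fixes R :: "('r, 'k) ring_scheme" and S :: "('s, 'l) ring_scheme" and \<theta> :: "'r \<Rightarrow> 's"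
    and B :: "'b set" and \<gamma> :: "('b \<Rightarrow> 'r) \<Rightarrow> 's" and \<tau> :: "'s \<Rightarrow> 'r"
  assumes ring_R: "ring R" and ring_S: "ring S" and theta: "\<theta> \<in> ring_hom R S"
    and finite_B: "finite B"
    and gamma: "\<gamma> \<in> mod_hom R (free_module R B) (restrict_scalars \<theta> (regular_module S))"
    and gamma_bij: "bij_betw \<gamma> (carrier (free_module R B)) (carrier S)"
    and tau: "\<tau> \<in> mod_hom R (restrict_scalars \<theta> (regular_module S)) (regular_module R)"
    and frobenius: "\<psi> \<in> mod_hom R (restrict_scalars \<theta> (regular_module S)) (regular_module R) \<Longrightarrow>
      \<exists>!s. s \<in> carrier S \<and> (\<forall>x\<in>carrier S. \<psi> x = \<tau> (x \<otimes>\<^bsub>S\<^esub> s))"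
begin

abbreviation res :: "('s, 'x, 'm) module_scheme \<Rightarrow> ('r, 'x) module" where
  "res \<equiv> restrict_scalars \<theta>"

sublocale R: ring R by (rule ring_R)
sublocale S: ring S by (rule ring_S)

lemma free_R: "left_module R (free_module R I)"
  and free_S: "left_module S (free_module S I)"
  and regular_R: "left_module R (regular_module R)"
  and regular_S: "left_module S (regular_module S)"
  by (intro left_module_free_module left_module_regular ring_R ring_S)+

lemma left_module_res: "left_module S M \<Longrightarrow> left_module R (res M)"
  by (rule left_module_restrict_scalars[OF ring_R theta])

lemma mod_hom_res: "f \<in> mod_hom S M N \<Longrightarrow> f \<in> mod_hom R (res M) (res N)"
  by (rule mod_hom_restrict_scalars[OF theta])

lemmas gamma_inv = mod_hom_inverse[OF free_R gamma, simplified, OF gamma_bij]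

lemma gamma_zero: "\<gamma> (\<lambda>b. \<zero>\<^bsub>R\<^esub>) = \<zero>\<^bsub>S\<^esub>"
  using mod_hom_zero[OF free_R left_module_res[OF regular_S] gamma] by (simp add: free_module_sel)

abbreviation coord :: "'s \<Rightarrow> 'b \<Rightarrow> 'r" where
  "coord \<equiv> the_inv_into (carrier (free_module R B)) \<gamma>"

lemma coord_zero: "coord \<zero>\<^bsub>S\<^esub> = (\<lambda>b. \<zero>\<^bsub>R\<^esub>)"
  using mod_hom_zero[OF left_module_res[OF regular_S] free_R gamma_inv(1)] by (simp add: free_module_sel)

text \<open>The isomorphism from the free \<open>R\<close>-module on \<open>I \<times> B\<close> to
  the free \<open>S\<close>-module on \<open>I\<close>: \<open>\<gamma>\<close> assembles each row
  of coefficients to an element of \<open>S\<close>. Contrary to common usage of the words,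
  \<open>uncurry\<close> consumes functions on pairs and its inverse \<open>curried\<close> produces
  them.\<close>

definition uncurry :: "('i \<times> 'b \<Rightarrow> 'r) \<Rightarrow> 'i \<Rightarrow> 's" where
  "uncurry h = (\<lambda>i. \<gamma> (\<lambda>b. h (i, b)))"

lemma row_closed:
  "h \<in> carrier (free_module R (I \<times> B)) \<Longrightarrow> (\<lambda>b. h (i, b)) \<in> carrier (free_module R B)"
  unfolding mem_free_module_finite[OF finite_B] by (simp add: mem_free_module)

lemma uncurry_closed:
  assumes h: "h \<in> carrier (free_module R (I \<times> B))"
  shows "uncurry h \<in> carrier (free_module S I)"
proof -
  have zero: "uncurry h i = \<zero>\<^bsub>S\<^esub>" if "\<And>b. h (i, b) = \<zero>\<^bsub>R\<^esub>" for i
    using that gamma_zero by (simp add: uncurry_def)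
  have "finite (fst ` {p. h p \<noteq> \<zero>\<^bsub>R\<^esub>})" using h by (simp add: mem_free_module)
  then have "finite {i. uncurry h i \<noteq> \<zero>\<^bsub>S\<^esub>}"
    by (rule rev_finite_subset) (use zero in force)
  moreover have "uncurry h i \<in> carrier S" for i
    using mod_homD(1)[OF gamma row_closed[OF h]] by (simp add: uncurry_def)
  moreover have "uncurry h i = \<zero>\<^bsub>S\<^esub>" if "i \<notin> I" for i
    by (rule zero) (use h that in \<open>auto simp: mem_free_module\<close>)
  ultimately show ?thesis by (simp add: mem_free_module)
qed

lemma uncurry_hom: "uncurry \<in> mod_hom R (free_module R (I \<times> B)) (res (free_module S I))"
proof (rule mod_homI)
  fix g h assume "g \<in> carrier (free_module R (I \<times> B))" "h \<in> carrier (free_module R (I \<times> B))"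
  from mod_homD(2)[OF gamma row_closed[OF this(1)] row_closed[OF this(2)]]
  show "uncurry (g \<oplus>\<^bsub>free_module R (I \<times> B)\<^esub> h) = uncurry g \<oplus>\<^bsub>res (free_module S I)\<^esub> uncurry h"
    by (simp add: uncurry_def free_module_sel)
next
  fix a h assume "a \<in> carrier R" "h \<in> carrier (free_module R (I \<times> B))"
  from mod_homD(3)[OF gamma this(1) row_closed[OF this(2)]]
  show "uncurry (a \<odot>\<^bsub>free_module R (I \<times> B)\<^esub> h) = a \<odot>\<^bsub>res (free_module S I)\<^esub> uncurry h"
    by (simp add: uncurry_def free_module_sel)
qed (simp add: uncurry_closed)

lemma uncurry_bij: "bij_betw uncurry (carrier (free_module R (I \<times> B))) (carrier (free_module S I))"
proof (rule bij_betw_byWitness[where f' = "\<lambda>f (i, b). coord (f i) b"])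
  show "\<forall>h\<in>carrier (free_module R (I \<times> B)). (\<lambda>(i, b). coord (uncurry h i) b) = h"
    by (auto simp: fun_eq_iff uncurry_def gamma_inv(2)[OF row_closed])
  have coord: "coord s \<in> carrier (free_module R B)" if "s \<in> carrier S" for s
    using gamma_inv(4) that by simp
  show "\<forall>f\<in>carrier (free_module S I). uncurry (\<lambda>(i, b). coord (f i) b) = f"
    by (auto simp: fun_eq_iff uncurry_def gamma_inv(3) mem_free_module)
  show "uncurry ` carrier (free_module R (I \<times> B)) \<subseteq> carrier (free_module S I)"
    using uncurry_closed by blast
  show "(\<lambda>f (i, b). coord (f i) b) ` carrier (free_module S I) \<subseteq> carrier (free_module R (I \<times> B))"
  proof (rule image_subsetI)
    fix f assume f: "f \<in> carrier (free_module S I)"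
    then have c: "coord (f i) \<in> carrier (free_module R B)" for i
      by (intro coord) (simp add: mem_free_module)
    have "finite ({i. f i \<noteq> \<zero>\<^bsub>S\<^esub>} \<times> B)" using f finite_B by (simp add: mem_free_module)
    then have "finite {p. (case p of (i, b) \<Rightarrow> coord (f i) b) \<noteq> \<zero>\<^bsub>R\<^esub>}"
      by (rule rev_finite_subset) (use c coord_zero in \<open>auto simp: mem_free_module\<close>)
    then show "(\<lambda>(i, b). coord (f i) b) \<in> carrier (free_module R (I \<times> B))"
      using c f coord_zero by (auto simp: mem_free_module)
  qed
qed

abbreviation curried :: "'i set \<Rightarrow> ('i \<Rightarrow> 's) \<Rightarrow> 'i \<times> 'b \<Rightarrow> 'r" where
  "curried I \<equiv> the_inv_into (carrier (free_module R (I \<times> B))) uncurry"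

lemmas curried = mod_hom_inverse[OF free_R uncurry_hom, simplified, OF uncurry_bij]

text \<open>Over \<open>R\<close>, a map into \<open>S\<close> amounts to the finitely many
  functionals given by its coordinates. Its kernel is therefore a common kernel of functionals on a
  finite free \<open>R\<close>-module, and generators over \<open>R\<close> also generate over
  \<open>S\<close>.\<close>

lemma left_coherent:
  assumes "left_coherent R"
  shows "left_coherent S"
proof (rule left_coherentI[OF ring_S])
  fix k :: nat and f assume f: "f \<in> mod_hom S (free_module S {..<k}) (regular_module S)"
  let ?F = "free_module S {..<k}" and ?P = "free_module R ({..<k} \<times> B)"
  let ?\<phi> = "\<lambda>b h. coord (f (uncurry h)) b"
  have "(\<lambda>h. h b) \<in> mod_hom R (free_module R B) (regular_module R)" for b
    by (rule mod_homI) (auto simp: free_module_sel mem_free_module)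
  then have "?\<phi> b \<in> mod_hom R ?P (regular_module R)" for b
    using mod_hom_comp[OF mod_hom_comp[OF mod_hom_comp[OF uncurry_hom mod_hom_res[OF f]] gamma_inv(1)]]
    by blast
  then have "fin_gen R ?P {h \<in> carrier ?P. \<forall>b\<in>B. ?\<phi> b h = \<zero>\<^bsub>R\<^esub>}"
    by (intro left_coherent_common_kernel assms) (simp_all add: finite_B)
  from fin_gen_image[OF this uncurry_hom]
  have gen: "fin_gen R (res ?F) (uncurry ` {h \<in> carrier ?P. \<forall>b\<in>B. ?\<phi> b h = \<zero>\<^bsub>R\<^esub>})" .
  have "(\<forall>b\<in>B. coord s b = \<zero>\<^bsub>R\<^esub>) \<longleftrightarrow> s = \<zero>\<^bsub>S\<^esub>" if s: "s \<in> carrier S" for s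
  proof
    assume *: "\<forall>b\<in>B. coord s b = \<zero>\<^bsub>R\<^esub>"
    have "coord s \<in> carrier (free_module R B)" using gamma_inv(4) s by simp
    with * have "coord s = (\<lambda>b. \<zero>\<^bsub>R\<^esub>)" by (auto simp: mem_free_module)
    then show "s = \<zero>\<^bsub>S\<^esub>" using gamma_inv(3)[of s] s gamma_zero by simp
  qed (simp add: coord_zero)
  then have "{h \<in> carrier ?P. \<forall>b\<in>B. ?\<phi> b h = \<zero>\<^bsub>R\<^esub>} = {h \<in> carrier ?P. f (uncurry h) = \<zero>\<^bsub>S\<^esub>}"
    using mod_homD(1)[OF f uncurry_closed] by auto
  moreover have "uncurry ` {h \<in> carrier ?P. f (uncurry h) = \<zero>\<^bsub>S\<^esub>} =
      {x \<in> uncurry ` carrier ?P. f x = \<zero>\<^bsub>S\<^esub>}" by blast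
  moreover have "\<dots> = a_kernel ?F (regular_module S) f"
    by (auto simp: mem_a_kernel bij_betw_imp_surj_on[OF uncurry_bij])
  ultimately show "fin_gen S ?F (a_kernel ?F (regular_module S) f)"
    using gen fin_gen_restrict_scalars[OF ring_R theta free_S submodule_a_kernel[OF free_S regular_S f]]
    by simp
qed

lemma curried_image:
  assumes "f \<in> mod_hom S (free_module S J) (free_module S I)"
  shows "(\<lambda>h. curried I (f (uncurry h))) ` carrier (free_module R (J \<times> B)) =
    curried I ` f ` carrier (free_module S J)"
  unfolding bij_betw_imp_surj_on[OF uncurry_bij, symmetric] by (simp add: image_image)

lemma curried_kernel:
  assumes "g \<in> mod_hom S (free_module S I) M"
  shows "curried I ` a_kernel (free_module S I) M g =
    a_kernel (free_module R (I \<times> B)) (res M) (\<lambda>h. g (uncurry h))"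
proof (intro equalityI subsetI)
  fix h assume h: "h \<in> a_kernel (free_module R (I \<times> B)) (res M) (\<lambda>h. g (uncurry h))"
  then have "h \<in> carrier (free_module R (I \<times> B))" by (simp add: mem_a_kernel)
  then show "h \<in> curried I ` a_kernel (free_module S I) M g"
    using h by (intro image_eqI[of _ _ "uncurry h"]) (simp_all add: mem_a_kernel curried uncurry_closed)
qed (auto simp: mem_a_kernel curried)

text \<open>Finiteness of \<open>B\<close> keeps the index sets \<open>{..<k} \<times> B\<close> and
  \<open>{..<m} \<times> B\<close> finite, so a presentation over \<open>S\<close> restricts to one
  over \<open>R\<close>.\<close>

lemma finitely_presented_res:
  assumes "finitely_presented S M"
  shows "finitely_presented R (res M)"
proof -
  from assms obtain k m :: nat and f g where M: "left_module S M"
    and f: "f \<in> mod_hom S (free_module S {..<m}) (free_module S {..<k})"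
    and g: "g \<in> mod_hom S (free_module S {..<k}) M"
    and surj: "g ` carrier (free_module S {..<k}) = carrier M"
    and ex: "f ` carrier (free_module S {..<m}) = a_kernel (free_module S {..<k}) M g"
    unfolding finitely_presented_def by blast
  let ?P = "free_module R ({..<k} \<times> B)"
  let ?f = "\<lambda>h. curried {..<k} (f (uncurry h))"
  have f': "?f \<in> mod_hom R (free_module R ({..<m} \<times> B)) ?P"
    by (rule mod_hom_comp[OF mod_hom_comp[OF uncurry_hom mod_hom_res[OF f]] curried(1)])
  show ?thesis
  proof (rule finitely_presentedI[OF left_module_res[OF M]])
    show "finite ({..<k} \<times> B)" using finite_B by simp
    show "(\<lambda>h. g (uncurry h)) \<in> mod_hom R ?P (res M)"
      by (rule mod_hom_comp[OF uncurry_hom mod_hom_res[OF g]])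
    show "(\<lambda>h. g (uncurry h)) ` carrier ?P = carrier (res M)"
      by (simp add: image_image[of g uncurry, symmetric] bij_betw_imp_surj_on[OF uncurry_bij] surj)
    have "?f ` carrier (free_module R ({..<m} \<times> B)) = a_kernel ?P (res M) (\<lambda>h. g (uncurry h))"
      unfolding curried_image[OF f] ex by (rule curried_kernel[OF g])
    then show "fin_gen R ?P (a_kernel ?P (res M) (\<lambda>h. g (uncurry h)))"
      using fin_gen_image_free[OF ring_R _ f'] finite_B by simp
  qed
qed

text \<open>Free \<open>S\<close>-modules are free over \<open>R\<close> on the enlarged index sets.
  The differentials are conjugated by \<open>uncurry\<close>, since the terms of a resolution must
  literally be free modules over \<open>R\<close>.\<close>

lemma free_resolution_res:
  assumes "left_module S M" "free_resolution S M I d e"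
  shows "free_resolution R (res M) (\<lambda>n. I n \<times> B) (\<lambda>n h. curried (I n) (d n (uncurry h)))
    (\<lambda>h. e (uncurry h))"
proof -
  note P = free_resolutionD[OF ring_S assms]
  have ex: "d 0 ` carrier (free_module S (I 1)) = a_kernel (free_module S (I 0)) M e"
    "d (Suc n) ` carrier (free_module S (I (Suc (Suc n)))) =
      a_kernel (free_module S (I (Suc n))) (free_module S (I n)) (d n)" for n
    using assms(2) by (simp_all add: free_resolution_def)
  \<comment> \<open>\<open>curried\<close> is injective, so dropping it from the differential leaves
    the kernel unchanged and brings it into the shape of \<open>curried_kernel\<close>.\<close>
  have ker: "a_kernel (free_module R (I (Suc n) \<times> B)) (free_module R (I n \<times> B))
      (\<lambda>h. curried (I n) (d n (uncurry h))) =
    a_kernel (free_module R (I (Suc n) \<times> B)) (res (free_module S (I n))) (\<lambda>h. d n (uncurry h))" for n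
  proof -
    have "curried (I n) y = \<zero>\<^bsub>free_module R (I n \<times> B)\<^esub> \<longleftrightarrow> y = \<zero>\<^bsub>free_module S (I n)\<^esub>"
      if y: "y \<in> carrier (free_module S (I n))" for y
      using curried(3)[OF y] mod_hom_zero[OF free_R left_module_res[OF free_S] uncurry_hom]
        mod_hom_zero[OF left_module_res[OF free_S] free_R curried(1)] by auto
    then show ?thesis
      using mod_homD(1)[OF P(3) uncurry_closed] by (simp add: set_eq_iff mem_a_kernel cong: conj_cong)
  qed
  show ?thesis
    unfolding free_resolution_def
  proof (intro conjI allI)
    show "(\<lambda>h. e (uncurry h)) \<in> mod_hom R (free_module R (I 0 \<times> B)) (res M)"
      by (rule mod_hom_comp[OF uncurry_hom mod_hom_res[OF P(1)]])
    show "(\<lambda>h. e (uncurry h)) ` carrier (free_module R (I 0 \<times> B)) = carrier (res M)"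
      by (simp add: image_image[of e uncurry, symmetric] bij_betw_imp_surj_on[OF uncurry_bij] P(2))
    show "(\<lambda>h. curried (I n) (d n (uncurry h))) \<in>
        mod_hom R (free_module R (I (Suc n) \<times> B)) (free_module R (I n \<times> B))" for n
      by (rule mod_hom_comp[OF mod_hom_comp[OF uncurry_hom mod_hom_res[OF P(3)]] curried(1)])
    have d0: "d 0 \<in> mod_hom S (free_module S (I 1)) (free_module S (I 0))" using P(3)[of 0] by simp
    show "(\<lambda>h. curried (I 0) (d 0 (uncurry h))) ` carrier (free_module R (I 1 \<times> B)) =
        a_kernel (free_module R (I 0 \<times> B)) (res M) (\<lambda>h. e (uncurry h))"
      unfolding curried_image[OF d0] ex by (rule curried_kernel[OF P(1)])
    show "(\<lambda>h. curried (I (Suc n)) (d (Suc n) (uncurry h))) `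
        carrier (free_module R (I (Suc (Suc n)) \<times> B)) =
      a_kernel (free_module R (I (Suc n) \<times> B)) (free_module R (I n \<times> B))
        (\<lambda>h. curried (I n) (d n (uncurry h)))" for n
      unfolding ker curried_image[OF P(3)] ex by (rule curried_kernel[OF P(3)])
  qed
qed

section \<open>The form \<open>\<tau>\<close> and ascent of the vanishing of Ext\<close>

lemma tau_eqI:
  assumes "a \<in> carrier S" "b \<in> carrier S" "\<And>x. x \<in> carrier S \<Longrightarrow> \<tau> (x \<otimes>\<^bsub>S\<^esub> a) = \<tau> (x \<otimes>\<^bsub>S\<^esub> b)"
  shows "a = b"
proof -
  have "(\<lambda>x. x \<otimes>\<^bsub>S\<^esub> a) \<in> mod_hom S (regular_module S) (regular_module S)"
    by (rule mod_homI) (simp_all add: assms S.l_distr S.m_assoc)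
  \<comment> \<open>The functional sending \<open>x\<close> to \<open>\<tau> (x \<otimes> a)\<close>
    is represented by \<open>a\<close> and by \<open>b\<close>; the uniqueness in
    \<open>frobenius\<close> makes them equal.\<close>
  from frobenius[OF mod_hom_comp[OF mod_hom_res[OF this] tau]] assms show ?thesis by blast
qed

text \<open>Half of the adjunction between restriction and coinduction, with \<open>S\<close> in
  place of the coinduced module of functionals on \<open>S\<close>. For fixed \<open>p\<close>, the
  functional sending \<open>x\<close> to \<open>\<psi> (x \<odot> p)\<close> is represented by some
  \<open>w p\<close>; nondegeneracy of the form makes \<open>w\<close> linear over
  \<open>S\<close>.\<close>

lemma tau_lift:
  assumes "left_module S M" "\<psi> \<in> mod_hom R (res M) (regular_module R)"
  shows "\<exists>w \<in> mod_hom S M (regular_module S). \<forall>p\<in>carrier M. \<tau> (w p) = \<psi> p"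
proof -
  interpret M: left_module S M by fact
  note tau_add = mod_homD(2)[OF tau, simplified]
  have "\<exists>s. s \<in> carrier S \<and> (\<forall>x\<in>carrier S. \<psi> (x \<odot>\<^bsub>M\<^esub> p) = \<tau> (x \<otimes>\<^bsub>S\<^esub> s))" if p: "p \<in> carrier M" for p
  proof -
    have "(\<lambda>x. x \<odot>\<^bsub>M\<^esub> p) \<in> mod_hom S (regular_module S) M"
      by (rule mod_homI) (simp_all add: p M.smult_l_distr M.smult_assoc1)
    from frobenius[OF mod_hom_comp[OF mod_hom_res[OF this] assms(2)]] show ?thesis by blast
  qed
  then obtain w where w: "\<And>p. p \<in> carrier M \<Longrightarrow> w p \<in> carrier S"
    and \<psi>w: "\<And>p x. p \<in> carrier M \<Longrightarrow> x \<in> carrier S \<Longrightarrow> \<psi> (x \<odot>\<^bsub>M\<^esub> p) = \<tau> (x \<otimes>\<^bsub>S\<^esub> w p)"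
    by metis
  have "w \<in> mod_hom S M (regular_module S)"
  proof (rule mod_homI)
    fix p q assume pq: "p \<in> carrier M" "q \<in> carrier M"
    have "w (p \<oplus>\<^bsub>M\<^esub> q) = w p \<oplus>\<^bsub>S\<^esub> w q"
    proof (rule tau_eqI)
      fix x assume x: "x \<in> carrier S"
      have "\<psi> (x \<odot>\<^bsub>M\<^esub> (p \<oplus>\<^bsub>M\<^esub> q)) = \<psi> (x \<odot>\<^bsub>M\<^esub> p) \<oplus>\<^bsub>R\<^esub> \<psi> (x \<odot>\<^bsub>M\<^esub> q)"
        using mod_homD(2)[OF assms(2), of "x \<odot>\<^bsub>M\<^esub> p" "x \<odot>\<^bsub>M\<^esub> q"] x pq by (simp add: M.smult_r_distr)
      then show "\<tau> (x \<otimes>\<^bsub>S\<^esub> w (p \<oplus>\<^bsub>M\<^esub> q)) = \<tau> (x \<otimes>\<^bsub>S\<^esub> (w p \<oplus>\<^bsub>S\<^esub> w q))"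
        using x pq w by (simp add: \<psi>w S.r_distr tau_add)
    qed (simp_all add: w pq)
    then show "w (p \<oplus>\<^bsub>M\<^esub> q) = w p \<oplus>\<^bsub>regular_module S\<^esub> w q" by simp
  next
    fix a p assume ap: "a \<in> carrier S" "p \<in> carrier M"
    have "w (a \<odot>\<^bsub>M\<^esub> p) = a \<otimes>\<^bsub>S\<^esub> w p"
    proof (rule tau_eqI)
      fix x assume x: "x \<in> carrier S"
      have "\<psi> (x \<odot>\<^bsub>M\<^esub> (a \<odot>\<^bsub>M\<^esub> p)) = \<psi> ((x \<otimes>\<^bsub>S\<^esub> a) \<odot>\<^bsub>M\<^esub> p)"
        using x ap by (simp add: M.smult_assoc1)
      then show "\<tau> (x \<otimes>\<^bsub>S\<^esub> w (a \<odot>\<^bsub>M\<^esub> p)) = \<tau> (x \<otimes>\<^bsub>S\<^esub> (a \<otimes>\<^bsub>S\<^esub> w p))"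
        using x ap w by (simp add: \<psi>w S.m_assoc)
    qed (simp_all add: w ap)
    then show "w (a \<odot>\<^bsub>M\<^esub> p) = a \<odot>\<^bsub>regular_module S\<^esub> w p" by simp
  qed (simp add: w)
  moreover have "\<tau> (w p) = \<psi> p" if "p \<in> carrier M" for p
    using \<psi>w[OF that S.one_closed] w[OF that] that by simp
  ultimately show ?thesis by blast
qed

text \<open>Composing a cocycle \<open>z\<close> with \<open>\<tau>\<close> gives a cocycle over
  \<open>R\<close>. The functional \<open>v\<close> that bounds it lifts through
  \<open>\<tau>\<close> to an \<open>S\<close>-linear \<open>w\<close>, and nondegeneracy of the
  form shows that \<open>w\<close> bounds \<open>z\<close>.\<close>

lemma Hom_acyclic_res:
  assumes "left_module S M" "free_resolution S M I d e"
    and "Hom_acyclic R (\<lambda>n. I n \<times> B) (\<lambda>n h. curried (I n) (d n (uncurry h))) n (regular_module R)"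
  shows "Hom_acyclic S I d n (regular_module S)"
  unfolding Hom_acyclic_def
proof (intro ballI impI)
  note P = free_resolutionD[OF ring_S assms(1,2)]
  fix z assume z: "z \<in> mod_hom S (free_module S (I (Suc n))) (regular_module S)"
    and zd: "\<forall>x\<in>carrier (free_module S (I (Suc (Suc n)))). z (d (Suc n) x) = \<zero>\<^bsub>regular_module S\<^esub>"
  note dc = mod_homD(1)[OF P(3)] and zc = mod_homD(1)[OF z]
  have tau_zero: "\<tau> \<zero>\<^bsub>S\<^esub> = \<zero>\<^bsub>R\<^esub>"
    using mod_hom_zero[OF left_module_res[OF regular_S] regular_R tau] by simp
  let ?z = "\<lambda>h. \<tau> (z (uncurry h))"
  have z': "?z \<in> mod_hom R (free_module R (I (Suc n) \<times> B)) (regular_module R)"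
    by (rule mod_hom_comp[OF mod_hom_comp[OF uncurry_hom mod_hom_res[OF z]] tau])
  have "\<exists>v\<in>mod_hom R (free_module R (I n \<times> B)) (regular_module R).
      \<forall>h\<in>carrier (free_module R (I (Suc n) \<times> B)). ?z h = v (curried (I n) (d n (uncurry h)))"
  proof (rule assms(3)[unfolded Hom_acyclic_def, rule_format, OF z'])
    fix h assume h: "h \<in> carrier (free_module R (I (Suc (Suc n)) \<times> B))"
    then show "?z (curried (I (Suc n)) (d (Suc n) (uncurry h))) = \<zero>\<^bsub>regular_module R\<^esub>"
      using zd by (simp add: curried(3) dc uncurry_closed tau_zero)
  qed
  then obtain v where v: "v \<in> mod_hom R (free_module R (I n \<times> B)) (regular_module R)"
    and zv: "\<And>h. h \<in> carrier (free_module R (I (Suc n) \<times> B)) \<Longrightarrow>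
      ?z h = v (curried (I n) (d n (uncurry h)))"
    by blast
  from tau_lift[OF free_S mod_hom_comp[OF curried(1) v]]
  obtain w where w: "w \<in> mod_hom S (free_module S (I n)) (regular_module S)"
    and \<tau>w: "\<forall>p\<in>carrier (free_module S (I n)). \<tau> (w p) = v (curried (I n) p)"
    by blast
  have \<tau>z: "\<tau> (z x) = \<tau> (w (d n x))" if x: "x \<in> carrier (free_module S (I (Suc n)))" for x
    using zv[OF curried(4)[OF x]] \<tau>w dc[OF x] by (simp add: curried(3)[OF x])
  interpret F: left_module S "free_module S (I (Suc n))" by (rule free_S)
  have "z x = w (d n x)" if x: "x \<in> carrier (free_module S (I (Suc n)))" for x
  proof (rule tau_eqI)
    show "z x \<in> carrier S" "w (d n x) \<in> carrier S"
      using zc[OF x] mod_homD(1)[OF w dc[OF x]] by simp_all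
    \<comment> \<open>Agreement under \<open>\<tau>\<close> is known for all elements, in particular
      for \<open>a \<odot> x\<close>, and all maps involved are \<open>S\<close>-linear; this
      supplies the factor \<open>a\<close> that \<open>tau_eqI\<close> demands.\<close>
    fix a assume a: "a \<in> carrier S"
    show "\<tau> (a \<otimes>\<^bsub>S\<^esub> z x) = \<tau> (a \<otimes>\<^bsub>S\<^esub> w (d n x))"
      using \<tau>z[OF F.smult_closed[OF a x]] a x
      by (simp add: mod_homD(3)[OF z] mod_homD(3)[OF w] mod_homD(3)[OF P(3)] dc)
  qed
  with w show "\<exists>w\<in>mod_hom S (free_module S (I n)) (regular_module S).
      \<forall>x\<in>carrier (free_module S (I (Suc n))). z x = w (d n x)" by blast
qed

end

text \<open>The condition whose least solution is \<open>FP_id\<close> of the regular module. With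
  it isolated, finiteness passes along an implication between two such conditions, and equality of
  dimensions along their equality.\<close>

definition Ext_vanishes :: "('a, 's) ring_scheme \<Rightarrow> nat \<Rightarrow> bool" where
  "Ext_vanishes S n \<longleftrightarrow> (\<forall>F :: ('a, (nat \<Rightarrow> 'a) set) module.
     finitely_presented S F \<longrightarrow> trivial_group (Ext S (n + 1) F (regular_module S)))"

lemma FP_id_regular:
  "FP_id S (regular_module S) =
     (if \<exists>n. Ext_vanishes S n then enat (LEAST n. Ext_vanishes S n) else \<infinity>)"
  unfolding FP_id_def Ext_vanishes_def Let_def ..

text \<open>Vanishing over \<open>R\<close> is given only for test modules in the type tied to
  \<open>R\<close>, so the restriction of \<open>F\<close> is replaced by an isomorphic
  \<open>F'\<close>. A resolution of \<open>F\<close> over \<open>S\<close>, restricted to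
  \<open>R\<close> and composed with this isomorphism, resolves \<open>F'\<close>.\<close>

lemma (in frobenius_extension) Ext_vanishes:
  assumes "Ext_vanishes R n"
  shows "Ext_vanishes S n"
  unfolding Ext_vanishes_def
proof (intro allI impI)
  fix F :: "('s, (nat \<Rightarrow> 's) set) module"
  assume fp: "finitely_presented S F"
  then have F: "left_module S F" by (simp add: finitely_presented_def)
  obtain F' :: "('r, (nat \<Rightarrow> 'r) set) module" and h where
    fp': "finitely_presented R F'" and h: "h \<in> mod_hom R (res F) F'" "bij_betw h (carrier (res F)) (carrier F')"
    using finitely_presented_representative[OF finitely_presented_res[OF fp]] by blast
  then have F': "left_module R F'" by (simp add: finitely_presented_def)
  obtain I :: "nat \<Rightarrow> ('s, (nat \<Rightarrow> 's) set) res_basis set" and d e where P: "free_resolution S F I d e"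
    using free_resolution_exists[OF F] by blast
  have "trivial_group (Ext R (Suc n) F' (regular_module R))"
    using assms fp' by (simp add: Ext_vanishes_def)
  then have "Hom_acyclic S I d n (regular_module S)"
    using trivial_Ext_iff[OF F' regular_R
        free_resolution_iso[OF left_module_res[OF F] F' free_resolution_res[OF F P] h]]
    by (intro Hom_acyclic_res[OF F P]) simp
  then show "trivial_group (Ext S (n + 1) F (regular_module S))"
    using trivial_Ext_iff[OF F regular_S P] by simp
qed

text \<open>Linearity over \<open>R\<close> determines a functional by its value at one, and since
  \<open>\<tau>\<close> inverts \<open>\<theta>\<close>, the element representing the functional is
  the image of that value under \<open>\<theta>\<close>.\<close>

lemma frobenius_extension_iso:
  assumes "ring R" "ring S" "\<theta> \<in> ring_hom R S" "bij_betw \<theta> (carrier R) (carrier S)"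
  shows "frobenius_extension R S \<theta> {()} (\<lambda>f. \<theta> (f ())) (the_inv_into (carrier R) \<theta>)"
proof -
  interpret R: ring R by fact
  interpret S: ring S by fact
  note h = ring_hom_memE[OF assms(3)]
  have reg: "left_module R (regular_module R)" "left_module S (regular_module S)"
    by (intro left_module_regular assms)+
  have "\<theta> \<in> mod_hom R (regular_module R) (restrict_scalars \<theta> (regular_module S))"
    by (rule mod_homI) (simp_all add: h)
  note inv = mod_hom_inverse[OF reg(1) this, simplified, OF assms(4)]
  let ?\<tau> = "the_inv_into (carrier R) \<theta>"
  show ?thesis
  proof
    show "(\<lambda>f. \<theta> (f ())) \<in> mod_hom R (free_module R {()}) (restrict_scalars \<theta> (regular_module S))"
      by (rule mod_homI) (simp_all add: mem_free_module free_module_sel h)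
    have c: "carrier (free_module R {()}) = {f. f () \<in> carrier R}"
      by (auto simp: mem_free_module)
    show "bij_betw (\<lambda>f. \<theta> (f ())) (carrier (free_module R {()})) (carrier S)"
      unfolding c by (rule bij_betw_byWitness[where f' = "\<lambda>s u. ?\<tau> s"]) (auto simp: inv h(1))
  next
    fix \<psi> assume \<psi>: "\<psi> \<in> mod_hom R (restrict_scalars \<theta> (regular_module S)) (regular_module R)"
    show "\<exists>!s. s \<in> carrier S \<and> (\<forall>x\<in>carrier S. \<psi> x = ?\<tau> (x \<otimes>\<^bsub>S\<^esub> s))"
    proof (rule ex1I[of _ "\<theta> (\<psi> \<one>\<^bsub>S\<^esub>)"], intro conjI ballI)
      have 1: "\<psi> \<one>\<^bsub>S\<^esub> \<in> carrier R" using mod_homD(1)[OF \<psi>] by simp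
      then show "\<theta> (\<psi> \<one>\<^bsub>S\<^esub>) \<in> carrier S" by (rule h(1))
      fix x assume x: "x \<in> carrier S"
      then have tx: "?\<tau> x \<in> carrier R" "\<theta> (?\<tau> x) = x" by (simp_all add: inv)
      have "\<psi> x = ?\<tau> x \<otimes>\<^bsub>R\<^esub> \<psi> \<one>\<^bsub>S\<^esub>"
        using mod_homD(3)[OF \<psi> tx(1), of "\<one>\<^bsub>S\<^esub>"] x tx(2) by simp
      also have "\<dots> = ?\<tau> (\<theta> (?\<tau> x \<otimes>\<^bsub>R\<^esub> \<psi> \<one>\<^bsub>S\<^esub>))" using tx(1) 1 by (simp add: inv)
      also have "\<dots> = ?\<tau> (x \<otimes>\<^bsub>S\<^esub> \<theta> (\<psi> \<one>\<^bsub>S\<^esub>))" using tx 1 by (simp add: h(2))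
      finally show "\<psi> x = ?\<tau> (x \<otimes>\<^bsub>S\<^esub> \<theta> (\<psi> \<one>\<^bsub>S\<^esub>))" .
    next
      fix s assume "s \<in> carrier S \<and> (\<forall>x\<in>carrier S. \<psi> x = ?\<tau> (x \<otimes>\<^bsub>S\<^esub> s))"
      \<comment> \<open>The assumption at the unit shows that \<open>s\<close> is mapped to the
        value of \<open>\<psi>\<close> at one by the inverse of \<open>\<theta>\<close>; applying
        \<open>\<theta>\<close> returns \<open>s\<close>.\<close>
      then show "s = \<theta> (\<psi> \<one>\<^bsub>S\<^esub>)" by (simp add: inv)
    qed
  qed (use assms inv(1) in auto)
qed

section \<open>Opposite rings and finite sums\<close>

lemma opp_ring_sel [simp]:
  "carrier (opp_ring S) = carrier S"
  "\<zero>\<^bsub>opp_ring S\<^esub> = \<zero>\<^bsub>S\<^esub>"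
  "\<one>\<^bsub>opp_ring S\<^esub> = \<one>\<^bsub>S\<^esub>"
  "x \<oplus>\<^bsub>opp_ring S\<^esub> y = x \<oplus>\<^bsub>S\<^esub> y"
  "x \<otimes>\<^bsub>opp_ring S\<^esub> y = y \<otimes>\<^bsub>S\<^esub> x"
  by (simp_all add: opp_ring_def)

lemma ring_opp_ring:
  assumes "ring S"
  shows "ring (opp_ring S)"
proof -
  interpret ring S by fact
  have "abelian_group (opp_ring S)"
  proof (rule abelian_groupI)
    fix x assume "x \<in> carrier (opp_ring S)"
    then show "\<exists>y\<in>carrier (opp_ring S). y \<oplus>\<^bsub>opp_ring S\<^esub> x = \<zero>\<^bsub>opp_ring S\<^esub>"
      by (intro bexI[of _ "\<ominus>\<^bsub>S\<^esub> x"]) (simp_all add: l_neg)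
  qed (simp_all add: a_ac)
  moreover have "monoid (opp_ring S)"
    by (rule monoidI) (simp_all add: m_assoc)
  ultimately show ?thesis
    by (rule ringI) (simp_all add: l_distr r_distr)
qed

lemma (in abelian_monoid) finsum_swap:
  assumes "finite A" "finite B" "\<And>x y. x \<in> A \<Longrightarrow> y \<in> B \<Longrightarrow> f x y \<in> carrier G"
  shows "(\<Oplus>x\<in>A. \<Oplus>y\<in>B. f x y) = (\<Oplus>y\<in>B. \<Oplus>x\<in>A. f x y)"
  using assms(1,3)
proof (induct A rule: finite_induct)
  case empty
  then show ?case using assms(2) by simp
next
  case (insert a A)
  have "(\<Oplus>x\<in>insert a A. \<Oplus>y\<in>B. f x y) = (\<Oplus>y\<in>B. f a y) \<oplus> (\<Oplus>y\<in>B. \<Oplus>x\<in>A. f x y)"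
    using insert by (subst finsum_insert) (auto intro!: finsum_closed)
  also have "\<dots> = (\<Oplus>y\<in>B. f a y \<oplus> (\<Oplus>x\<in>A. f x y))"
    by (rule finsum_addf[symmetric]) (use insert(4) in \<open>auto intro!: finsum_closed\<close>)
  also have "\<dots> = (\<Oplus>y\<in>B. \<Oplus>x\<in>insert a A. f x y)"
    by (rule finsum_cong') (use insert in \<open>auto intro!: finsum_closed\<close>)
  finally show ?case .
qed

lemma (in abelian_monoid) finsum_only:
  assumes "finite A" "a \<in> A" "f a \<in> carrier G" "\<And>x. x \<in> A \<Longrightarrow> x \<noteq> a \<Longrightarrow> f x = \<zero>"
  shows "(\<Oplus>x\<in>A. f x) = f a"
proof -
  have "(\<Oplus>x\<in>A. f x) = (\<Oplus>x\<in>{a}. f x)"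
    by (rule add.finprod_mono_neutral_cong_right) (use assms in \<open>auto simp: Pi_def, metis zero_closed\<close>)
  then show ?thesis using assms(3) by simp
qed

section \<open>Group rings of finite groups\<close>

locale finite_group_ring = R: ring R + G: group G
  for R :: "('a, 'r) ring_scheme" and G :: "('g, 'h) monoid_scheme" +
  assumes finite_G: "finite (carrier G)"
begin

abbreviation RG where "RG \<equiv> group_ring R G"

lemma carrier_RG: "carrier RG = carrier (free_module R (carrier G))"
  by (simp add: group_ring_def)

lemma mem_RG: "f \<in> carrier RG \<longleftrightarrow> (\<forall>x. f x \<in> carrier R) \<and> (\<forall>x. x \<notin> carrier G \<longrightarrow> f x = \<zero>\<^bsub>R\<^esub>)"
  unfolding carrier_RG by (rule mem_free_module_finite[OF finite_G])

lemma RG_sel: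
  "\<zero>\<^bsub>RG\<^esub> = (\<lambda>x. \<zero>\<^bsub>R\<^esub>)" "f \<oplus>\<^bsub>RG\<^esub> h = (\<lambda>x. f x \<oplus>\<^bsub>R\<^esub> h x)"
  "\<one>\<^bsub>RG\<^esub> = (\<lambda>x. if x = \<one>\<^bsub>G\<^esub> then \<one>\<^bsub>R\<^esub> else \<zero>\<^bsub>R\<^esub>)"
  by (simp_all add: group_ring_def free_module_def)

text \<open>As \<open>G\<close> is finite and the additional summands vanish, the sum over the
  support of the first factor may range over all of \<open>G\<close>, which permits substitutions in
  the summation variable.\<close>

lemma RG_mult:
  assumes "f \<in> carrier RG" "h \<in> carrier RG"
  shows "f \<otimes>\<^bsub>RG\<^esub> h =
    (\<lambda>x. if x \<in> carrier G then \<Oplus>\<^bsub>R\<^esub>y\<in>carrier G. f y \<otimes>\<^bsub>R\<^esub> h (inv\<^bsub>G\<^esub> y \<otimes>\<^bsub>G\<^esub> x) else \<zero>\<^bsub>R\<^esub>)"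
proof -
  have "(\<Oplus>\<^bsub>R\<^esub>y\<in>{y \<in> carrier G. f y \<noteq> \<zero>\<^bsub>R\<^esub>}. f y \<otimes>\<^bsub>R\<^esub> h (inv\<^bsub>G\<^esub> y \<otimes>\<^bsub>G\<^esub> x)) =
      (\<Oplus>\<^bsub>R\<^esub>y\<in>carrier G. f y \<otimes>\<^bsub>R\<^esub> h (inv\<^bsub>G\<^esub> y \<otimes>\<^bsub>G\<^esub> x))" for x
    using assms finite_G by (intro R.add.finprod_mono_neutral_cong_left) (auto simp: mem_RG)
  then show ?thesis by (simp add: group_ring_def fun_eq_iff)
qed

lemma RG_mult_apply:
  assumes "f \<in> carrier RG" "h \<in> carrier RG" "x \<in> carrier G"
  shows "(f \<otimes>\<^bsub>RG\<^esub> h) x = (\<Oplus>\<^bsub>R\<^esub>y\<in>carrier G. f y \<otimes>\<^bsub>R\<^esub> h (inv\<^bsub>G\<^esub> y \<otimes>\<^bsub>G\<^esub> x))"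
  using assms by (simp add: RG_mult)

lemma RG_mult_closed:
  assumes "f \<in> carrier RG" "h \<in> carrier RG"
  shows "f \<otimes>\<^bsub>RG\<^esub> h \<in> carrier RG"
proof -
  have "(f \<otimes>\<^bsub>RG\<^esub> h) x \<in> carrier R" for x
    using assms by (auto simp: RG_mult mem_RG intro!: R.finsum_closed)
  moreover have "(f \<otimes>\<^bsub>RG\<^esub> h) x = \<zero>\<^bsub>R\<^esub>" if "x \<notin> carrier G" for x
    using assms that by (simp add: RG_mult)
  ultimately show ?thesis by (simp add: mem_RG)
qed

lemma RG_eqI:
  assumes "f \<in> carrier RG" "h \<in> carrier RG" "\<And>x. x \<in> carrier G \<Longrightarrow> f x = h x"
  shows "f = h"
  using assms unfolding mem_RG fun_eq_iff by metis

text \<open>Left multiplication by \<open>a\<close> permutes \<open>G\<close>; this is the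
  substitution behind associativity and the antipode.\<close>

lemma finsum_translate:
  assumes "a \<in> carrier G" "\<And>x. x \<in> carrier G \<Longrightarrow> F x \<in> carrier R"
  shows "(\<Oplus>\<^bsub>R\<^esub>x\<in>carrier G. F (a \<otimes>\<^bsub>G\<^esub> x)) = (\<Oplus>\<^bsub>R\<^esub>x\<in>carrier G. F x)"
proof -
  have "(\<lambda>x. a \<otimes>\<^bsub>G\<^esub> x) ` carrier G = carrier G" by (rule G.surj_const_mult[OF assms(1)])
  then show ?thesis
    using R.finsum_reindex[of F "\<lambda>x. a \<otimes>\<^bsub>G\<^esub> x" "carrier G"] G.inj_on_cmult[OF assms(1)] assms(2)
    by simp
qed

lemma RG_mult_assoc:
  assumes "f \<in> carrier RG" "g \<in> carrier RG" "h \<in> carrier RG"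
  shows "f \<otimes>\<^bsub>RG\<^esub> g \<otimes>\<^bsub>RG\<^esub> h = f \<otimes>\<^bsub>RG\<^esub> (g \<otimes>\<^bsub>RG\<^esub> h)"
proof (rule RG_eqI)
  have c [simp]: "f x \<in> carrier R" "g x \<in> carrier R" "h x \<in> carrier R" for x
    using assms by (simp_all add: mem_RG)
  fix x assume x: "x \<in> carrier G"
  let ?S = "\<lambda>F. \<Oplus>\<^bsub>R\<^esub>y\<in>carrier G. F y"
  have "(f \<otimes>\<^bsub>RG\<^esub> g \<otimes>\<^bsub>RG\<^esub> h) x =
      ?S (\<lambda>y. ?S (\<lambda>z. f z \<otimes>\<^bsub>R\<^esub> g (inv\<^bsub>G\<^esub> z \<otimes>\<^bsub>G\<^esub> y)) \<otimes>\<^bsub>R\<^esub> h (inv\<^bsub>G\<^esub> y \<otimes>\<^bsub>G\<^esub> x))"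
    unfolding RG_mult_apply[OF RG_mult_closed[OF assms(1,2)] assms(3) x]
    by (rule R.finsum_cong') (auto simp: RG_mult_apply assms intro!: R.finsum_closed)
  also have "\<dots> = ?S (\<lambda>y. ?S (\<lambda>z. f z \<otimes>\<^bsub>R\<^esub> (g (inv\<^bsub>G\<^esub> z \<otimes>\<^bsub>G\<^esub> y) \<otimes>\<^bsub>R\<^esub> h (inv\<^bsub>G\<^esub> y \<otimes>\<^bsub>G\<^esub> x))))"
    by (rule R.finsum_cong')
      (auto simp: R.finsum_ldistr[OF finite_G] R.m_assoc intro!: R.finsum_closed)
  also have "\<dots> = ?S (\<lambda>z. ?S (\<lambda>y. f z \<otimes>\<^bsub>R\<^esub> (g (inv\<^bsub>G\<^esub> z \<otimes>\<^bsub>G\<^esub> y) \<otimes>\<^bsub>R\<^esub> h (inv\<^bsub>G\<^esub> y \<otimes>\<^bsub>G\<^esub> x))))"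
    by (rule R.finsum_swap[OF finite_G finite_G]) simp
  also have "\<dots> = ?S (\<lambda>z. f z \<otimes>\<^bsub>R\<^esub> (g \<otimes>\<^bsub>RG\<^esub> h) (inv\<^bsub>G\<^esub> z \<otimes>\<^bsub>G\<^esub> x))"
  proof (rule R.finsum_cong'[OF refl])
    have gh: "(g \<otimes>\<^bsub>RG\<^esub> h) y \<in> carrier R" for y
      using RG_mult_closed[OF assms(2,3)] by (simp add: mem_RG)
    then show "(\<lambda>z. f z \<otimes>\<^bsub>R\<^esub> (g \<otimes>\<^bsub>RG\<^esub> h) (inv\<^bsub>G\<^esub> z \<otimes>\<^bsub>G\<^esub> x)) \<in> carrier G \<rightarrow> carrier R" by simp
    fix z assume z: "z \<in> carrier G"
    \<comment> \<open>With \<open>w\<close> for \<open>inv z \<otimes> y\<close>, the inner sum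
      becomes the convolution of \<open>g\<close> and \<open>h\<close> at
      \<open>inv z \<otimes> x\<close>.\<close>
    let ?F = "\<lambda>w. g w \<otimes>\<^bsub>R\<^esub> h (inv\<^bsub>G\<^esub> w \<otimes>\<^bsub>G\<^esub> (inv\<^bsub>G\<^esub> z \<otimes>\<^bsub>G\<^esub> x))"
    have "?S (\<lambda>y. f z \<otimes>\<^bsub>R\<^esub> (g (inv\<^bsub>G\<^esub> z \<otimes>\<^bsub>G\<^esub> y) \<otimes>\<^bsub>R\<^esub> h (inv\<^bsub>G\<^esub> y \<otimes>\<^bsub>G\<^esub> x))) =
        f z \<otimes>\<^bsub>R\<^esub> ?S (\<lambda>y. g (inv\<^bsub>G\<^esub> z \<otimes>\<^bsub>G\<^esub> y) \<otimes>\<^bsub>R\<^esub> h (inv\<^bsub>G\<^esub> y \<otimes>\<^bsub>G\<^esub> x))"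
      by (rule R.finsum_rdistr[OF finite_G, symmetric]) simp_all
    also have "?S (\<lambda>y. g (inv\<^bsub>G\<^esub> z \<otimes>\<^bsub>G\<^esub> y) \<otimes>\<^bsub>R\<^esub> h (inv\<^bsub>G\<^esub> y \<otimes>\<^bsub>G\<^esub> x)) = ?S (\<lambda>y. ?F (inv\<^bsub>G\<^esub> z \<otimes>\<^bsub>G\<^esub> y))"
    proof (rule R.finsum_cong'[OF refl])
      fix y assume y: "y \<in> carrier G"
      have "inv\<^bsub>G\<^esub> (inv\<^bsub>G\<^esub> z \<otimes>\<^bsub>G\<^esub> y) \<otimes>\<^bsub>G\<^esub> (inv\<^bsub>G\<^esub> z \<otimes>\<^bsub>G\<^esub> x) = inv\<^bsub>G\<^esub> y \<otimes>\<^bsub>G\<^esub> (z \<otimes>\<^bsub>G\<^esub> (inv\<^bsub>G\<^esub> z \<otimes>\<^bsub>G\<^esub> x))"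
        using x y z by (simp add: G.inv_mult_group G.m_assoc)
      also have "z \<otimes>\<^bsub>G\<^esub> (inv\<^bsub>G\<^esub> z \<otimes>\<^bsub>G\<^esub> x) = x" using x z by (simp flip: G.m_assoc)
      finally show "g (inv\<^bsub>G\<^esub> z \<otimes>\<^bsub>G\<^esub> y) \<otimes>\<^bsub>R\<^esub> h (inv\<^bsub>G\<^esub> y \<otimes>\<^bsub>G\<^esub> x) = ?F (inv\<^bsub>G\<^esub> z \<otimes>\<^bsub>G\<^esub> y)" by simp
    qed simp
    also have "\<dots> = ?S ?F" by (rule finsum_translate) (use z in simp_all)
    also have "?S ?F = (g \<otimes>\<^bsub>RG\<^esub> h) (inv\<^bsub>G\<^esub> z \<otimes>\<^bsub>G\<^esub> x)"
      using assms x z by (simp add: RG_mult_apply)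
    finally show "?S (\<lambda>y. f z \<otimes>\<^bsub>R\<^esub> (g (inv\<^bsub>G\<^esub> z \<otimes>\<^bsub>G\<^esub> y) \<otimes>\<^bsub>R\<^esub> h (inv\<^bsub>G\<^esub> y \<otimes>\<^bsub>G\<^esub> x))) =
        f z \<otimes>\<^bsub>R\<^esub> (g \<otimes>\<^bsub>RG\<^esub> h) (inv\<^bsub>G\<^esub> z \<otimes>\<^bsub>G\<^esub> x)" .
  qed
  also have "\<dots> = (f \<otimes>\<^bsub>RG\<^esub> (g \<otimes>\<^bsub>RG\<^esub> h)) x"
    using assms x by (simp add: RG_mult_apply RG_mult_closed)
  finally show "(f \<otimes>\<^bsub>RG\<^esub> g \<otimes>\<^bsub>RG\<^esub> h) x = (f \<otimes>\<^bsub>RG\<^esub> (g \<otimes>\<^bsub>RG\<^esub> h)) x" .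
qed (intro RG_mult_closed assms)+

definition scalar :: "'a \<Rightarrow> 'g \<Rightarrow> 'a" where
  "scalar r = (\<lambda>x. if x = \<one>\<^bsub>G\<^esub> then r else \<zero>\<^bsub>R\<^esub>)"

lemma scalar_closed: "r \<in> carrier R \<Longrightarrow> scalar r \<in> carrier RG"
  by (auto simp: scalar_def mem_RG)

text \<open>Only the summand at the identity survives. Restricted scalars hence act coordinatewise,
  which is why the identity map can serve as \<open>\<gamma>\<close> for the group ring.\<close>

lemma scalar_mult:
  assumes "r \<in> carrier R" "f \<in> carrier RG"
  shows "scalar r \<otimes>\<^bsub>RG\<^esub> f = (\<lambda>x. r \<otimes>\<^bsub>R\<^esub> f x)"
proof (rule RG_eqI)
  show "scalar r \<otimes>\<^bsub>RG\<^esub> f \<in> carrier RG" by (intro RG_mult_closed scalar_closed assms)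
  show "(\<lambda>x. r \<otimes>\<^bsub>R\<^esub> f x) \<in> carrier RG" using assms by (simp add: mem_RG)
  fix x assume x: "x \<in> carrier G"
  have "(scalar r \<otimes>\<^bsub>RG\<^esub> f) x = scalar r \<one>\<^bsub>G\<^esub> \<otimes>\<^bsub>R\<^esub> f (inv\<^bsub>G\<^esub> \<one>\<^bsub>G\<^esub> \<otimes>\<^bsub>G\<^esub> x)"
    unfolding RG_mult_apply[OF scalar_closed[OF assms(1)] assms(2) x]
    by (rule R.finsum_only[OF finite_G]) (use assms in \<open>auto simp: scalar_def mem_RG\<close>)
  then show "(scalar r \<otimes>\<^bsub>RG\<^esub> f) x = r \<otimes>\<^bsub>R\<^esub> f x" using x by (simp add: scalar_def)
qed

lemma ring_RG: "ring RG"
proof (rule ringI)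
  show "abelian_group RG"
  proof (rule abelian_groupI)
    fix f assume "f \<in> carrier RG"
    then show "\<exists>g\<in>carrier RG. g \<oplus>\<^bsub>RG\<^esub> f = \<zero>\<^bsub>RG\<^esub>"
      by (intro bexI[of _ "\<lambda>x. \<ominus>\<^bsub>R\<^esub> f x"]) (simp_all add: mem_RG RG_sel R.l_neg)
  qed (simp_all add: mem_RG RG_sel R.a_ac fun_eq_iff)
  have one: "\<one>\<^bsub>RG\<^esub> = scalar \<one>\<^bsub>R\<^esub>" by (simp add: RG_sel scalar_def)
  show "monoid RG"
  proof (rule monoidI)
    fix f assume f: "f \<in> carrier RG"
    show "\<one>\<^bsub>RG\<^esub> \<otimes>\<^bsub>RG\<^esub> f = f"
      unfolding one scalar_mult[OF R.one_closed f] using f by (simp add: mem_RG)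
    have 1: "\<one>\<^bsub>RG\<^esub> \<in> carrier RG" unfolding one by (rule scalar_closed) simp
    show "f \<otimes>\<^bsub>RG\<^esub> \<one>\<^bsub>RG\<^esub> = f"
    proof (rule RG_eqI[OF RG_mult_closed[OF f 1] f])
      fix x assume x: "x \<in> carrier G"
      \<comment> \<open>The unit is supported at the identity of \<open>G\<close>, so only the
        summand \<open>y = x\<close> survives.\<close>
      have z: "inv\<^bsub>G\<^esub> y \<otimes>\<^bsub>G\<^esub> x \<noteq> \<one>\<^bsub>G\<^esub>" if "y \<in> carrier G" "y \<noteq> x" for y
        using that x by (metis G.inv_equality G.inv_inv G.inv_closed)
      have "(f \<otimes>\<^bsub>RG\<^esub> \<one>\<^bsub>RG\<^esub>) x = f x \<otimes>\<^bsub>R\<^esub> \<one>\<^bsub>RG\<^esub> (inv\<^bsub>G\<^esub> x \<otimes>\<^bsub>G\<^esub> x)"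
        unfolding RG_mult_apply[OF f 1 x]
        by (rule R.finsum_only[OF finite_G x]) (use f z in \<open>auto simp: RG_sel mem_RG\<close>)
      then show "(f \<otimes>\<^bsub>RG\<^esub> \<one>\<^bsub>RG\<^esub>) x = f x" using f x by (simp add: RG_sel mem_RG)
    qed
  qed (simp_all add: RG_mult_closed RG_mult_assoc one scalar_closed)
  fix f g h assume f: "f \<in> carrier RG" and g: "g \<in> carrier RG" and h: "h \<in> carrier RG"
  have c [simp]: "f x \<in> carrier R" "g x \<in> carrier R" "h x \<in> carrier R" for x
    using f g h by (simp_all add: mem_RG)
  have add: "f \<oplus>\<^bsub>RG\<^esub> g \<in> carrier RG" using f g by (simp add: mem_RG RG_sel)
  have addR: "p \<oplus>\<^bsub>RG\<^esub> q \<in> carrier RG" if "p \<in> carrier RG" "q \<in> carrier RG" for p q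
    using that by (simp add: mem_RG RG_sel)
  show "(f \<oplus>\<^bsub>RG\<^esub> g) \<otimes>\<^bsub>RG\<^esub> h = f \<otimes>\<^bsub>RG\<^esub> h \<oplus>\<^bsub>RG\<^esub> g \<otimes>\<^bsub>RG\<^esub> h"
  proof (rule RG_eqI)
    fix x assume x: "x \<in> carrier G"
    have "((f \<oplus>\<^bsub>RG\<^esub> g) \<otimes>\<^bsub>RG\<^esub> h) x = (\<Oplus>\<^bsub>R\<^esub>y\<in>carrier G. f y \<otimes>\<^bsub>R\<^esub> h (inv\<^bsub>G\<^esub> y \<otimes>\<^bsub>G\<^esub> x) \<oplus>\<^bsub>R\<^esub> g y \<otimes>\<^bsub>R\<^esub> h (inv\<^bsub>G\<^esub> y \<otimes>\<^bsub>G\<^esub> x))"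
      unfolding RG_mult_apply[OF add h x]
      by (rule R.finsum_cong') (auto simp: RG_sel R.l_distr)
    also have "\<dots> = (f \<otimes>\<^bsub>RG\<^esub> h \<oplus>\<^bsub>RG\<^esub> g \<otimes>\<^bsub>RG\<^esub> h) x"
      using f g h x by (simp add: RG_mult_apply RG_sel R.finsum_addf)
    finally show "((f \<oplus>\<^bsub>RG\<^esub> g) \<otimes>\<^bsub>RG\<^esub> h) x = (f \<otimes>\<^bsub>RG\<^esub> h \<oplus>\<^bsub>RG\<^esub> g \<otimes>\<^bsub>RG\<^esub> h) x" .
  qed (intro RG_mult_closed addR f g h)+
  show "h \<otimes>\<^bsub>RG\<^esub> (f \<oplus>\<^bsub>RG\<^esub> g) = h \<otimes>\<^bsub>RG\<^esub> f \<oplus>\<^bsub>RG\<^esub> h \<otimes>\<^bsub>RG\<^esub> g"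
  proof (rule RG_eqI)
    fix x assume x: "x \<in> carrier G"
    have "(h \<otimes>\<^bsub>RG\<^esub> (f \<oplus>\<^bsub>RG\<^esub> g)) x = (\<Oplus>\<^bsub>R\<^esub>y\<in>carrier G. h y \<otimes>\<^bsub>R\<^esub> f (inv\<^bsub>G\<^esub> y \<otimes>\<^bsub>G\<^esub> x) \<oplus>\<^bsub>R\<^esub> h y \<otimes>\<^bsub>R\<^esub> g (inv\<^bsub>G\<^esub> y \<otimes>\<^bsub>G\<^esub> x))"
      unfolding RG_mult_apply[OF h add x]
      by (rule R.finsum_cong') (auto simp: RG_sel R.r_distr)
    also have "\<dots> = (h \<otimes>\<^bsub>RG\<^esub> f \<oplus>\<^bsub>RG\<^esub> h \<otimes>\<^bsub>RG\<^esub> g) x"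
      using f g h x by (simp add: RG_mult_apply RG_sel R.finsum_addf)
    finally show "(h \<otimes>\<^bsub>RG\<^esub> (f \<oplus>\<^bsub>RG\<^esub> g)) x = (h \<otimes>\<^bsub>RG\<^esub> f \<oplus>\<^bsub>RG\<^esub> h \<otimes>\<^bsub>RG\<^esub> g) x" .
  qed (intro RG_mult_closed addR f g h)+
qed

lemma scalar_hom: "scalar \<in> ring_hom R RG"
proof (rule ring_hom_memI)
  fix r s assume "r \<in> carrier R" "s \<in> carrier R"
  then show "scalar (r \<otimes>\<^bsub>R\<^esub> s) = scalar r \<otimes>\<^bsub>RG\<^esub> scalar s"
    by (auto simp: scalar_mult scalar_closed) (auto simp: scalar_def)
next
  show "scalar r \<in> carrier RG" if "r \<in> carrier R" for r by (rule scalar_closed[OF that])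
qed (auto simp: scalar_def RG_sel fun_eq_iff)

text \<open>The form \<open>\<tau>\<close> is the coefficient of the identity; a functional \<open>\<psi>\<close> is represented
  by \<open>\<Sum>\<^sub>g \<psi>(g) g\<^sup>-\<^sup>1\<close>.\<close>

lemma frobenius_extension_RG:
  "frobenius_extension R RG scalar (carrier G) (\<lambda>f. f) (\<lambda>f. f \<one>\<^bsub>G\<^esub>)"
proof -
  interpret RG: ring RG by (rule ring_RG)
  let ?F = "free_module R (carrier G)" and ?\<tau> = "\<lambda>f :: 'g \<Rightarrow> 'a. f \<one>\<^bsub>G\<^esub>"
  let ?res = "restrict_scalars scalar (regular_module RG)"
  have reg: "left_module R (regular_module R)" by (rule left_module_regular) (rule R.ring_axioms)
  have id: "(\<lambda>f. f) \<in> mod_hom R ?F ?res"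
    by (rule mod_homI) (simp_all add: carrier_RG[symmetric] scalar_mult, simp_all add: RG_sel free_module_sel)
  have tau: "?\<tau> \<in> mod_hom R ?res (regular_module R)"
    by (rule mod_homI) (simp_all add: scalar_mult, simp_all add: RG_sel mem_RG)
  show ?thesis
  proof
    fix \<psi> assume \<psi>: "\<psi> \<in> mod_hom R ?res (regular_module R)"
    define s where "s = (\<lambda>x. if x \<in> carrier G then \<psi> (unit_vector R (inv\<^bsub>G\<^esub> x)) else \<zero>\<^bsub>R\<^esub>)"
    have u: "unit_vector R g \<in> carrier RG" if "g \<in> carrier G" for g
      unfolding carrier_RG by (rule unit_vector_closed[OF R.ring_axioms that])
    have s: "s \<in> carrier RG"
      using mod_homD(1)[OF \<psi>] u by (simp add: mem_RG s_def)
    \<comment> \<open>Pairing with the group element \<open>g\<close> reads off the coefficient at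
      its inverse. On the basis this shows that \<open>s\<close> represents \<open>\<psi>\<close>,
      and for any other representing \<open>t\<close> it fixes every coefficient.\<close>
    have unit: "?\<tau> (unit_vector R g \<otimes>\<^bsub>RG\<^esub> t) = t (inv\<^bsub>G\<^esub> g)" if g: "g \<in> carrier G" and t: "t \<in> carrier RG" for g t
    proof -
      have tc: "t x \<in> carrier R" for x using t by (simp add: mem_RG)
      have "(unit_vector R g \<otimes>\<^bsub>RG\<^esub> t) \<one>\<^bsub>G\<^esub> = unit_vector R g g \<otimes>\<^bsub>R\<^esub> t (inv\<^bsub>G\<^esub> g \<otimes>\<^bsub>G\<^esub> \<one>\<^bsub>G\<^esub>)"
        unfolding RG_mult_apply[OF u[OF g] t G.one_closed]
        by (rule R.finsum_only[OF finite_G g]) (use tc in \<open>auto simp: unit_vector_def\<close>)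
      then show ?thesis using g tc by (simp add: unit_vector_def)
    qed
    have right: "(\<lambda>x. ?\<tau> (x \<otimes>\<^bsub>RG\<^esub> s)) \<in> mod_hom R ?F (regular_module R)"
    proof (rule mod_hom_comp[OF id mod_hom_comp[OF _ tau]])
      have "(\<lambda>x. x \<otimes>\<^bsub>RG\<^esub> s) \<in> mod_hom RG (regular_module RG) (regular_module RG)"
        by (rule mod_homI) (simp_all add: s RG.l_distr RG.m_assoc)
      from mod_hom_restrict_scalars[OF scalar_hom this]
      show "(\<lambda>x. x \<otimes>\<^bsub>RG\<^esub> s) \<in> mod_hom R ?res ?res" .
    qed
    have "\<psi> x = ?\<tau> (x \<otimes>\<^bsub>RG\<^esub> s)" if "x \<in> carrier RG" for x
    proof (rule free_hom_eqI[OF reg mod_hom_comp[OF id \<psi>] right])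
      fix g assume "g \<in> carrier G"
      then show "\<psi> (unit_vector R g) = ?\<tau> (unit_vector R g \<otimes>\<^bsub>RG\<^esub> s)"
        by (simp add: unit s) (simp add: s_def)
    qed (use that in \<open>simp add: carrier_RG\<close>)
    moreover have "t = s" if t: "t \<in> carrier RG" "\<forall>x\<in>carrier RG. \<psi> x = ?\<tau> (x \<otimes>\<^bsub>RG\<^esub> t)" for t
    proof (rule RG_eqI[OF t(1) s])
      fix x assume x: "x \<in> carrier G"
      then show "t x = s x"
        using t(2) u[of "inv\<^bsub>G\<^esub> x"] unit[of "inv\<^bsub>G\<^esub> x" t] t(1) by (simp add: s_def)
    qed
    ultimately show "\<exists>!s. s \<in> carrier RG \<and> (\<forall>x\<in>carrier RG. \<psi> x = ?\<tau> (x \<otimes>\<^bsub>RG\<^esub> s))"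
      using s by (intro ex1I[of _ s]) auto
  qed (use ring_RG R.ring_axioms scalar_hom finite_G id tau in \<open>auto simp: carrier_RG bij_betw_def\<close>)
qed

section \<open>The antipode and the opposite group ring\<close>

definition antipode :: "('g \<Rightarrow> 'a) \<Rightarrow> 'g \<Rightarrow> 'a" where
  "antipode f = (\<lambda>x. if x \<in> carrier G then f (inv\<^bsub>G\<^esub> x) else \<zero>\<^bsub>R\<^esub>)"

lemma antipode_closed: "f \<in> carrier RG \<Longrightarrow> antipode f \<in> carrier RG"
  by (simp add: antipode_def mem_RG)

lemma antipode_bij: "bij_betw antipode (carrier RG) (carrier RG)"
  by (rule bij_betw_byWitness[of _ antipode]) (auto simp: antipode_closed, auto simp: antipode_def mem_RG fun_eq_iff)

text \<open>Inversion reverses products in \<open>G\<close>, and commutativity of \<open>R\<close>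
  allows the coefficients to be reversed as well.\<close>

lemma antipode_mult:
  assumes "cring R" "f \<in> carrier RG" "h \<in> carrier RG"
  shows "antipode (f \<otimes>\<^bsub>RG\<^esub> h) = antipode h \<otimes>\<^bsub>RG\<^esub> antipode f"
proof (rule RG_eqI)
  interpret cring R by fact
  have c [simp]: "f x \<in> carrier R" "h x \<in> carrier R" for x
    using assms(2,3) by (simp_all add: mem_RG)
  fix x assume x: "x \<in> carrier G"
  let ?F = "\<lambda>z. antipode h z \<otimes>\<^bsub>R\<^esub> antipode f (inv\<^bsub>G\<^esub> z \<otimes>\<^bsub>G\<^esub> x)"
  have "antipode (f \<otimes>\<^bsub>RG\<^esub> h) x = (\<Oplus>\<^bsub>R\<^esub>y\<in>carrier G. f y \<otimes>\<^bsub>R\<^esub> h (inv\<^bsub>G\<^esub> y \<otimes>\<^bsub>G\<^esub> inv\<^bsub>G\<^esub> x))"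
    using x by (simp add: antipode_def RG_mult_apply assms)
  \<comment> \<open>Substituting \<open>z = x \<otimes> y\<close> turns
    \<open>antipode f (inv z \<otimes> x)\<close> into \<open>f y\<close> and
    \<open>antipode h z\<close> into \<open>h (inv y \<otimes> inv x)\<close>.\<close>
  also have "\<dots> = (\<Oplus>\<^bsub>R\<^esub>y\<in>carrier G. ?F (x \<otimes>\<^bsub>G\<^esub> y))"
  proof (rule R.finsum_cong'[OF refl])
    fix y assume y: "y \<in> carrier G"
    have "inv\<^bsub>G\<^esub> (x \<otimes>\<^bsub>G\<^esub> y) \<otimes>\<^bsub>G\<^esub> x = inv\<^bsub>G\<^esub> y"
      using x y by (simp add: G.inv_mult_group G.m_assoc)
    then show "f y \<otimes>\<^bsub>R\<^esub> h (inv\<^bsub>G\<^esub> y \<otimes>\<^bsub>G\<^esub> inv\<^bsub>G\<^esub> x) = ?F (x \<otimes>\<^bsub>G\<^esub> y)"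
      using x y by (simp add: antipode_def G.inv_mult_group m_comm)
  qed (use x in \<open>auto simp: antipode_def\<close>)
  also have "\<dots> = (\<Oplus>\<^bsub>R\<^esub>z\<in>carrier G. ?F z)"
    by (rule finsum_translate[OF x]) (simp add: antipode_def)
  also have "\<dots> = (antipode h \<otimes>\<^bsub>RG\<^esub> antipode f) x"
    using x assms by (simp add: RG_mult_apply antipode_closed)
  finally show "antipode (f \<otimes>\<^bsub>RG\<^esub> h) x = (antipode h \<otimes>\<^bsub>RG\<^esub> antipode f) x" .
qed (intro antipode_closed RG_mult_closed assms)+

text \<open>Vanishing of Ext passes only from the base of an extension upwards, so both directions
  of the isomorphism are wanted in order to equate the left and right conditions.\<close>

lemma antipode_hom:
  assumes "cring R"
  shows "antipode \<in> ring_hom RG (opp_ring RG)" "antipode \<in> ring_hom (opp_ring RG) RG"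
proof -
  have "antipode (f \<oplus>\<^bsub>RG\<^esub> h) = antipode f \<oplus>\<^bsub>RG\<^esub> antipode h" for f h
    by (simp add: antipode_def RG_sel fun_eq_iff)
  moreover have "antipode \<one>\<^bsub>RG\<^esub> = \<one>\<^bsub>RG\<^esub>"
    by (auto simp: antipode_def RG_sel fun_eq_iff)
  ultimately show "antipode \<in> ring_hom RG (opp_ring RG)" "antipode \<in> ring_hom (opp_ring RG) RG"
    by (auto intro!: ring_hom_memI simp: antipode_closed antipode_mult assms)
qed

end

theorem proposition5p1:
  fixes R :: "('a, 'r) ring_scheme" and G :: "('g, 'h) monoid_scheme"
  assumes "cring R" and "Ding_Chen_ring R"
    and "group G" and "finite (carrier G)"
  shows "Ding_Chen_ring (group_ring R G)"
proof -
  have ring: "ring R" using assms(1) by (rule cring.axioms)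
  interpret finite_group_ring R G
    by (intro finite_group_ring.intro finite_group_ring_axioms.intro ring assms)
  have opp: "ring (opp_ring RG)" by (rule ring_opp_ring[OF ring_RG])
  interpret A: frobenius_extension R RG scalar "carrier G" "\<lambda>f. f" "\<lambda>f. f \<one>\<^bsub>G\<^esub>"
    by (rule frobenius_extension_RG)
  interpret B: frobenius_extension RG "opp_ring RG" antipode "{()}" "\<lambda>f. antipode (f ())"
    "the_inv_into (carrier RG) antipode"
    by (rule frobenius_extension_iso[OF ring_RG opp antipode_hom(1)[OF assms(1)]])
      (simp add: antipode_bij)
  interpret C: frobenius_extension "opp_ring RG" RG antipode "{()}" "\<lambda>f. antipode (f ())"
    "the_inv_into (carrier (opp_ring RG)) antipode"
    by (rule frobenius_extension_iso[OF opp ring_RG antipode_hom(2)[OF assms(1)]])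
      (simp add: antipode_bij)
  obtain n :: nat where coh: "left_coherent R" and "FP_id R (regular_module R) = enat n"
    using assms(2) by (auto simp: Ding_Chen_ring_def)
  then obtain m where "Ext_vanishes R m" by (auto simp: FP_id_regular split: if_splits)
  \<comment> \<open>Only finiteness is taken from \<open>R\<close>; the value of the dimension is
    the least degree for \<open>RG\<close> itself.\<close>
  then have ex: "\<exists>m. Ext_vanishes RG m" using A.Ext_vanishes by blast
  \<comment> \<open>The two conditions imply each other in every degree, so their least solutions,
    the left and right dimensions, coincide.\<close>
  have "Ext_vanishes (opp_ring RG) = Ext_vanishes RG"
    using B.Ext_vanishes C.Ext_vanishes by blast
  then have "FP_id (opp_ring RG) (regular_module (opp_ring RG)) = FP_id RG (regular_module RG)"
    by (simp add: FP_id_regular)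
  moreover have "FP_id RG (regular_module RG) = enat (LEAST m. Ext_vanishes RG m)"
    using ex by (simp add: FP_id_regular)
  moreover have "left_coherent RG" by (rule A.left_coherent[OF coh])
  moreover have "right_coherent RG"
    unfolding right_coherent_def by (rule B.left_coherent) fact
  ultimately show ?thesis using ring_RG by (simp add: Ding_Chen_ring_def)
qed

end
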